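(* Let $\mathcal{A}=\{A_1,\dots,A_m\}$ be a finite family of real $d\times d$ matrices with joint spectral radius $\rho(\mathcal{A})=1$. Suppose that $\mathcal{A}$ is reducible and that, in a suitable basis, its block upper triangular form has exactly two diagonal blocks, i.e. $$A_j=\begin{pmatrix} A_j^{(1)} & * \\ 0 & A_j^{(2)}\end{pmatrix},\qquad j=1,\dots,m,$$ with the same block sizes for all $j$ and with both families $\mathcal{A}^{(i)}=\{A_1^{(i)},\dots,A_m^{(i)}\}$, $i=1,2$, irreducible. Suppose also that each of the families $\mathcal{A}^{(1)}$ and $\mathcal{A}^{(2)}$ has a dominant word whose corresponding product has a unique and simple leading eigenvalue. Then $\mathcal{A}$ is marginally unstable if and only if both of the following conditions hold: 1) the dominant words of $\mathcal{A}^{(1)}$ and of $\mathcal{A}^{(2)}$ coincide up to a cyclic permutation; 2) denoting by $\pi$ this common dominant word, the leading eigenvalues of the products $\pi(\mathcal{A}^{(1)})$ and $\pi(\mathcal{A}^{(2)})$ are equal, and the product $\pi(\mathcal{A})$ has a nontrivial Jordan block (i.e. of size at least $2$) with this eigenvalue. Moreover, if conditions 1) and 2) are satisfied, then $\mathcal{A}$ has linear growth: $M_k(\mathcal{A})\asymp k$, $k\in\mathbb{N}$, i.e. there are constants $C_1,C_2>0$ such that $C_1k\le M_k(\mathcal{A})\le C_2k$ for all $k\in\mathbb{N}$.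
   Context: For a compact family $\mathcal{A}$ of real $d\times d$ matrices, put $M_k(\mathcal{A})=\max\{\|A(k)\cdots A(1)\| : A(j)\in\mathcal{A},\ j=1,\dots,k\}$ for a fixed matrix norm (the choice is immaterial up to constants). The joint spectral radius is $\rho(\mathcal{A})=\lim_{k\to\infty}M_k(\mathcal{A})^{1/k}$. A family is called normalized if its joint spectral radius equals $1$; the normalized family associated with $\mathcal{A}$ is obtained by dividing each matrix by $\rho(\mathcal{A})$. The discrete time switching system associated with $\mathcal{A}$ is $x(k+1)=A(k)x(k)$, $x(0)=x_0$, where $A(k)\in\mathcal{A}$ is an arbitrary sequence (switching law); the sequences $x(k)$ are its trajectories. When $\rho(\mathcal{A})=1$, the system (or the family $\mathcal{A}$) is called marginally stable if all its trajectories are bounded, and marginally unstable otherwise. A family of $d\times d$ matrices is reducible if all its matrices share a common nontrivial (i.e. different from $\{0\}$ and $\mathbb{R}^d$) invariant subspace; otherwise it is irreducible. Words: to a family $\mathcal{B}=\{B_1,\dots,B_m\}$ associate an alphabet $\{a_1,\dots,a_m\}$. To a word $\pi=a_{d_1}\cdots a_{d_n}$ corresponds the product $\pi(\mathcal{B})=B_{d_1}\cdots B_{d_n}$. The families $\mathcal{A},\mathcal{A}^{(1)},\mathcal{A}^{(2)}$ are all indexed by the same alphabet ($a_j$ corresponds to $A_j$, $A_j^{(1)}$, $A_j^{(2)}$ respectively). A nonempty word is simple if it is not a power of a shorter word. A simple word $\pi$ (and the product $\pi(\mathcal{B})$) is dominant for $\mathcal{B}$ if there is a constant $q<1$ such that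 the spectral radius of each product of matrices of the normalized family of $\mathcal{B}$ is smaller than $q$, unless the word of this product is a power of $\pi$ or of one of its cyclic permutations. (A dominant word is considered up to cyclic permutation.) A leading eigenvalue of a matrix is an eigenvalue of largest modulus. It is called unique and simple if it is the only eigenvalue of largest modulus and has algebraic multiplicity one; if it is non-real, uniqueness means that there are exactly two leading eigenvalues, complex conjugate to each other (and both are simple). *)

theory Defs
  imports "Jordan_Normal_Form.Spectral_Radius"
begin

text \<open>
  A family of \<open>m\<close> real \<open>n \<times> n\<close> matrices is a function \<open>B :: nat \<Rightarrow> real mat\<close> of which only the
  values \<open>B 0, \<dots>, B (m - 1)\<close> matter. The alphabet is \<open>{..<m}\<close>, so that different letters may carry
  the same matrix, and a word is a list over it.
\<close>

definition words :: "nat \<Rightarrow> nat list set" where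
  "words m = {w. set w \<subseteq> {..<m}}"

definition word_prod :: "nat \<Rightarrow> (nat \<Rightarrow> real mat) \<Rightarrow> nat list \<Rightarrow> real mat" where
  "word_prod n B w = foldr (\<lambda>j X. B j * X) w (1\<^sub>m n)"

definition word_pow :: "nat list \<Rightarrow> nat \<Rightarrow> nat list" where
  "word_pow u k = concat (replicate k u)"

definition simple_word :: "nat list \<Rightarrow> bool" where
  "simple_word w \<longleftrightarrow> w \<noteq> [] \<and> \<not> (\<exists>u k. length u < length w \<and> w = word_pow u k)"

definition cyclic_perm :: "nat list \<Rightarrow> nat list \<Rightarrow> bool" where
  "cyclic_perm u v \<longleftrightarrow> (\<exists>r. v = rotate r u)"

definition mat_norm :: "nat \<Rightarrow> (real mat \<Rightarrow> real) \<Rightarrow> bool" where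
  "mat_norm n N \<longleftrightarrow>
     (\<forall>X \<in> carrier_mat n n. N X \<ge> 0 \<and> (N X = 0 \<longleftrightarrow> X = 0\<^sub>m n n)) \<and>
     (\<forall>c. \<forall>X \<in> carrier_mat n n. N (c \<cdot>\<^sub>m X) = \<bar>c\<bar> * N X) \<and>
     (\<forall>X \<in> carrier_mat n n. \<forall>Y \<in> carrier_mat n n. N (X + Y) \<le> N X + N Y)"

definition max_growth ::
  "(real mat \<Rightarrow> real) \<Rightarrow> nat \<Rightarrow> nat \<Rightarrow> (nat \<Rightarrow> real mat) \<Rightarrow> nat \<Rightarrow> real" where
  "max_growth N n m B k = Max ((\<lambda>w. N (word_prod n B w)) ` {w \<in> words m. length w = k})"

definition joint_spectral_radius ::
  "(real mat \<Rightarrow> real) \<Rightarrow> nat \<Rightarrow> nat \<Rightarrow> (nat \<Rightarrow> real mat) \<Rightarrow> real" where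
  "joint_spectral_radius N n m B = lim (\<lambda>k. root k (max_growth N n m B k))"

definition normalized_family ::
  "(real mat \<Rightarrow> real) \<Rightarrow> nat \<Rightarrow> nat \<Rightarrow> (nat \<Rightarrow> real mat) \<Rightarrow> nat \<Rightarrow> real mat" where
  "normalized_family N n m B j = (1 / joint_spectral_radius N n m B) \<cdot>\<^sub>m B j"

fun trajectory :: "(nat \<Rightarrow> real mat) \<Rightarrow> (nat \<Rightarrow> nat) \<Rightarrow> real vec \<Rightarrow> nat \<Rightarrow> real vec" where
  "trajectory B s x0 0 = x0"
| "trajectory B s x0 (Suc k) = B (s k) *\<^sub>v trajectory B s x0 k"

definition all_trajectories_bounded :: "nat \<Rightarrow> nat \<Rightarrow> (nat \<Rightarrow> real mat) \<Rightarrow> bool" where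
  "all_trajectories_bounded n m B \<longleftrightarrow>
     (\<forall>s x0. range s \<subseteq> {..<m} \<longrightarrow> x0 \<in> carrier_vec n \<longrightarrow>
        (\<exists>K. \<forall>k. sqrt (trajectory B s x0 k \<bullet> trajectory B s x0 k) \<le> K))"

definition marginally_unstable ::
  "(real mat \<Rightarrow> real) \<Rightarrow> nat \<Rightarrow> nat \<Rightarrow> (nat \<Rightarrow> real mat) \<Rightarrow> bool" where
  "marginally_unstable N n m B \<longleftrightarrow>
     joint_spectral_radius N n m B = 1 \<and> \<not> all_trajectories_bounded n m B"

definition reducible_family :: "nat \<Rightarrow> nat \<Rightarrow> (nat \<Rightarrow> real mat) \<Rightarrow> bool" where
  "reducible_family n m B \<longleftrightarrow>
     (\<exists>W. VectorSpace.subspace class_ring W (module_vec TYPE(real) n) \<and>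
        W \<noteq> {0\<^sub>v n} \<and> W \<noteq> carrier_vec n \<and> (\<forall>j<m. \<forall>w\<in>W. B j *\<^sub>v w \<in> W))"

abbreviation complexify :: "real mat \<Rightarrow> complex mat" where
  "complexify X \<equiv> map_mat complex_of_real X"

text \<open>
  The normalized family only exists for a positive joint spectral radius; without this
  requirement \<open>1 / 0 = 0\<close> would make every simple word dominant for a family of joint spectral
  radius \<open>0\<close>.
\<close>

definition dominant_word ::
  "(real mat \<Rightarrow> real) \<Rightarrow> nat \<Rightarrow> nat \<Rightarrow> (nat \<Rightarrow> real mat) \<Rightarrow> nat list \<Rightarrow> bool" where
  "dominant_word N n m B p \<longleftrightarrow>
     p \<in> words m \<and> simple_word p \<and> joint_spectral_radius N n m B > 0 \<and>
     (\<exists>q<1. \<forall>w \<in> words m. w \<noteq> [] \<and> \<not> (\<exists>p' k. cyclic_perm p p' \<and> w = word_pow p' k) \<longrightarrow>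
        spectral_radius (complexify (word_prod n (normalized_family N n m B) w)) < q)"

definition leading_eigenvalues :: "real mat \<Rightarrow> complex set" where
  "leading_eigenvalues X =
     {z. eigenvalue (complexify X) z \<and> (\<forall>y. eigenvalue (complexify X) y \<longrightarrow> cmod y \<le> cmod z)}"

text \<open>
  For real \<open>z\<close> the set \<open>{z, cnj z}\<close> is the singleton \<open>{z}\<close>; for non-real \<open>z\<close> it consists of two
  complex conjugate eigenvalues.
\<close>

definition unique_simple_leading :: "real mat \<Rightarrow> bool" where
  "unique_simple_leading X \<longleftrightarrow>
     (\<exists>z. leading_eigenvalues X = {z, cnj z}) \<and>
     (\<forall>z \<in> leading_eigenvalues X. order z (char_poly (complexify X)) = 1)"

definition nontrivial_jordan_block :: "real mat \<Rightarrow> complex \<Rightarrow> bool" where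
  "nontrivial_jordan_block X z \<longleftrightarrow>
     (\<exists>n_as. jordan_nf (complexify X) n_as \<and> (\<exists>n\<ge>2. (n, z) \<in> set n_as))"

end

theory Submission
  imports Defs "HOL-Library.Sublist"
begin

text \<open>
  The products of an irreducible family of joint spectral radius one are bounded. If moreover all
  concatenations of the words of some set have spectral radius at most \<open>q < 1\<close>, then products of
  many such words are small: by pigeonhole two partial products \<open>P\<^sub>i\<close> and \<open>P\<^sub>j = P\<^sub>i U\<close> are close,
  while \<open>\<bar>det (1 - U)\<bar> \<ge> (1 - q)\<^sup>n\<close>, so \<open>P\<^sub>i\<close> itself is small. For a dominant word \<open>p\<close> this applies
  to all words that are not factors of powers of \<open>p\<close>. Hence a product is small as soon as its word
  breaks the period \<open>p\<close> often enough.

  The off-diagonal block of \<open>u v\<close> is \<open>A1(u) D(v) + D(u) A2(v)\<close>. If one diagonal family has joint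
  spectral radius below one, or if the dominant words differ, then every long word contracts one of
  the two diagonal families and \<open>D\<close> stays bounded. If they share the dominant word \<open>p\<close>, then \<open>D\<close> is
  bounded as soon as it is bounded on the powers of \<open>p\<close>, which fails exactly in the presence of a
  Jordan block of size at least two for an eigenvalue of modulus one. In that case the powers of \<open>p\<close>
  grow linearly.
\<close>

section \<open>The entrywise 1-norm\<close>

text \<open>Dominance speaks about spectral radii of single products, whereas stability concerns
  norms of all products. The determinant argument turns the former into the latter, but it needs the
  gap \<open>q\<close> for every concatenation of the chosen words at once. Being a power of a
  cyclic permutation of \<open>p\<close> is not inherited by factors; being a factor of a power of
  \<open>p\<close> is. So once a word contains an aperiodic factor no extension is periodic, and the
  gap survives concatenation. Bounded diagonal products alone give only a linear bound on
  \<open>D\<close>. If every long word contracts one diagonal family, chunks of one fixed length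
  improve this to a bound. With a common dominant word this fails, as powers of \<open>p\<close>
  contract neither family; chunks are then cut after a fixed number of breaks of the period, their
  length is unbounded, and \<open>D\<close> is controlled on them through its values on powers of
  \<open>p\<close>. The diagonal blocks only inherit joint spectral radius at most one; that one of
  them attains it forces the common leading eigenvalue onto the unit circle.\<close>

definition mnorm :: "'a::real_normed_field mat \<Rightarrow> real" where
  "mnorm X = (\<Sum>i<dim_row X. \<Sum>j<dim_col X. norm (X $$ (i,j)))"

definition vnorm :: "'a::real_normed_field vec \<Rightarrow> real" where
  "vnorm v = (\<Sum>i<dim_vec v. norm (v $ i))"

lemma mnorm_nonneg [simp]: "mnorm X \<ge> 0"
  unfolding mnorm_def by (intro sum_nonneg) auto

lemma vnorm_nonneg [simp]: "vnorm v \<ge> 0"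
  unfolding vnorm_def by (intro sum_nonneg) auto

lemma norm_entry_le_mnorm:
  assumes "i < dim_row X" "j < dim_col X"
  shows "norm (X $$ (i,j)) \<le> mnorm X"
proof -
  have "norm (X $$ (i,j)) \<le> (\<Sum>j<dim_col X. norm (X $$ (i,j)))"
    using assms(2) by (intro member_le_sum) auto
  also have "\<dots> \<le> mnorm X"
    unfolding mnorm_def
    using assms(1) by (intro member_le_sum[where f = "\<lambda>i. \<Sum>j<dim_col X. norm (X $$ (i,j))"])
      (auto intro: sum_nonneg)
  finally show ?thesis .
qed

lemma norm_entry_le_vnorm: "i < dim_vec v \<Longrightarrow> norm (v $ i) \<le> vnorm v"
  unfolding vnorm_def by (intro member_le_sum) auto

lemma mnorm_le:
  assumes "\<And>i j. i < dim_row X \<Longrightarrow> j < dim_col X \<Longrightarrow> norm (X $$ (i,j)) \<le> b"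
  shows "mnorm X \<le> real (dim_row X) * real (dim_col X) * b"
proof -
  have "mnorm X \<le> (\<Sum>i<dim_row X. \<Sum>j<dim_col X. b)"
    unfolding mnorm_def using assms by (intro sum_mono) auto
  then show ?thesis by simp
qed

lemma mnorm_mult:
  assumes X: "X \<in> carrier_mat a b" and Y: "Y \<in> carrier_mat b c"
  shows "mnorm (X * Y) \<le> mnorm X * mnorm Y"
proof -
  have row: "(\<Sum>j<c. norm (Y $$ (k,j))) \<le> mnorm Y" if "k < b" for k
    unfolding mnorm_def using Y that
    by (auto intro!: member_le_sum[where f = "\<lambda>i. \<Sum>j<c. norm (Y $$ (i,j))"] sum_nonneg)
  have "mnorm (X * Y) = (\<Sum>i<a. \<Sum>j<c. norm (\<Sum>k<b. X $$ (i,k) * Y $$ (k,j)))"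
    unfolding mnorm_def using X Y
    by (auto simp: scalar_prod_def atLeast0LessThan intro!: sum.cong)
  also have "\<dots> \<le> (\<Sum>i<a. \<Sum>j<c. \<Sum>k<b. norm (X $$ (i,k)) * norm (Y $$ (k,j)))"
    by (intro sum_mono order.trans[OF norm_sum]) (auto simp: norm_mult)
  also have "\<dots> = (\<Sum>i<a. \<Sum>k<b. norm (X $$ (i,k)) * (\<Sum>j<c. norm (Y $$ (k,j))))"
    by (subst sum.swap) (simp add: sum_distrib_left)
  also have "\<dots> \<le> (\<Sum>i<a. \<Sum>k<b. norm (X $$ (i,k)) * mnorm Y)"
    by (intro sum_mono mult_left_mono row) auto
  also have "\<dots> = mnorm X * mnorm Y"
    unfolding mnorm_def using X by (simp add: sum_distrib_right)
  finally show ?thesis .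
qed

lemma vnorm_mult_mat_vec:
  assumes X: "X \<in> carrier_mat a b" and v: "v \<in> carrier_vec b"
  shows "vnorm (X *\<^sub>v v) \<le> mnorm X * vnorm v"
proof -
  have "vnorm (X *\<^sub>v v) = (\<Sum>i<a. norm (\<Sum>k<b. X $$ (i,k) * v $ k))"
    unfolding vnorm_def using X v
    by (auto simp: scalar_prod_def atLeast0LessThan intro!: sum.cong)
  also have "\<dots> \<le> (\<Sum>i<a. \<Sum>k<b. norm (X $$ (i,k)) * norm (v $ k))"
    by (intro sum_mono order.trans[OF norm_sum]) (auto simp: norm_mult)
  also have "\<dots> \<le> (\<Sum>i<a. \<Sum>k<b. norm (X $$ (i,k)) * vnorm v)"
    using v by (intro sum_mono mult_left_mono norm_entry_le_vnorm) auto
  also have "\<dots> = mnorm X * vnorm v"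
    unfolding mnorm_def using X by (simp add: sum_distrib_right)
  finally show ?thesis .
qed

lemma mnorm_add:
  assumes X: "X \<in> carrier_mat a b" and Y: "Y \<in> carrier_mat a b"
  shows "mnorm (X + Y) \<le> mnorm X + mnorm Y"
proof -
  have "mnorm (X + Y) = (\<Sum>i<a. \<Sum>j<b. norm (X $$ (i,j) + Y $$ (i,j)))"
    unfolding mnorm_def using X Y by (auto intro!: sum.cong)
  also have "\<dots> \<le> (\<Sum>i<a. \<Sum>j<b. norm (X $$ (i,j)) + norm (Y $$ (i,j)))"
    by (intro sum_mono norm_triangle_ineq)
  also have "\<dots> = mnorm X + mnorm Y"
    unfolding mnorm_def using X Y by (simp add: sum.distrib)
  finally show ?thesis .
qed

lemma vnorm_add:
  assumes x: "x \<in> carrier_vec n" and y: "y \<in> carrier_vec n"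
  shows "vnorm (x + y) \<le> vnorm x + vnorm y"
proof -
  have "vnorm (x + y) = (\<Sum>i<n. norm (x $ i + y $ i))"
    unfolding vnorm_def using x y by (auto intro!: sum.cong)
  also have "\<dots> \<le> (\<Sum>i<n. norm (x $ i) + norm (y $ i))"
    by (intro sum_mono norm_triangle_ineq)
  also have "\<dots> = vnorm x + vnorm y"
    unfolding vnorm_def using x y by (simp add: sum.distrib)
  finally show ?thesis .
qed

lemma mnorm_smult: "mnorm (c \<cdot>\<^sub>m X) = norm c * mnorm X"
  unfolding mnorm_def by (simp add: norm_mult sum_distrib_left)

lemma vnorm_smult: "vnorm (c \<cdot>\<^sub>v x) = norm c * vnorm x"
  unfolding vnorm_def by (simp add: norm_mult sum_distrib_left)

lemma mnorm_complexify [simp]: "mnorm (complexify X) = mnorm X"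
  unfolding mnorm_def by simp

text \<open>The reason for using the entrywise 1-norm: additivity over blocks compares a triangular
  product with its diagonal and off-diagonal parts without any constant.\<close>

lemma mnorm_four_block:
  assumes A: "A \<in> carrier_mat a b" and B: "B \<in> carrier_mat a c"
    and C: "C \<in> carrier_mat e b" and D: "D \<in> carrier_mat e c"
  shows "mnorm (four_block_mat A B C D) = mnorm A + mnorm B + mnorm C + mnorm D"
proof -
  have split: "(\<Sum>i<x + y. f i) = (\<Sum>i<x. f i) + (\<Sum>i<y. f (x + i))" for x y :: nat and f :: "nat \<Rightarrow> real"
    by (induction y) (auto simp: algebra_simps)
  show ?thesis
    unfolding mnorm_def using assms
    by (simp add: split sum.distrib)
qed

lemma mnorm_zero [simp]: "mnorm (0\<^sub>m a b) = 0"
  unfolding mnorm_def by simp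

lemma mnorm_diag_block_mat:
  assumes "X \<in> set Xs"
  shows "mnorm X \<le> mnorm (diag_block_mat Xs)"
  using assms
proof (induction Xs)
  case (Cons Y Xs)
  have "mnorm (diag_block_mat (Y # Xs)) = mnorm Y + mnorm (diag_block_mat Xs)"
    by (simp add: Let_def) (subst mnorm_four_block, auto)
  then show ?case using Cons by (auto intro: order.trans)
qed auto

lemma sqrt_scalar_prod_self_le_vnorm:
  fixes x :: "real vec"
  shows "sqrt (x \<bullet> x) \<le> vnorm x"
proof -
  have "x \<bullet> x = (\<Sum>i<dim_vec x. (x $ i)^2)"
    by (auto simp: scalar_prod_def power2_eq_square atLeast0LessThan)
  also have "\<dots> \<le> (\<Sum>i<dim_vec x. \<bar>x $ i\<bar> * vnorm x)"
  proof (intro sum_mono)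
    fix i assume "i \<in> {..<dim_vec x}"
    then have "\<bar>x $ i\<bar> * \<bar>x $ i\<bar> \<le> \<bar>x $ i\<bar> * vnorm x"
      using norm_entry_le_vnorm[of i x] by (intro mult_left_mono) auto
    then show "(x $ i)^2 \<le> \<bar>x $ i\<bar> * vnorm x" by (simp add: power2_eq_square)
  qed
  also have "\<dots> = vnorm x ^ 2"
    by (simp add: vnorm_def sum_distrib_right power2_eq_square)
  finally show ?thesis by (intro real_le_lsqrt) auto
qed

lemma abs_entry_le_sqrt_scalar_prod:
  fixes x :: "real vec"
  assumes "i < dim_vec x"
  shows "\<bar>x $ i\<bar> \<le> sqrt (x \<bullet> x)"
proof -
  have "(x $ i)^2 \<le> (\<Sum>i<dim_vec x. (x $ i)^2)"
    using assms by (intro member_le_sum) auto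
  also have "\<dots> = x \<bullet> x"
    by (auto simp: scalar_prod_def power2_eq_square atLeast0LessThan)
  finally show ?thesis by (intro real_le_rsqrt) auto
qed

section \<open>Words and products\<close>

lemma words_append [simp]: "u @ v \<in> words m \<longleftrightarrow> u \<in> words m \<and> v \<in> words m"
  unfolding words_def by auto

lemma words_Cons [simp]: "j # v \<in> words m \<longleftrightarrow> j < m \<and> v \<in> words m"
  unfolding words_def by auto

lemma words_Nil [simp]: "[] \<in> words m"
  unfolding words_def by auto

lemma words_concat: "set cs \<subseteq> words m \<Longrightarrow> concat cs \<in> words m"
  unfolding words_def by auto

lemma words_word_pow: "p \<in> words m \<Longrightarrow> word_pow p k \<in> words m"
  unfolding words_def word_pow_def by auto

lemma words_sublist: "sublist u w \<Longrightarrow> w \<in> words m \<Longrightarrow> u \<in> words m"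
  unfolding sublist_def by auto

lemma finite_words_length: "finite {w \<in> words m. length w = k}"
proof -
  have "{w \<in> words m. length w = k} = {w. set w \<subseteq> {..<m} \<and> length w = k}"
    unfolding words_def by auto
  then show ?thesis by (simp add: finite_lists_length_eq)
qed

lemma word_pow_0 [simp]: "word_pow p 0 = []"
  and word_pow_Suc: "word_pow p (Suc k) = p @ word_pow p k"
  unfolding word_pow_def by auto

lemma word_pow_add: "word_pow p (j + k) = word_pow p j @ word_pow p k"
  by (induction j) (auto simp: word_pow_Suc)

lemma word_pow_Suc': "word_pow p (Suc k) = word_pow p k @ p"
  using word_pow_add[of p k 1] by (simp add: word_pow_Suc)

lemma length_word_pow [simp]: "length (word_pow p k) = k * length p"
  by (induction k) (auto simp: word_pow_Suc)

locale mat_family =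
  fixes n m :: nat and B :: "nat \<Rightarrow> real mat"
  assumes carrier: "\<And>j. j < m \<Longrightarrow> B j \<in> carrier_mat n n"
begin

abbreviation "W \<equiv> word_prod n B"

lemma W_Nil [simp]: "W [] = 1\<^sub>m n"
  by (simp add: word_prod_def)

lemma W_Cons [simp]: "W (j # w) = B j * W w"
  by (simp add: word_prod_def)

lemma W_carrier [simp]: "w \<in> words m \<Longrightarrow> W w \<in> carrier_mat n n"
  by (induction w) (auto intro!: mult_carrier_mat[OF carrier])

lemma W_append:
  assumes u: "u \<in> words m" and v: "v \<in> words m"
  shows "W (u @ v) = W u * W v"
  using u
proof (induction u)
  case Nil
  show ?case using left_mult_one_mat[OF W_carrier[OF v]] by simp
next
  case (Cons j u)
  then have j: "B j \<in> carrier_mat n n" and u: "u \<in> words m"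
    using carrier by auto
  show ?case
    using Cons.IH[OF u] assoc_mult_mat[OF j W_carrier[OF u] W_carrier[OF v]] by simp
qed

lemma W_word_pow:
  assumes p: "p \<in> words m"
  shows "W (word_pow p k) = W p ^\<^sub>m k"
proof (induction k)
  case 0
  have "dim_row (W p) = n" using W_carrier[OF p] by blast
  then show ?case by simp
next
  case (Suc k)
  show ?case
    unfolding word_pow_Suc' W_append[OF words_word_pow[OF p] p] Suc by simp
qed

lemma mnorm_W_append: "u \<in> words m \<Longrightarrow> v \<in> words m \<Longrightarrow> mnorm (W (u @ v)) \<le> mnorm (W u) * mnorm (W v)"
  using mnorm_mult[OF W_carrier W_carrier, of u v] by (simp only: W_append)

end

section \<open>Joint spectral radius\<close>

text \<open>Bolzano-Weierstrass one coordinate at a time: each new coordinate has a monotone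
  subsequence along the current one, and the coordinates already treated keep their limits under the
  refinement.\<close>

lemma bounded_coordinates_convergent_subseq:
  fixes f :: "nat \<Rightarrow> 'i \<Rightarrow> real"
  assumes "finite I" and "\<And>k i. i \<in> I \<Longrightarrow> \<bar>f k i\<bar> \<le> K"
  shows "\<exists>r l. strict_mono r \<and> (\<forall>i\<in>I. (\<lambda>k. f (r k) i) \<longlonglongrightarrow> l i)"
  using assms
proof (induction I)
  case empty
  show ?case by (intro exI[of _ id]) (auto simp: strict_mono_def)
next
  case (insert a I)
  then obtain r l where r: "strict_mono r" and l: "\<And>i. i \<in> I \<Longrightarrow> (\<lambda>k. f (r k) i) \<longlonglongrightarrow> l i"
    by blast
  obtain g where g: "strict_mono g" "monoseq (\<lambda>k. f (r (g k)) a)"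
    using seq_monosub[of "\<lambda>k. f (r k) a"] by auto
  have "Bseq (\<lambda>k. f (r (g k)) a)"
    using insert.prems by (intro BseqI'[where K = K]) auto
  then obtain x where x: "(\<lambda>k. f (r (g k)) a) \<longlonglongrightarrow> x"
    using Bseq_monoseq_convergent g(2) convergent_def by blast
  have "(\<lambda>k. f ((r \<circ> g) k) i) \<longlonglongrightarrow> (l(a := x)) i" if "i \<in> insert a I" for i
    using x LIMSEQ_subseq_LIMSEQ[OF l g(1)] that by (auto simp: o_def)
  then show ?case
    using strict_mono_o[OF r g(1)] by blast
qed

lemma bounded_mats_convergent_subseq:
  fixes X :: "nat \<Rightarrow> real mat"
  assumes X: "\<And>k. X k \<in> carrier_mat n m" and K: "\<And>k. mnorm (X k) \<le> K"
  shows "\<exists>r Y. strict_mono r \<and> Y \<in> carrier_mat n m \<and>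
    (\<forall>i<n. \<forall>j<m. (\<lambda>k. X (r k) $$ (i,j)) \<longlonglongrightarrow> Y $$ (i,j))"
proof -
  have "\<bar>X k $$ (i,j)\<bar> \<le> K" if "i < n" "j < m" for i j k
    using norm_entry_le_mnorm[of i "X k" j] K[of k] X[of k] that by auto
  then obtain r l where "strict_mono r" and "\<forall>i\<in>{..<n}\<times>{..<m}. (\<lambda>k. X (r k) $$ i) \<longlonglongrightarrow> l i"
    using bounded_coordinates_convergent_subseq[of "{..<n}\<times>{..<m}" "\<lambda>k ij. X k $$ ij" K] by auto
  then show ?thesis
    by (intro exI[of _ r] exI[of _ "mat n m l"]) auto
qed

lemma bounded_vecs_convergent_subseq:
  fixes x :: "nat \<Rightarrow> real vec"
  assumes x: "\<And>k. x k \<in> carrier_vec n" and K: "\<And>k. vnorm (x k) \<le> K"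
  shows "\<exists>r y. strict_mono r \<and> y \<in> carrier_vec n \<and> (\<forall>i<n. (\<lambda>k. x (r k) $ i) \<longlonglongrightarrow> y $ i)"
proof -
  have "\<bar>x k $ i\<bar> \<le> K" if "i < n" for i k
    using norm_entry_le_vnorm[of i "x k"] K[of k] x[of k] that by auto
  then obtain r l where "strict_mono r" and "\<forall>i\<in>{..<n}. (\<lambda>k. x (r k) $ i) \<longlonglongrightarrow> l i"
    using bounded_coordinates_convergent_subseq[of "{..<n}" "\<lambda>k i. x k $ i" K] by auto
  then show ?thesis
    by (intro exI[of _ r] exI[of _ "vec n l"]) auto
qed

section \<open>Equivalence of matrix norms\<close>

lemma mat_normD:
  assumes "mat_norm n N" "X \<in> carrier_mat n n"
  shows "N X \<ge> 0" "N X = 0 \<longleftrightarrow> X = 0\<^sub>m n n" "N (c \<cdot>\<^sub>m X) = \<bar>c\<bar> * N X"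
    and "Y \<in> carrier_mat n n \<Longrightarrow> N (X + Y) \<le> N X + N Y"
  using assms unfolding mat_norm_def by blast+

lemma mat_norm_le_mnorm:
  assumes N: "mat_norm n N"
  shows "\<exists>c>0. \<forall>X\<in>carrier_mat n n. N X \<le> c * mnorm X"
proof -
  define E where "E ij = mat n n (\<lambda>kl. if kl = ij then 1 else (0::real))" for ij
  define R where "R X S = mat n n (\<lambda>kl. if kl \<in> S then X $$ kl else (0::real))" for X S
  define c where "c = 1 + (\<Sum>ij\<in>{..<n}\<times>{..<n}. N (E ij))"
  have E: "E ij \<in> carrier_mat n n" and NE: "N (E ij) \<ge> 0" for ij
    using N unfolding mat_norm_def E_def by auto
  have cE: "N (E ij) \<le> c" if "ij \<in> {..<n}\<times>{..<n}" for ij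
    unfolding c_def using member_le_sum[of ij "{..<n}\<times>{..<n}" "\<lambda>ij. N (E ij)"] NE that by force
  have R: "N (R X S) \<le> (\<Sum>ij\<in>S. \<bar>X $$ ij\<bar> * c)" if "finite S" "S \<subseteq> {..<n}\<times>{..<n}" for X S
    using that
  proof (induction S)
    case empty
    have "R X {} = 0\<^sub>m n n" unfolding R_def by (intro eq_matI) auto
    then show ?case using mat_normD(2)[OF N zero_carrier_mat] by simp
  next
    case (insert ij S)
    have RS: "R X S \<in> carrier_mat n n" unfolding R_def by auto
    have "R X (insert ij S) = X $$ ij \<cdot>\<^sub>m E ij + R X S"
      unfolding R_def E_def using insert by (intro eq_matI) auto
    then have "N (R X (insert ij S)) \<le> N (X $$ ij \<cdot>\<^sub>m E ij) + N (R X S)"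
      using mat_normD(4)[OF N _ RS] E[of ij] by simp
    also have "N (X $$ ij \<cdot>\<^sub>m E ij) = \<bar>X $$ ij\<bar> * N (E ij)"
      using mat_normD(3)[OF N E] .
    also have "\<dots> \<le> \<bar>X $$ ij\<bar> * c"
      using cE insert.prems by (intro mult_left_mono) auto
    finally show ?case using insert by simp
  qed
  have "N X \<le> c * mnorm X" if X: "X \<in> carrier_mat n n" for X
  proof -
    have "R X ({..<n}\<times>{..<n}) = X"
      unfolding R_def using X by (intro eq_matI) auto
    moreover have "(\<Sum>ij\<in>{..<n}\<times>{..<n}. \<bar>X $$ ij\<bar> * c) = c * mnorm X"
      unfolding mnorm_def using X
      by (simp add: sum_distrib_left sum.cartesian_product mult.commute case_prod_unfold)
    ultimately show ?thesis using R[of "{..<n}\<times>{..<n}" X] by simp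
  qed
  moreover have "c > 0" unfolding c_def using sum_nonneg[of "{..<n}\<times>{..<n}" "\<lambda>ij. N (E ij)"] NE by force
  ultimately show ?thesis by blast
qed

text \<open>Compactness of the unit sphere of \<open>mnorm\<close>: normalised counterexamples
  accumulate at some \<open>Z\<close> of 1-norm one, while the previous bound makes \<open>N\<close>
  continuous and yields \<open>N Z \<le> 0\<close>.\<close>

lemma mnorm_le_mat_norm:
  assumes N: "mat_norm n N"
  shows "\<exists>c>0. \<forall>X\<in>carrier_mat n n. mnorm X \<le> c * N X"
proof (rule ccontr)
  assume "\<not> ?thesis"
  then have "\<exists>X\<in>carrier_mat n n. mnorm X > real (Suc k) * N X" for k
    by (metis not_le of_nat_0_less_iff zero_less_Suc)
  then obtain X where X: "\<And>k. X k \<in> carrier_mat n n" and gt: "\<And>k. mnorm (X k) > real (Suc k) * N (X k)"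
    by metis
  have pos: "mnorm (X k) > 0" for k
  proof -
    have "real (Suc k) * N (X k) \<ge> 0" using N X unfolding mat_norm_def by simp
    then show ?thesis using gt[of k] by linarith
  qed
  define Y where "Y k = (1 / mnorm (X k)) \<cdot>\<^sub>m X k" for k
  have Y: "Y k \<in> carrier_mat n n" and Y1: "mnorm (Y k) = 1" for k
    using X pos[of k] unfolding Y_def by (auto simp: mnorm_smult)
  have NY: "N (Y k) \<le> 1 / real (Suc k)" for k
  proof -
    have "N (Y k) = N (X k) / mnorm (X k)"
      using N X pos[of k] unfolding mat_norm_def Y_def by auto
    also have "\<dots> \<le> 1 / real (Suc k)"
      using less_imp_le[OF gt[of k]] pos[of k] by (simp add: pos_divide_le_eq pos_le_divide_eq mult.commute del: of_nat_Suc)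
    finally show ?thesis .
  qed
  obtain r Z where r: "strict_mono r" and Z: "Z \<in> carrier_mat n n"
    and lim: "\<And>i j. i < n \<Longrightarrow> j < n \<Longrightarrow> (\<lambda>k. Y (r k) $$ (i,j)) \<longlonglongrightarrow> Z $$ (i,j)"
    using bounded_mats_convergent_subseq[of Y n n 1] Y Y1 by (metis order_refl)
  obtain c where c: "\<And>X. X \<in> carrier_mat n n \<Longrightarrow> N X \<le> c * mnorm X"
    using mat_norm_le_mnorm[OF N] by blast
  define D where "D k = Z + (-1) \<cdot>\<^sub>m Y (r k)" for k
  have D: "D k \<in> carrier_mat n n" for k
    using Z Y[of "r k"] unfolding D_def by simp
  have Dn: "mnorm (D k) = (\<Sum>i<n. \<Sum>j<n. \<bar>Z $$ (i,j) - Y (r k) $$ (i,j)\<bar>)" for k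
    unfolding mnorm_def D_def using Z Y[of "r k"] by auto
  have "(\<lambda>k. mnorm (D k)) \<longlonglongrightarrow> (\<Sum>i<n. \<Sum>j<n. \<bar>Z $$ (i,j) - Z $$ (i,j)\<bar>)"
    unfolding Dn using lim by (intro tendsto_sum tendsto_rabs tendsto_diff) auto
  then have D0: "(\<lambda>k. mnorm (D k)) \<longlonglongrightarrow> 0" by simp
  have "N Z \<le> c * mnorm (D k) + 1 / real (Suc k)" for k
  proof -
    have "Z = D k + Y (r k)"
      unfolding D_def using Z Y[of "r k"] by (intro eq_matI) auto
    then have "N Z \<le> N (D k) + N (Y (r k))"
      using N D[of k] Y[of "r k"] unfolding mat_norm_def by metis
    also have "\<dots> \<le> c * mnorm (D k) + 1 / real (Suc (r k))"
      using c[OF D] NY by (intro add_mono) auto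
    also have "1 / real (Suc (r k)) \<le> 1 / real (Suc k)"
      using seq_suble[OF r, of k] by (intro divide_left_mono) auto
    finally show ?thesis by simp
  qed
  moreover have "(\<lambda>k. c * mnorm (D k) + 1 / real (Suc k)) \<longlonglongrightarrow> c * 0 + 0"
    using LIMSEQ_inverse_real_of_nat
    by (intro tendsto_add tendsto_mult D0 tendsto_const) (simp add: inverse_eq_divide)
  ultimately have "N Z \<le> 0"
    by (intro LIMSEQ_le_const[where X = "\<lambda>k. c * mnorm (D k) + 1 / real (Suc k)"]) auto
  then have "Z = 0\<^sub>m n n"
    using N Z unfolding mat_norm_def by (metis order_antisym)
  moreover have "(\<lambda>k. mnorm (Y (r k))) \<longlonglongrightarrow> mnorm Z"
  proof -
    have "(\<lambda>k. \<Sum>i<n. \<Sum>j<n. norm (Y (r k) $$ (i,j))) \<longlonglongrightarrow> (\<Sum>i<n. \<Sum>j<n. norm (Z $$ (i,j)))"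
      using lim by (intro tendsto_sum tendsto_norm) auto
    then show ?thesis unfolding mnorm_def using Z Y by (simp add: carrier_matD[OF Y])
  qed
  ultimately show False using Y1 LIMSEQ_unique[OF tendsto_const] by fastforce
qed

text \<open>Fekete's lemma in multiplicative form. The limit is an infimum, which gives an
  exponential bound for every \<open>r\<close> above it, valid for all \<open>k\<close>. Values
  \<open>f k = 0\<close> are allowed, so no logarithm is taken.\<close>

lemma fekete_root_limit:
  fixes f :: "nat \<Rightarrow> real"
  assumes nonneg: "\<And>k. f k \<ge> 0" and submult: "\<And>j k. f (j + k) \<le> f j * f k"
  shows "\<exists>\<rho>\<ge>0. (\<lambda>k. root k (f k)) \<longlonglongrightarrow> \<rho> \<and> (\<forall>r>\<rho>. \<exists>C>0. \<forall>k. f k \<le> C * r ^ k)"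
proof -
  \<comment> \<open>Index 0 is left out because \<open>root 0\<close> is constantly 0.\<close>
  define S where "S = (\<lambda>k. root k (f k)) ` {1..}"
  define \<rho> where "\<rho> = Inf S"
  have bdd: "bdd_below S" unfolding S_def using nonneg by (intro bdd_belowI[of _ 0]) auto
  have rho0: "\<rho> \<ge> 0" unfolding \<rho>_def S_def using nonneg by (intro cInf_greatest) auto
  have bound: "\<exists>C>0. \<forall>k. f k \<le> C * r ^ k" if r: "r > \<rho>" for r
  proof -
    obtain k0 where k0: "k0 \<ge> 1" "root k0 (f k0) < r"
      using cInf_lessD[of S r] r unfolding \<rho>_def S_def by auto
    have r0: "r > 0" using r rho0 by linarith
    have fk0: "f k0 \<le> r ^ k0"
      using power_mono[of "root k0 (f k0)" r k0] k0 nonneg[of k0] by auto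
    \<comment> \<open>Bounds \<open>f\<close> on the remainders modulo \<open>k0\<close>; the
      induction on the quotient then multiplies by \<open>f k0 \<le> r ^ k0\<close>. The summand 1
      keeps \<open>C\<close> positive.\<close>
    define C where "C = 1 + (\<Sum>s<k0. f s / r ^ s)"
    have small: "f s \<le> C * r ^ s" if "s < k0" for s
    proof -
      have "f s / r ^ s \<le> (\<Sum>s<k0. f s / r ^ s)"
        using that nonneg r0 by (intro member_le_sum) auto
      also have "\<dots> \<le> C" unfolding C_def by simp
      finally show ?thesis using r0 by (simp add: pos_divide_le_eq)
    qed
    have step: "f (q * k0 + s) \<le> C * r ^ (q * k0 + s)" if "s < k0" for q s
    proof (induction q)
      case 0 then show ?case using small that by simp
    next
      case (Suc q)
      have "f (Suc q * k0 + s) \<le> f k0 * f (q * k0 + s)"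
        using submult[of k0 "q * k0 + s"] by (simp add: add_ac)
      also have "\<dots> \<le> r ^ k0 * (C * r ^ (q * k0 + s))"
        using fk0 Suc nonneg r0 by (intro mult_mono) auto
      finally show ?case by (simp add: power_add algebra_simps)
    qed
    have "f k \<le> C * r ^ k" for k
      using step[of "k mod k0" "k div k0"] k0 by simp
    moreover have "C > 0" unfolding C_def using nonneg r0 by (auto intro!: add_pos_nonneg sum_nonneg)
    ultimately show ?thesis by blast
  qed
  have "(\<lambda>k. root k (f k)) \<longlonglongrightarrow> \<rho>"
  proof (rule order_tendstoI)
    fix a assume a: "a < \<rho>"
    have "root k (f k) \<ge> \<rho>" if "k \<ge> 1" for k
      unfolding \<rho>_def using that bdd by (intro cInf_lower) (auto simp: S_def)
    then show "\<forall>\<^sub>F k in sequentially. a < root k (f k)"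
      using a by (intro eventually_sequentiallyI[of 1]) force
  next
    fix a assume a: "\<rho> < a"
    define r where "r = (\<rho> + a) / 2"
    have r: "r > \<rho>" "r < a" "r > 0" using a rho0 unfolding r_def by auto
    obtain C where C: "C > 0" "\<And>k. f k \<le> C * r ^ k" using bound[OF r(1)] by blast
    have "(\<lambda>k. root k C * r) \<longlonglongrightarrow> 1 * r"
      using LIMSEQ_root_const[OF C(1)] by (intro tendsto_mult tendsto_const)
    then have "\<forall>\<^sub>F k in sequentially. root k C * r < a"
      using r(2) order_tendstoD(2) by fastforce
    then show "\<forall>\<^sub>F k in sequentially. root k (f k) < a"
      using eventually_gt_at_top[of 0]
    proof eventually_elim
      case (elim k)
      have "root k (f k) \<le> root k (C * r ^ k)" using elim C by simp
      also have "\<dots> = root k C * r" using elim r by (simp add: real_root_mult real_root_power_cancel)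
      finally show ?case using elim by simp
    qed
  qed
  then show ?thesis using rho0 bound by blast
qed

section \<open>The growth function and its exponential rate\<close>

lemma max_growth_ge:
  "w \<in> words m \<Longrightarrow> length w = k \<Longrightarrow> N (word_prod n B w) \<le> max_growth N n m B k"
  unfolding max_growth_def by (intro Max_ge finite_imageI finite_words_length) auto

lemma max_growth_attained:
  assumes "m > 0"
  shows "\<exists>w\<in>words m. length w = k \<and> max_growth N n m B k = N (word_prod n B w)"
proof -
  have "replicate k 0 \<in> {w \<in> words m. length w = k}"
    using assms unfolding words_def by auto
  then have "max_growth N n m B k \<in> (\<lambda>w. N (word_prod n B w)) ` {w \<in> words m. length w = k}"
    unfolding max_growth_def by (intro Max_in finite_imageI finite_words_length) blast
  then show ?thesis by auto
qed

text \<open>Submultiplicativity is available for \<open>mnorm\<close>, so the limit is found there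
  and carried to \<open>N\<close> by norm equivalence, since the k-th roots of the constants tend to
  one.\<close>

lemma (in mat_family) jsr_characterization:
  assumes N: "mat_norm n N" and m: "m > 0"
  shows jsr_nonneg: "joint_spectral_radius N n m B \<ge> 0"
    and jsr_upper: "\<And>r. r > joint_spectral_radius N n m B \<Longrightarrow> \<exists>C>0. \<forall>w\<in>words m. mnorm (W w) \<le> C * r ^ length w"
    and jsr_le: "\<And>r C. r \<ge> 0 \<Longrightarrow> (\<And>w. w \<in> words m \<Longrightarrow> mnorm (W w) \<le> C * r ^ length w) \<Longrightarrow> joint_spectral_radius N n m B \<le> r"
proof -
  let ?f = "max_growth mnorm n m B" and ?g = "max_growth N n m B"
  have f_nonneg: "?f k \<ge> 0" for k
    using max_growth_attained[OF m, of k mnorm n B] by auto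
  have submult: "?f (j + k) \<le> ?f j * ?f k" for j k
  proof -
    obtain w where w: "w \<in> words m" "length w = j + k" "?f (j + k) = mnorm (W w)"
      using max_growth_attained[OF m] by blast
    define u v where "u = take j w" and "v = drop j w"
    have uv: "w = u @ v" "length u = j" "length v = k" using w unfolding u_def v_def by auto
    then have wd: "u \<in> words m" "v \<in> words m" using w by auto
    have "mnorm (W w) \<le> mnorm (W u) * mnorm (W v)"
      unfolding uv using wd by (rule mnorm_W_append)
    also have "\<dots> \<le> ?f j * ?f k"
      using wd uv f_nonneg by (intro mult_mono max_growth_ge) auto
    finally show ?thesis using w by simp
  qed
  obtain \<rho> where rho: "\<rho> \<ge> 0" "(\<lambda>k. root k (?f k)) \<longlonglongrightarrow> \<rho>"
    and bound: "\<And>r. r > \<rho> \<Longrightarrow> \<exists>C>0. \<forall>k. ?f k \<le> C * r ^ k"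
    using fekete_root_limit[of ?f, OF f_nonneg submult] by blast
  obtain c1 where c1: "c1 > 0" "\<And>X. X \<in> carrier_mat n n \<Longrightarrow> N X \<le> c1 * mnorm X"
    using mat_norm_le_mnorm[OF N] by blast
  obtain c2 where c2: "c2 > 0" "\<And>X. X \<in> carrier_mat n n \<Longrightarrow> mnorm X \<le> c2 * N X"
    using mnorm_le_mat_norm[OF N] by blast
  have gf: "?g k \<le> c1 * ?f k" for k
  proof -
    obtain w where w: "w \<in> words m" "length w = k" "?g k = N (W w)"
      using max_growth_attained[OF m] by blast
    have "N (W w) \<le> c1 * mnorm (W w)" using w c1 by simp
    also have "\<dots> \<le> c1 * ?f k" using w c1 by (intro mult_left_mono max_growth_ge) auto
    finally show ?thesis using w by simp
  qed
  have fg: "?f k \<le> c2 * ?g k" for k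
  proof -
    obtain w where w: "w \<in> words m" "length w = k" "?f k = mnorm (W w)"
      using max_growth_attained[OF m] by blast
    have "mnorm (W w) \<le> c2 * N (W w)" using w c2 by simp
    also have "\<dots> \<le> c2 * ?g k" using w c2 by (intro mult_left_mono max_growth_ge) auto
    finally show ?thesis using w by simp
  qed
  have "(\<lambda>k. root k (?g k)) \<longlonglongrightarrow> \<rho>"
  proof (rule tendsto_sandwich)
    show "(\<lambda>k. root k (1 / c2) * root k (?f k)) \<longlonglongrightarrow> \<rho>"
      using tendsto_mult[OF LIMSEQ_root_const[of "1 / c2"] rho(2)] c2 by simp
    show "(\<lambda>k. root k c1 * root k (?f k)) \<longlonglongrightarrow> \<rho>"
      using tendsto_mult[OF LIMSEQ_root_const[of c1] rho(2)] c1 by simp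
    show "\<forall>\<^sub>F k in sequentially. root k (1 / c2) * root k (?f k) \<le> root k (?g k)"
      using eventually_gt_at_top[of 0]
    proof eventually_elim
      case (elim k)
      have "1 / c2 * ?f k \<le> ?g k" using fg[of k] c2 by (simp add: field_simps)
      then have "root k (1 / c2 * ?f k) \<le> root k (?g k)" using elim by simp
      then show ?case by (simp only: real_root_mult)
    qed
    show "\<forall>\<^sub>F k in sequentially. root k (?g k) \<le> root k c1 * root k (?f k)"
      using eventually_gt_at_top[of 0]
    proof eventually_elim
      case (elim k)
      then have "root k (?g k) \<le> root k (c1 * ?f k)" using gf[of k] by simp
      then show ?case by (simp only: real_root_mult)
    qed
  qed
  then have jsr: "joint_spectral_radius N n m B = \<rho>"
    unfolding joint_spectral_radius_def by (rule limI)
  show "joint_spectral_radius N n m B \<ge> 0" using jsr rho by simp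
  show "\<exists>C>0. \<forall>w\<in>words m. mnorm (W w) \<le> C * r ^ length w" if r: "r > joint_spectral_radius N n m B" for r
  proof -
    obtain C where "C > 0" "\<And>k. ?f k \<le> C * r ^ k" using bound r jsr by metis
    then show ?thesis using max_growth_ge[of _ m _ mnorm n B] by (meson order_trans)
  qed
  show "joint_spectral_radius N n m B \<le> r"
    if r: "r \<ge> 0" and le: "\<And>w. w \<in> words m \<Longrightarrow> mnorm (W w) \<le> C * r ^ length w" for r C
  proof -
    define C' where "C' = max C 1"
    have fC: "?f k \<le> C' * r ^ k" for k
    proof -
      obtain w where w: "w \<in> words m" "length w = k" "?f k = mnorm (W w)"
        using max_growth_attained[OF m] by blast
      have "C * r ^ k \<le> C' * r ^ k" using r unfolding C'_def by (intro mult_right_mono) auto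
      then show ?thesis using le[OF w(1)] w by simp
    qed
    have "(\<lambda>k. root k C' * r) \<longlonglongrightarrow> 1 * r"
      by (intro tendsto_mult LIMSEQ_root_const tendsto_const) (simp add: C'_def)
    moreover have "\<forall>k\<ge>1. root k (?f k) \<le> root k C' * r"
    proof (intro allI impI)
      fix k :: nat assume k: "k \<ge> 1"
      have "root k (?f k) \<le> root k (C' * r ^ k)" using k fC by simp
      also have "\<dots> = root k C' * r" using k r by (simp add: real_root_mult real_root_power_cancel)
      finally show "root k (?f k) \<le> root k C' * r" .
    qed
    ultimately have "\<rho> \<le> r" using LIMSEQ_le[OF rho(2)] by fastforce
    then show ?thesis using jsr by simp
  qed
qed

section \<open>Irreducible families of joint spectral radius one\<close>

lemma tendsto_vnorm_mult_mat_vec: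
  fixes x :: "nat \<Rightarrow> real vec"
  assumes X: "X \<in> carrier_mat a n" and x: "\<And>k. x k \<in> carrier_vec n" and y: "y \<in> carrier_vec n"
    and lim: "\<And>i. i < n \<Longrightarrow> (\<lambda>k. x k $ i) \<longlonglongrightarrow> y $ i"
  shows "(\<lambda>k. vnorm (X *\<^sub>v x k)) \<longlonglongrightarrow> vnorm (X *\<^sub>v y)"
proof -
  have *: "vnorm (X *\<^sub>v z) = (\<Sum>i<a. \<bar>\<Sum>j<n. X $$ (i,j) * z $ j\<bar>)" if "z \<in> carrier_vec n" for z
    unfolding vnorm_def using X that
    by (auto simp: scalar_prod_def atLeast0LessThan intro!: sum.cong)
  show ?thesis
    unfolding *[OF x] *[OF y] using lim by (intro tendsto_sum tendsto_rabs tendsto_mult tendsto_const) auto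
qed

lemma tendsto_vnorm:
  fixes x :: "nat \<Rightarrow> real vec"
  assumes x: "\<And>k. x k \<in> carrier_vec n" and y: "y \<in> carrier_vec n"
    and lim: "\<And>i. i < n \<Longrightarrow> (\<lambda>k. x k $ i) \<longlonglongrightarrow> y $ i"
  shows "(\<lambda>k. vnorm (x k)) \<longlonglongrightarrow> vnorm y"
  using tendsto_vnorm_mult_mat_vec[OF one_carrier_mat x y lim] x y by simp

lemma vnorm_eq_0_iff:
  "x \<in> carrier_vec n \<Longrightarrow> vnorm x = 0 \<longleftrightarrow> x = 0\<^sub>v n"
  unfolding vnorm_def by (subst sum_nonneg_eq_0_iff) auto

lemma subspaceI:
  fixes U :: "real vec set"
  assumes "U \<subseteq> carrier_vec n" "0\<^sub>v n \<in> U"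
    and "\<And>x y. x \<in> U \<Longrightarrow> y \<in> U \<Longrightarrow> x + y \<in> U" and "\<And>c x. x \<in> U \<Longrightarrow> c \<cdot>\<^sub>v x \<in> U"
  shows "VectorSpace.subspace class_ring U (module_vec TYPE(real) n)"
proof -
  interpret vec_space "TYPE(real)" n .
  show ?thesis
    unfolding VectorSpace.subspace_def
  proof (intro conjI submodule.intro)
    show "vectorspace class_ring (module_vec TYPE(real) n)" by unfold_locales
    show "module class_ring (module_vec TYPE(real) n)" by unfold_locales
  qed (use assms in \<open>auto simp: module_vec_simps\<close>)
qed

context mat_family
begin

text \<open>The vectors with bounded orbit form an invariant subspace. If it is zero, compactness
  gives a length within which every vector can be doubled in norm, hence exponential growth; if it
  is everything, the unit vectors bound the columns of all products. The growth hypothesis also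
  holds for joint spectral radius below one.\<close>

lemma irreducible_products_bounded:
  assumes irred: "\<not> reducible_family n m B"
    and growth: "\<And>r. r > 1 \<Longrightarrow> \<exists>C>0. \<forall>w\<in>words m. mnorm (W w) \<le> C * r ^ length w"
  shows "\<exists>K\<ge>1. \<forall>w\<in>words m. mnorm (W w) \<le> K"
proof -
  define U where "U = {x \<in> carrier_vec n. \<exists>K. \<forall>w\<in>words m. vnorm (W w *\<^sub>v x) \<le> K}"
  have "VectorSpace.subspace class_ring U (module_vec TYPE(real) n)"
  proof (rule subspaceI)
    show "U \<subseteq> carrier_vec n" unfolding U_def by auto
    have "vnorm (W w *\<^sub>v 0\<^sub>v n) \<le> 0" if "w \<in> words m" for w
      using vnorm_mult_mat_vec[OF W_carrier[OF that] zero_carrier_vec] vnorm_eq_0_iff[of "0\<^sub>v n :: real vec" n]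
      by simp
    then show "0\<^sub>v n \<in> U" unfolding U_def by auto
  next
    fix x y assume "x \<in> U" "y \<in> U"
    then obtain K1 K2 where x: "x \<in> carrier_vec n" "\<And>w. w \<in> words m \<Longrightarrow> vnorm (W w *\<^sub>v x) \<le> K1"
      and y: "y \<in> carrier_vec n" "\<And>w. w \<in> words m \<Longrightarrow> vnorm (W w *\<^sub>v y) \<le> K2"
      unfolding U_def by blast
    have "vnorm (W w *\<^sub>v (x + y)) \<le> K1 + K2" if w: "w \<in> words m" for w
    proof -
      have "W w *\<^sub>v (x + y) = W w *\<^sub>v x + W w *\<^sub>v y"
        using mult_add_distrib_mat_vec[OF W_carrier[OF w] x(1) y(1)] .
      then show ?thesis
        using vnorm_add[of "W w *\<^sub>v x" n "W w *\<^sub>v y"] x(2)[OF w] y(2)[OF w] W_carrier[OF w] x(1) y(1)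
        by fastforce
    qed
    then show "x + y \<in> U" unfolding U_def using x(1) y(1) by auto
  next
    fix c x assume "x \<in> U"
    then obtain K where x: "x \<in> carrier_vec n" "\<And>w. w \<in> words m \<Longrightarrow> vnorm (W w *\<^sub>v x) \<le> K"
      unfolding U_def by blast
    have "vnorm (W w *\<^sub>v (c \<cdot>\<^sub>v x)) \<le> \<bar>c\<bar> * K" if w: "w \<in> words m" for w
      using mult_mat_vec[OF W_carrier[OF w] x(1), of c] x(2)[OF w] by (simp add: vnorm_smult mult_left_mono)
    then show "c \<cdot>\<^sub>v x \<in> U" unfolding U_def using x(1) by auto
  qed
  moreover have "B j *\<^sub>v x \<in> U" if j: "j < m" and x: "x \<in> U" for j x
  proof -
    obtain K where x: "x \<in> carrier_vec n" "\<And>w. w \<in> words m \<Longrightarrow> vnorm (W w *\<^sub>v x) \<le> K"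
      using x unfolding U_def by blast
    have "W w *\<^sub>v (B j *\<^sub>v x) = W (w @ [j]) *\<^sub>v x" if w: "w \<in> words m" for w
      using assoc_mult_mat_vec[OF W_carrier[OF w] carrier[OF j] x(1)] W_append[OF w, of "[j]"] j carrier[OF j]
      by simp
    then have "\<forall>w\<in>words m. vnorm (W w *\<^sub>v (B j *\<^sub>v x)) \<le> K"
      using x(2) j by simp
    then show ?thesis unfolding U_def using x(1) carrier[OF j] by auto
  qed
  ultimately consider "U = {0\<^sub>v n}" "U \<noteq> carrier_vec n" | "U = carrier_vec n"
    using irred unfolding reducible_family_def by blast
  then show ?thesis
  proof cases
    case 1
    have "\<exists>L. \<forall>x\<in>carrier_vec n. vnorm x = 1 \<longrightarrow> (\<exists>w\<in>words m. length w \<le> L \<and> vnorm (W w *\<^sub>v x) \<ge> 2)"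
    proof (rule ccontr)
      assume "\<not> ?thesis"
      then obtain x where x: "\<And>k. x k \<in> carrier_vec n" "\<And>k. vnorm (x k) = 1"
        and less: "\<And>k w. w \<in> words m \<Longrightarrow> length w \<le> k \<Longrightarrow> vnorm (W w *\<^sub>v x k) < 2"
        by (metis not_le)
      obtain r y where r: "strict_mono r" and y: "y \<in> carrier_vec n"
        and lim: "\<And>i. i < n \<Longrightarrow> (\<lambda>k. x (r k) $ i) \<longlonglongrightarrow> y $ i"
        using bounded_vecs_convergent_subseq[of x n 1] x by (metis order_refl)
      have "vnorm (W w *\<^sub>v y) \<le> 2" if w: "w \<in> words m" for w
      proof (rule LIMSEQ_le_const2)
        show "(\<lambda>k. vnorm (W w *\<^sub>v x (r k))) \<longlonglongrightarrow> vnorm (W w *\<^sub>v y)"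
          by (rule tendsto_vnorm_mult_mat_vec[OF W_carrier[OF w] x(1) y lim])
        have "vnorm (W w *\<^sub>v x (r k)) \<le> 2" if "k \<ge> length w" for k
          using less[OF w, of "r k"] seq_suble[OF r, of k] that by simp
        then show "\<exists>N. \<forall>k\<ge>N. vnorm (W w *\<^sub>v x (r k)) \<le> 2" by blast
      qed
      then have "y \<in> U" unfolding U_def using y by auto
      then have "vnorm y = 0" using 1 vnorm_eq_0_iff[OF y] by simp
      moreover have "(\<lambda>k. vnorm (x (r k))) \<longlonglongrightarrow> vnorm y"
        by (rule tendsto_vnorm[OF x(1) y lim])
      ultimately show False using x(2) LIMSEQ_unique[OF tendsto_const] by fastforce
    qed
    then obtain L0 where L0: "\<And>x. x \<in> carrier_vec n \<Longrightarrow> vnorm x = 1 \<Longrightarrow>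
        \<exists>w\<in>words m. length w \<le> L0 \<and> vnorm (W w *\<^sub>v x) \<ge> 2" by blast
    define L where "L = Suc L0"
    have L: "\<exists>w\<in>words m. length w \<le> L \<and> vnorm (W w *\<^sub>v x) \<ge> 2 * vnorm x" if x: "x \<in> carrier_vec n" for x
    proof (cases "vnorm x = 0")
      case True then show ?thesis by (intro bexI[of _ "[]"]) auto
    next
      case False
      then have pos: "vnorm x > 0" using vnorm_nonneg[of x] by linarith
      define y where "y = (1 / vnorm x) \<cdot>\<^sub>v x"
      have y: "y \<in> carrier_vec n" "vnorm y = 1" using x pos unfolding y_def by (auto simp: vnorm_smult)
      then obtain w where w: "w \<in> words m" "length w \<le> L0" "vnorm (W w *\<^sub>v y) \<ge> 2" using L0 by blast
      have "vnorm (W w *\<^sub>v y) = vnorm (W w *\<^sub>v x) / vnorm x"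
        unfolding y_def using mult_mat_vec[OF W_carrier[OF w(1)] x] pos by (simp add: vnorm_smult)
      then have "vnorm (W w *\<^sub>v x) \<ge> 2 * vnorm x"
        using w(3) pos by (simp add: pos_le_divide_eq)
      then show ?thesis using w(1,2) unfolding L_def by (intro bexI[of _ w]) auto
    qed
    obtain x0 :: "real vec" where x0: "x0 \<in> carrier_vec n" "x0 \<noteq> 0\<^sub>v n"
      using 1 zero_carrier_vec[of n, where ?'a = real] by auto
    then have pos: "vnorm x0 > 0" using vnorm_eq_0_iff[OF x0(1)] vnorm_nonneg[of x0] by linarith
    have iter: "\<exists>w\<in>words m. length w \<le> L * j \<and> vnorm (W w *\<^sub>v x0) \<ge> 2 ^ j * vnorm x0" for j
    proof (induction j)
      case 0 show ?case using x0 by (intro bexI[of _ "[]"]) auto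
    next
      case (Suc j)
      then obtain w where w: "w \<in> words m" "length w \<le> L * j" "vnorm (W w *\<^sub>v x0) \<ge> 2 ^ j * vnorm x0" by blast
      have wx: "W w *\<^sub>v x0 \<in> carrier_vec n" using W_carrier[OF w(1)] x0 by auto
      obtain v where v: "v \<in> words m" "length v \<le> L" "vnorm (W v *\<^sub>v (W w *\<^sub>v x0)) \<ge> 2 * vnorm (W w *\<^sub>v x0)"
        using L[OF wx] by blast
      have "W (v @ w) *\<^sub>v x0 = W v *\<^sub>v (W w *\<^sub>v x0)"
        using assoc_mult_mat_vec[OF W_carrier[OF v(1)] W_carrier[OF w(1)] x0(1)] W_append[OF v(1) w(1)] by simp
      then show ?case using v w by (intro bexI[of _ "v @ w"]) auto
    qed
    \<comment> \<open>Any value strictly between 1 and 2 would do for \<open>r ^ L\<close>: doubling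
      within \<open>L\<close> letters beats the assumed growth by the factor 4/3 per round.\<close>
    define r where "r = root L (3/2)"
    have r: "r > 1" "r ^ L = 3/2"
      unfolding r_def using real_root_pow_pos2[of L "3/2"] by (auto simp: L_def simp del: power_Suc)
    obtain C where C: "C > 0" "\<And>w. w \<in> words m \<Longrightarrow> mnorm (W w) \<le> C * r ^ length w" using growth[OF r(1)] by blast
    have le: "(4/3) ^ j \<le> C" for j :: nat
    proof -
      obtain w where w: "w \<in> words m" "length w \<le> L * j" "vnorm (W w *\<^sub>v x0) \<ge> 2 ^ j * vnorm x0" using iter by blast
      have "2 ^ j * vnorm x0 \<le> mnorm (W w) * vnorm x0"
        using vnorm_mult_mat_vec[OF W_carrier[OF w(1)] x0(1)] w(3) by linarith
      then have "2 ^ j \<le> mnorm (W w)" using pos by simp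
      also have "\<dots> \<le> C * r ^ length w" using C w by simp
      also have "\<dots> \<le> C * r ^ (L * j)" using C(1) r(1) w(2) by (intro mult_left_mono power_increasing) auto
      also have "\<dots> = C * (3/2) ^ j" by (simp add: power_mult r(2))
      finally have "2 ^ j / (3/2) ^ j \<le> C" by (simp add: pos_divide_le_eq)
      then show ?thesis by (simp add: power_divide[symmetric])
    qed
    obtain j where "(4/3::real) ^ j > C" using real_arch_pow[of "4/3" C] by auto
    then show ?thesis using le[of j] by simp
  next
    case 2
    have "\<exists>K. \<forall>w\<in>words m. vnorm (W w *\<^sub>v unit_vec n j) \<le> K" for j
    proof -
      have "unit_vec n j \<in> U" using 2 by simp
      then show ?thesis unfolding U_def by blast
    qed
    then obtain K where K: "\<And>w j. w \<in> words m \<Longrightarrow> vnorm (W w *\<^sub>v unit_vec n j) \<le> K j" by metis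
    have K0: "K j \<ge> 0" for j using K[of "[]" j] by (auto intro: order_trans[OF vnorm_nonneg])
    have "mnorm (W w) \<le> 1 + real n * real n * (\<Sum>j<n. K j)" if w: "w \<in> words m" for w
    proof -
      have "mnorm (W w) \<le> real (dim_row (W w)) * real (dim_col (W w)) * (\<Sum>j<n. K j)"
      proof (rule mnorm_le)
        fix i j assume ij: "i < dim_row (W w)" "j < dim_col (W w)"
        then have ij': "i < n" "j < n" using W_carrier[OF w] by auto
        have "(W w *\<^sub>v unit_vec n j) $ i = W w $$ (i,j)"
          using W_carrier[OF w] ij' by (simp add: scalar_prod_right_unit[of j n "row (W w) i"])
        then have "norm (W w $$ (i,j)) \<le> K j"
          using norm_entry_le_vnorm[of i "W w *\<^sub>v unit_vec n j"] K[OF w, of j] ij by simp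
        also have "\<dots> \<le> (\<Sum>j<n. K j)" using K0 ij' by (intro member_le_sum) auto
        finally show "norm (W w $$ (i,j)) \<le> (\<Sum>j<n. K j)" .
      qed
      then show ?thesis using W_carrier[OF w] by simp
    qed
    then show ?thesis using K0 by (intro exI[of _ "1 + real n * real n * (\<Sum>j<n. K j)"]) (auto intro!: sum_nonneg mult_nonneg_nonneg)
  qed
qed

end

section \<open>Products of small spectral radius\<close>

text \<open>The determinant is the characteristic polynomial of \<open>U\<close> at 1, hence the
  product of \<open>1 - a\<close> over the eigenvalues \<open>a\<close>, and each factor has modulus
  at least \<open>1 - q\<close>.\<close>

lemma det_one_minus_ge:
  fixes U :: "real mat"
  assumes U: "U \<in> carrier_mat n n" and ev: "\<And>z. eigenvalue (complexify U) z \<Longrightarrow> cmod z \<le> q" and q: "q < 1"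
  shows "\<bar>det (1\<^sub>m n + (-1) \<cdot>\<^sub>m U)\<bar> \<ge> (1 - q) ^ n"
proof -
  have cU: "complexify U \<in> carrier_mat n n" using U by auto
  obtain as where as: "char_poly (complexify U) = (\<Prod>a\<leftarrow>as. [:- a, 1:])" "length as = n"
    using char_poly_factorized[OF cU] by blast
  have "cmod a \<le> q" if "a \<in> set as" for a
    using ev eigenvalue_root_char_poly[OF cU, of a] linear_poly_root[OF that] as(1) by simp
  then have "cmod (\<Prod>a\<leftarrow>as. 1 - a) \<ge> (1 - q) ^ length as"
  proof (induction as)
    case (Cons a as)
    have "cmod (1 - a) \<ge> 1 - q" using norm_triangle_ineq2[of 1 a] Cons.prems[of a] by simp
    then show ?case using Cons q by (simp add: norm_mult mult_mono)
  qed auto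
  also have "(\<Prod>a\<leftarrow>as. 1 - a) = poly (char_poly (complexify U)) 1"
    unfolding as by (induction as) (auto simp: algebra_simps)
  also have "\<dots> = det (- char_matrix (complexify U) 1)" by (rule char_poly_matrix[OF cU])
  also have "- char_matrix (complexify U) 1 = complexify (1\<^sub>m n + (-1) \<cdot>\<^sub>m U)"
    unfolding char_matrix_def using U by (intro eq_matI) auto
  also have "det \<dots> = complex_of_real (det (1\<^sub>m n + (-1) \<cdot>\<^sub>m U))" by (rule of_real_hom.hom_det)
  finally show ?thesis using as by simp
qed

lemma abs_det_le:
  fixes Y :: "real mat"
  assumes Y: "Y \<in> carrier_mat k k" and b: "\<And>i j. i < k \<Longrightarrow> j < k \<Longrightarrow> \<bar>Y $$ (i,j)\<bar> \<le> b"
  shows "\<bar>det Y\<bar> \<le> fact k * b ^ k"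
proof -
  have "\<bar>det Y\<bar> \<le> (\<Sum>p | p permutes {0..<k}. \<bar>signof p * (\<Prod>i = 0..<k. Y $$ (i, p i))\<bar>)"
    unfolding det_def'[OF Y] by (rule sum_abs)
  also have "\<dots> \<le> (\<Sum>p | p permutes {0..<k}. b ^ k)"
  proof (intro sum_mono)
    fix p assume p: "p \<in> {p. p permutes {0..<k}}"
    have "\<bar>signof p * (\<Prod>i = 0..<k. Y $$ (i, p i))\<bar> = (\<Prod>i = 0..<k. \<bar>Y $$ (i, p i)\<bar>)"
      by (cases p rule: sign_cases) (simp_all add: abs_prod)
    also have "\<dots> \<le> (\<Prod>i = 0..<k. b)"
      using p permutes_in_image[of p "{0..<k}"] by (intro prod_mono conjI b) auto
    finally show "\<bar>signof p * (\<Prod>i = 0..<k. Y $$ (i, p i))\<bar> \<le> b ^ k" by simp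
  qed
  also have "\<dots> = fact k * b ^ k" by (simp add: card_permutations[OF refl])
  finally show ?thesis .
qed

text \<open>The adjugate is polynomial in the entries and thus bounded on bounded sets, whereas the
  inverse is controlled only after division by the determinant. Its entries are signed minors,
  estimated by the Leibniz formula.\<close>

lemma mnorm_adj_mat_le:
  "\<exists>C>0. \<forall>X\<in>carrier_mat n n. mnorm X \<le> b \<longrightarrow> mnorm (adj_mat X :: real mat) \<le> C"
proof -
  define C where "C = real n * real n * (fact (n - 1) * b ^ (n - 1))"
  have "mnorm (adj_mat X) \<le> C" if X: "X \<in> carrier_mat n n" and b: "mnorm X \<le> b" for X :: "real mat"
  proof -
    have "mnorm (adj_mat X) \<le> real (dim_row (adj_mat X)) * real (dim_col (adj_mat X)) * (fact (n - 1) * b ^ (n - 1))"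
    proof (rule mnorm_le)
      fix i j assume "i < dim_row (adj_mat X)" "j < dim_col (adj_mat X)"
      then have ij: "i < n" "j < n" using adj_mat(1)[OF X] by auto
      have "\<bar>det (mat_delete X j i)\<bar> \<le> fact (n - 1) * b ^ (n - 1)"
      proof (rule abs_det_le)
        show "mat_delete X j i \<in> carrier_mat (n - 1) (n - 1)" using mat_delete_carrier[OF X] .
        fix i' j' assume "i' < n - 1" "j' < n - 1"
        then have "\<exists>k<n. \<exists>l<n. mat_delete X j i $$ (i', j') = X $$ (k, l)"
          unfolding mat_delete_def using X
          by (intro exI[of _ "if i' < j then i' else Suc i'"] exI[of _ "if j' < i then j' else Suc j'"] conjI) auto
        then show "\<bar>mat_delete X j i $$ (i', j')\<bar> \<le> b"
          using norm_entry_le_mnorm[of _ X] X b by (force intro: order_trans)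
      qed
      moreover have "\<bar>(- 1) ^ (j + i) :: real\<bar> = 1" by (simp add: power_abs)
      ultimately show "norm (adj_mat X $$ (i,j)) \<le> fact (n - 1) * b ^ (n - 1)"
        unfolding adj_mat_def cofactor_def using X ij by (simp add: abs_mult)
    qed
    then show ?thesis using adj_mat(1)[OF X] unfolding C_def by simp
  qed
  then show ?thesis by (intro exI[of _ "max C 1"]) (auto intro: max.coboundedI1)
qed

text \<open>Total boundedness, with \<open>J\<close> independent of the sequence: rounding the
  entries to multiples of \<open>\<eta>\<close> leaves finitely many patterns, and \<open>J\<close>
  is their number.\<close>

lemma bounded_mats_close_pair:
  assumes d: "\<delta> > 0"
  shows "\<exists>J. \<forall>P :: nat \<Rightarrow> real mat. (\<forall>k\<le>J. P k \<in> carrier_mat n n \<and> mnorm (P k) \<le> K) \<longrightarrow>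
    (\<exists>i j. i < j \<and> j \<le> J \<and> mnorm (P i + (-1) \<cdot>\<^sub>m P j) \<le> \<delta>)"
proof -
  \<comment> \<open>The errors of \<open>n * n\<close> entries add up to at most
    \<open>\<delta>\<close>; the summand 1 covers \<open>n = 0\<close>.\<close>
  define \<eta> where "\<eta> = \<delta> / (1 + real n * real n)"
  have eta: "\<eta> > 0" unfolding \<eta>_def using d by (auto intro!: divide_pos_pos add_pos_nonneg)
  define M where "M = \<lceil>K / \<eta>\<rceil> + 1"
  define I where "I = {..<n} \<times> {..<n}"
  define T where "T = PiE I (\<lambda>_. {-M..M})"
  have fT: "finite T" unfolding T_def I_def by (intro finite_PiE) auto
  have *: "\<exists>i j. i < j \<and> j \<le> card T \<and> mnorm (P i + (-1) \<cdot>\<^sub>m P j) \<le> \<delta>"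
    if P: "\<And>k. k \<le> card T \<Longrightarrow> P k \<in> carrier_mat n n" "\<And>k. k \<le> card T \<Longrightarrow> mnorm (P k) \<le> K"
    for P :: "nat \<Rightarrow> real mat"
  proof -
    define g where "g k = restrict (\<lambda>ij. \<lfloor>P k $$ ij / \<eta>\<rfloor>) I" for k
    have "g k \<in> T" if k: "k \<le> card T" for k
    proof -
      have "\<lfloor>P k $$ ij / \<eta>\<rfloor> \<in> {-M..M}" if "ij \<in> I" for ij
      proof -
        obtain a b where ij: "ij = (a, b)" "a < n" "b < n" using \<open>ij \<in> I\<close> unfolding I_def by auto
        have "\<bar>P k $$ ij\<bar> \<le> K"
          using norm_entry_le_mnorm[of a "P k" b] P(1)[OF k] P(2)[OF k] ij by auto
        then have "P k $$ ij / \<eta> \<le> K / \<eta>" "- (K / \<eta>) \<le> P k $$ ij / \<eta>"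
          using eta by (auto simp: divide_le_cancel minus_divide_left simp del: divide_minus_left)
        then show ?thesis unfolding M_def by (simp; linarith)
      qed
      then show ?thesis unfolding g_def T_def by auto
    qed
    then have "g ` {..card T} \<subseteq> T" by auto
    then have "card (g ` {..card T}) \<le> card T" by (rule card_mono[OF fT])
    then have "card (g ` {..card T}) < card {..card T}" by simp
    then have "\<not> inj_on g {..card T}" by (rule pigeonhole)
    then obtain a b where ab: "a \<le> card T" "b \<le> card T" "a \<noteq> b" "g a = g b"
      unfolding inj_on_def by auto
    obtain i j where ij: "i < j" "j \<le> card T" "g i = g j"
      using that[of a b] that[of b a] ab by (cases "a < b") auto
    have close: "\<bar>P i $$ (a,b) - P j $$ (a,b)\<bar> \<le> \<eta>" if "a < n" "b < n" for a b
    proof -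
      have "\<lfloor>P i $$ (a,b) / \<eta>\<rfloor> = \<lfloor>P j $$ (a,b) / \<eta>\<rfloor>"
        using fun_cong[OF ij(3), of "(a,b)"] that unfolding g_def I_def by simp
      then have "\<bar>P i $$ (a,b) / \<eta> - P j $$ (a,b) / \<eta>\<bar> \<le> 1" by linarith
      then have "\<bar>P i $$ (a,b) - P j $$ (a,b)\<bar> / \<eta> \<le> 1"
        using eta by (simp add: diff_divide_distrib[symmetric] abs_divide)
      then show ?thesis using eta by (simp add: pos_divide_le_eq)
    qed
    have C: "P i \<in> carrier_mat n n" "P j \<in> carrier_mat n n" using P ij by auto
    have "mnorm (P i + (-1) \<cdot>\<^sub>m P j) \<le> real n * real n * \<eta>"
      using mnorm_le[of "P i + (-1) \<cdot>\<^sub>m P j" \<eta>] close C by auto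
    also have "\<dots> \<le> \<delta>"
      unfolding \<eta>_def using d by (simp add: pos_divide_le_eq add_pos_nonneg mult.commute algebra_simps)
    finally show ?thesis using ij by blast
  qed
  show ?thesis
  proof (rule exI[of _ "card T"], intro allI impI)
    fix P :: "nat \<Rightarrow> real mat"
    assume "\<forall>k\<le>card T. P k \<in> carrier_mat n n \<and> mnorm (P k) \<le> K"
    then show "\<exists>i j. i < j \<and> j \<le> card T \<and> mnorm (P i + (-1) \<cdot>\<^sub>m P j) \<le> \<delta>"
      by (intro *) auto
  qed
qed

text \<open>The word between two partial products is itself a concatenation of words of
  \<open>S\<close>, which is why the spectral bound is demanded for all concatenations. The factor
  \<open>1 - U\<close> is removed with its adjugate, whose norm is bounded independently of
  \<open>U\<close>.\<close>

lemma (in mat_family) concat_products_small: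
  assumes K: "\<And>w. w \<in> words m \<Longrightarrow> mnorm (W w) \<le> K" and S: "S \<subseteq> words m" and q: "q < 1"
    and ev: "\<And>us z. us \<noteq> [] \<Longrightarrow> set us \<subseteq> S \<Longrightarrow> eigenvalue (complexify (W (concat us))) z \<Longrightarrow> cmod z \<le> q"
    and eps: "\<epsilon> > 0"
  shows "\<exists>J>0. \<forall>us. length us = J \<longrightarrow> set us \<subseteq> S \<longrightarrow> mnorm (W (concat us)) < \<epsilon>"
proof -
  define K' where "K' = max K 1"
  have K': "K' \<ge> 1" "\<And>w. w \<in> words m \<Longrightarrow> mnorm (W w) \<le> K'"
    using K unfolding K'_def by (auto intro: max.coboundedI1)
  obtain Ca where Ca: "Ca > 0" "\<And>X :: real mat. X \<in> carrier_mat n n \<Longrightarrow> mnorm X \<le> K' + K' \<Longrightarrow> mnorm (adj_mat X) \<le> Ca"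
    using mnorm_adj_mat_le[of n "K' + K'"] by blast
  \<comment> \<open>Solved backwards from the last estimate: the adjugate and the determinant leave
    \<open>\<epsilon> / (2 * K')\<close> for the partial product. The remaining factor costs
    \<open>K'\<close>, and the 2 makes the inequality strict.\<close>
  define \<delta> where "\<delta> = \<epsilon> * (1 - q) ^ n / (2 * K' * Ca)"
  have d: "\<delta> > 0" unfolding \<delta>_def using eps q K' Ca by auto
  obtain J where J: "\<forall>P :: nat \<Rightarrow> real mat. (\<forall>k\<le>J. P k \<in> carrier_mat n n \<and> mnorm (P k) \<le> K') \<longrightarrow>
      (\<exists>i j. i < j \<and> j \<le> J \<and> mnorm (P i + (-1) \<cdot>\<^sub>m P j) \<le> \<delta>)"
    using bounded_mats_close_pair[OF d, of n K'] by (elim exE)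
  have small: "mnorm (W (concat us)) < \<epsilon>" if len: "length us = Suc J" and us: "set us \<subseteq> S" for us
  proof -
    have wd: "concat vs \<in> words m" if "set vs \<subseteq> set us" for vs
      using that us S by (intro words_concat) auto
    have tk: "concat (take k us) \<in> words m" for k using wd set_take_subset by metis
    define P where "P k = W (concat (take k us))" for k
    have Pc: "P k \<in> carrier_mat n n" for k unfolding P_def using tk by simp
    have Pn: "mnorm (P k) \<le> K'" for k unfolding P_def using tk K' by simp
    obtain i j where ij: "i < j" "j \<le> J" and close: "mnorm (P i + (-1) \<cdot>\<^sub>m P j) \<le> \<delta>"
      using J[rule_format, of P] Pc Pn by auto
    define u where "u = take (j - i) (drop i us)"
    have tju: "take j us = take i us @ u"
      unfolding u_def using ij by (metis le_add_diff_inverse less_imp_le take_add)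
    have uset: "set u \<subseteq> set us" unfolding u_def by (meson set_take_subset set_drop_subset order_trans)
    have une: "u \<noteq> []" unfolding u_def using ij len by auto
    define X where "X = W (concat u)"
    have Xc: "X \<in> carrier_mat n n" unfolding X_def using wd[OF uset] by simp
    have PjX: "P j = P i * X"
      unfolding P_def X_def tju concat_append using tk wd[OF uset] by (rule W_append)
    define Y where "Y = 1\<^sub>m n + (-1) \<cdot>\<^sub>m X"
    have Yc: "Y \<in> carrier_mat n n" unfolding Y_def using Xc by auto
    have detY: "\<bar>det Y\<bar> \<ge> (1 - q) ^ n"
      unfolding Y_def using Xc ev[OF une] uset us q by (intro det_one_minus_ge) (auto simp: X_def)
    have "mnorm Y \<le> mnorm (1\<^sub>m n :: real mat) + mnorm ((-1) \<cdot>\<^sub>m X)"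
      unfolding Y_def using Xc by (intro mnorm_add) auto
    also have "\<dots> \<le> K' + K'"
      using K'(2)[of "[]"] K'(2)[OF wd[OF uset]] by (simp add: mnorm_smult X_def)
    finally have adj: "mnorm (adj_mat Y) \<le> Ca" using Ca Yc by blast
    have "P i + (-1) \<cdot>\<^sub>m P j = P i * Y"
      unfolding Y_def PjX using Pc[of i] Xc
      by (simp add: mult_add_distrib_mat[of _ n n _ n] mult_smult_distrib[of _ n n _ n])
    then have "(P i + (-1) \<cdot>\<^sub>m P j) * adj_mat Y = P i * (Y * adj_mat Y)"
      using assoc_mult_mat[OF Pc Yc adj_mat(1)[OF Yc]] by simp
    also have "\<dots> = det Y \<cdot>\<^sub>m P i"
      unfolding adj_mat(2)[OF Yc] using Pc[of i] by (simp add: mult_smult_distrib[of _ n n _ n])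
    finally have "\<bar>det Y\<bar> * mnorm (P i) = mnorm ((P i + (-1) \<cdot>\<^sub>m P j) * adj_mat Y)"
      by (simp add: mnorm_smult)
    also have "\<dots> \<le> mnorm (P i + (-1) \<cdot>\<^sub>m P j) * mnorm (adj_mat Y)"
      using Pc[of i] Pc[of j] adj_mat(1)[OF Yc] by (intro mnorm_mult[of _ n n _ n]) auto
    also have "\<dots> \<le> \<delta> * Ca" using close adj d by (intro mult_mono) auto
    finally have "\<bar>det Y\<bar> * mnorm (P i) \<le> \<delta> * Ca" .
    then have "(1 - q) ^ n * mnorm (P i) \<le> \<delta> * Ca"
      using mult_right_mono[OF detY mnorm_nonneg[of "P i"]] by linarith
    also have "\<dots> = (1 - q) ^ n * (\<epsilon> / (2 * K'))" unfolding \<delta>_def using Ca by simp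
    finally have "(1 - q) ^ n * mnorm (P i) \<le> (1 - q) ^ n * (\<epsilon> / (2 * K'))" .
    then have Pi: "mnorm (P i) \<le> \<epsilon> / (2 * K')"
      using q by (subst (asm) mult_le_cancel_left_pos) auto
    have split: "concat us = concat (take i us) @ concat (drop i us)"
      by (metis append_take_drop_id concat_append)
    have dr: "concat (drop i us) \<in> words m" using wd set_drop_subset by metis
    have "mnorm (W (concat us)) \<le> mnorm (P i) * mnorm (W (concat (drop i us)))"
      unfolding split P_def using tk dr by (rule mnorm_W_append)
    also have "\<dots> \<le> \<epsilon> / (2 * K') * K'" using Pi K' dr eps by (intro mult_mono) auto
    also have "\<dots> < \<epsilon>" using K'(1) eps by simp
    finally show ?thesis .
  qed
  show ?thesis using small by (intro exI[of _ "Suc J"]) auto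
qed

section \<open>Powers of a real matrix and its complex spectrum\<close>

lemma smult_mat_pow:
  fixes X :: "real mat"
  assumes X: "X \<in> carrier_mat n n"
  shows "(c \<cdot>\<^sub>m X) ^\<^sub>m k = c ^ k \<cdot>\<^sub>m (X ^\<^sub>m k)"
proof (induction k)
  case (Suc k)
  have Xk: "X ^\<^sub>m k \<in> carrier_mat n n" using X by simp
  have "(c \<cdot>\<^sub>m X) ^\<^sub>m Suc k = (c ^ k \<cdot>\<^sub>m (X ^\<^sub>m k)) * (c \<cdot>\<^sub>m X)" using Suc by simp
  also have "\<dots> = c ^ k \<cdot>\<^sub>m (c \<cdot>\<^sub>m (X ^\<^sub>m k * X))"
    using X Xk by (simp add: mult_smult_distrib[OF Xk X] mult_smult_assoc_mat[of _ n n _ n])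
  also have "\<dots> = c ^ Suc k \<cdot>\<^sub>m (X ^\<^sub>m Suc k)" using X Xk by (intro eq_matI) auto
  finally show ?case .
qed (use X in \<open>auto intro!: eq_matI\<close>)

lemma complexify_pow: "X \<in> carrier_mat n n \<Longrightarrow> complexify (X ^\<^sub>m k) = complexify X ^\<^sub>m k"
  by (rule of_real_hom.mat_hom_pow)

lemma norm_bound_mnorm:
  assumes X: "X \<in> carrier_mat n n" and b: "norm_bound (complexify X) b"
  shows "mnorm X \<le> real n * real n * b"
  using mnorm_le[of X b] b X unfolding norm_bound_def by auto

text \<open>Powers of a matrix of spectral radius below one are bounded. Dividing first by some
  \<open>s\<close> between the spectrum and one keeps the radius below one and turns boundedness
  into geometric decay.\<close>

lemma pow_decay_of_eigenvalues:
  fixes X :: "real mat"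
  assumes X: "X \<in> carrier_mat n n" and n: "n > 0" and q: "q < 1"
    and ev: "\<And>z. eigenvalue (complexify X) z \<Longrightarrow> cmod z \<le> q"
  shows "\<exists>C s. C > 0 \<and> 0 < s \<and> s < 1 \<and> (\<forall>k. mnorm (X ^\<^sub>m k) \<le> C * s ^ k)"
proof -
  \<comment> \<open>The maximum with 0 keeps \<open>s\<close> positive, as \<open>q\<close> carries
    no sign condition.\<close>
  define s where "s = (1 + max q 0) / 2"
  have s: "0 < s" "s < 1" "q < s" using q unfolding s_def by (auto simp: max_def)
  define Y where "Y = (1 / s) \<cdot>\<^sub>m X"
  have Y: "Y \<in> carrier_mat n n" "complexify Y \<in> carrier_mat n n" using X unfolding Y_def by auto
  have "cmod z < 1" if z: "eigenvalue (complexify Y) z" for z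
  proof -
    obtain v where v: "v \<in> carrier_vec n" "v \<noteq> 0\<^sub>v n" "complexify Y *\<^sub>v v = z \<cdot>\<^sub>v v"
      using z Y(2) unfolding eigenvalue_def eigenvector_def by auto
    have cX: "complexify X \<in> carrier_mat n n" using X by simp
    have "complexify X = complex_of_real s \<cdot>\<^sub>m complexify Y"
      unfolding Y_def using s X by (intro eq_matI) auto
    then have "complexify X *\<^sub>v v = complex_of_real s \<cdot>\<^sub>v (complexify Y *\<^sub>v v)"
      using Y(2) v(1) by (intro eq_vecI) auto
    also have "\<dots> = (complex_of_real s * z) \<cdot>\<^sub>v v"
      unfolding v(3) by (simp add: smult_smult_assoc)
    finally have "eigenvalue (complexify X) (complex_of_real s * z)"
      using v cX unfolding eigenvalue_def eigenvector_def by auto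
    then have "s * cmod z \<le> q" using ev s by (force simp: norm_mult)
    then have "s * cmod z < s * 1" using s by linarith
    then show ?thesis using s by (simp only: mult_less_cancel_left_pos)
  qed
  then have "spectral_radius (complexify Y) < 1"
    using spectral_radius_mem_max(1)[OF Y(2) n] unfolding spectrum_def by auto
  then obtain c where c: "\<And>k. norm_bound (complexify Y ^\<^sub>m k) c"
    using spectral_radius_jnf_norm_bound_less_1_upper_triangular[OF Y(2)] by blast
  define C where "C = max 1 (real n * real n * c)"
  have "mnorm (X ^\<^sub>m k) \<le> C * s ^ k" for k
  proof -
    have "mnorm (Y ^\<^sub>m k) \<le> real n * real n * c"
      using c[of k] Y(1) by (intro norm_bound_mnorm) (auto simp: complexify_pow)
    moreover have "mnorm (Y ^\<^sub>m k) = (1 / s) ^ k * mnorm (X ^\<^sub>m k)"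
      unfolding Y_def smult_mat_pow[OF X] mnorm_smult using s by simp
    ultimately have "mnorm (X ^\<^sub>m k) / s ^ k \<le> C" unfolding C_def by (simp add: power_one_over)
    then show ?thesis using s by (simp add: pos_divide_le_eq)
  qed
  then show ?thesis using s unfolding C_def by (intro exI[of _ C] exI[of _ s]) (auto simp: C_def)
qed

text \<open>A complex eigenvector is stretched by exactly \<open>cmod z\<close> at each step, which
  a bound of rate \<open>r < cmod z\<close> cannot allow. The bound on real powers applies because
  \<open>mnorm\<close> is unchanged by complexification.\<close>

lemma eigenvalue_le_of_pow_bound:
  fixes X :: "real mat"
  assumes X: "X \<in> carrier_mat n n" and z: "eigenvalue (complexify X) z"
    and r: "r > 0" and le: "\<And>k. mnorm (X ^\<^sub>m k) \<le> C * r ^ k"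
  shows "cmod z \<le> r"
proof (rule ccontr)
  assume "\<not> ?thesis"
  then have gt: "cmod z / r > 1" using r by simp
  have cX: "complexify X \<in> carrier_mat n n" using X by simp
  obtain v where ev: "eigenvector (complexify X) v z" using z unfolding eigenvalue_def by blast
  then have v: "v \<in> carrier_vec n" "v \<noteq> 0\<^sub>v n" using cX unfolding eigenvector_def by auto
  have pos: "vnorm v > 0" using vnorm_nonneg[of v] vnorm_eq_0_iff[OF v(1)] v(2) by linarith
  have "(cmod z / r) ^ k \<le> C" for k
  proof -
    have "cmod z ^ k * vnorm v = vnorm (complexify X ^\<^sub>m k *\<^sub>v v)"
      unfolding eigenvector_pow[OF cX ev] vnorm_smult by (simp add: norm_power)
    also have "\<dots> \<le> mnorm (complexify X ^\<^sub>m k) * vnorm v"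
      using cX v by (intro vnorm_mult_mat_vec) auto
    also have "mnorm (complexify X ^\<^sub>m k) = mnorm (X ^\<^sub>m k)"
      using complexify_pow[OF X, of k] mnorm_complexify by metis
    finally have "cmod z ^ k \<le> C * r ^ k" using pos le[of k] by simp
    then show ?thesis using r by (simp add: power_divide pos_divide_le_eq)
  qed
  moreover obtain k where "(cmod z / r) ^ k > C" using real_arch_pow[OF gt] by blast
  ultimately show False by (meson not_le)
qed

lemma eigenvalue_le_spectral_radius:
  assumes X: "X \<in> carrier_mat n n" and z: "eigenvalue X z"
  shows "cmod z \<le> spectral_radius X"
  using spectral_radius_mem_max(2)[OF X eigenvalue_imp_nonzero_dim[OF X z]] z
  unfolding spectrum_def by auto

section \<open>Factors of powers of a word\<close>

definition periodic :: "nat list \<Rightarrow> nat list \<Rightarrow> bool" where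
  "periodic p w \<longleftrightarrow> (\<exists>k. sublist w (word_pow p k))"

lemma periodic_Nil [simp]: "periodic p []"
  unfolding periodic_def by auto

lemma periodic_sublist: "sublist u w \<Longrightarrow> periodic p w \<Longrightarrow> periodic p u"
  unfolding periodic_def using sublist_order.order.trans by blast

text \<open>With \<open>p = x @ y\<close> and \<open>p' = y @ x\<close>, padding a power of
  \<open>p'\<close> by \<open>x\<close> in front and \<open>y\<close> behind gives the next power of
  \<open>p\<close>.\<close>

lemma periodic_word_pow_cyclic_perm:
  assumes "cyclic_perm p p'"
  shows "periodic p (word_pow p' k)"
proof -
  obtain r where r: "p' = rotate r p" using assms unfolding cyclic_perm_def by blast
  define x y where "x = take (r mod length p) p" and "y = drop (r mod length p) p"
  have p: "p = x @ y" "p' = y @ x" unfolding x_def y_def r rotate_drop_take by auto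
  have "x @ word_pow p' k @ y = word_pow p (Suc k)"
  proof (induction k)
    case (Suc k)
    have "x @ word_pow p' (Suc k) @ y = (x @ y) @ (x @ word_pow p' k @ y)"
      by (simp add: p word_pow_Suc)
    then show ?case using Suc p(1) by (simp add: word_pow_Suc)
  qed (simp add: p word_pow_Suc)
  then have "sublist (word_pow p' k) (word_pow p (Suc k))"
    unfolding sublist_def by metis
  then show ?thesis unfolding periodic_def by blast
qed

lemma cyclic_perm_sym:
  assumes "cyclic_perm p p'"
  shows "cyclic_perm p' p"
proof (cases "p = []")
  case True then show ?thesis using assms unfolding cyclic_perm_def by auto
next
  case False
  obtain r where r: "p' = rotate r p" using assms unfolding cyclic_perm_def by blast
  define t where "t = length p - r mod length p"
  have "t + r mod length p = length p" unfolding t_def using False by simp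
  then have "(t + r) mod length p = 0" by (metis mod_add_right_eq mod_self)
  then have "rotate t p' = p" unfolding r rotate_rotate by (metis rotate_conv_mod rotate0 id_apply)
  then show ?thesis unfolding cyclic_perm_def by metis
qed

lemma cyclic_perm_trans: "cyclic_perm p p' \<Longrightarrow> cyclic_perm p' p'' \<Longrightarrow> cyclic_perm p p''"
  unfolding cyclic_perm_def by (metis rotate_rotate)

lemma prefix_word_pow:
  assumes "prefix w (word_pow p k)"
  shows "\<exists>j t. w = word_pow p j @ t \<and> sublist t p"
  using assms
proof (induction k arbitrary: w)
  case 0
  then show ?case by (intro exI[of _ 0] exI[of _ "[]"]) auto
next
  case (Suc k)
  then have "prefix w (p @ word_pow p k)" by (simp add: word_pow_Suc)
  then consider "prefix w p" | v where "w = p @ v" "prefix v (word_pow p k)"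
    by (auto simp: prefix_append)
  then show ?case
  proof cases
    case 1 then show ?thesis by (intro exI[of _ 0] exI[of _ w]) auto
  next
    case 2
    then obtain j t where "v = word_pow p j @ t" "sublist t p" using Suc.IH by blast
    then show ?thesis using 2 by (intro exI[of _ "Suc j"] exI[of _ t]) (auto simp: word_pow_Suc)
  qed
qed

text \<open>Only the middle part can be long: the border pieces are no longer than \<open>p\<close>,
  so estimates on periodic words reduce to powers of \<open>p\<close>.\<close>

lemma periodic_decomposition:
  assumes "periodic p w"
  shows "\<exists>s j t. w = s @ word_pow p j @ t \<and> sublist s p \<and> sublist t p"
proof -
  obtain k where "sublist w (word_pow p k)" using assms unfolding periodic_def by blast
  then show ?thesis
  proof (induction k)
    case 0
    then show ?case by (intro exI[of _ "[]"] exI[of _ 0]) auto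
  next
    case (Suc k)
    then consider "sublist w p" | "sublist w (word_pow p k)"
      | x y where "w = x @ y" "suffix x p" "prefix y (word_pow p k)"
      by (auto simp: word_pow_Suc sublist_append)
    then show ?case
    proof cases
      case 1 then show ?thesis by (intro exI[of _ w] exI[of _ 0] exI[of _ "[]"]) auto
    next
      case 2 then show ?thesis using Suc.IH by blast
    next
      case 3
      then show ?thesis using prefix_word_pow[OF 3(3)] by (metis suffix_imp_sublist)
    qed
  qed
qed

lemma concat_not_periodic:
  assumes "us \<noteq> []" and "\<And>u. u \<in> set us \<Longrightarrow> \<not> periodic p u"
  shows "\<not> periodic p (concat us)"
proof -
  obtain u vs where us: "us = u # vs" using assms(1) by (cases us) auto
  then have "sublist u (concat us)" by auto
  then show ?thesis using periodic_sublist assms(2)[of u] us by auto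
qed

lemma split_into_blocks:
  "length w = J * l \<Longrightarrow> \<exists>us. length us = J \<and> concat us = w \<and> (\<forall>u\<in>set us. length u = l)"
proof (induction J arbitrary: w)
  case (Suc J)
  have "length (drop l w) = J * l" using Suc.prems by simp
  then obtain us where us: "length us = J" "concat us = drop l w" "\<forall>u\<in>set us. length u = l"
    using Suc.IH by blast
  then show ?case using Suc.prems by (intro exI[of _ "take l w # us"]) auto
qed auto

section \<open>Dominant words\<close>

text \<open>The exceptional words are enlarged from powers of cyclic permutations of
  \<open>p\<close> to all periodic words. At joint spectral radius one this is weaker than
  dominance, but the words it controls are closed under nonempty concatenation.\<close>

definition dominates :: "nat \<Rightarrow> nat \<Rightarrow> (nat \<Rightarrow> real mat) \<Rightarrow> real \<Rightarrow> nat list \<Rightarrow> bool" where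
  "dominates n m B q p \<longleftrightarrow> q < 1 \<and> (\<forall>w\<in>words m. \<not> periodic p w \<longrightarrow>
     (\<forall>z. eigenvalue (complexify (word_prod n B w)) z \<longrightarrow> cmod z \<le> q))"

lemma spectral_radius_less_1:
  assumes X: "X \<in> carrier_mat n n" and n: "n > 0" and ev: "\<And>z. eigenvalue X z \<Longrightarrow> cmod z < 1"
  shows "spectral_radius X < 1"
  using spectral_radius_mem_max(1)[OF X n] ev unfolding spectrum_def by auto

context mat_family
begin

text \<open>Normalisation is trivial at radius one. The exact exceptional set is kept, because the
  dominant word of another family may be a factor of a power of \<open>p\<close> without being a
  power of a cyclic permutation of \<open>p\<close>.\<close>

lemma dominant_word_eigenvalue:
  assumes jsr: "joint_spectral_radius N n m B = 1" and dom: "dominant_word N n m B p"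
  shows "\<exists>q<1. \<forall>w\<in>words m. w \<noteq> [] \<and> \<not> (\<exists>p' k. cyclic_perm p p' \<and> w = word_pow p' k) \<longrightarrow>
     (\<forall>z. eigenvalue (complexify (W w)) z \<longrightarrow> cmod z < q)"
proof -
  have "normalized_family N n m B = B"
    unfolding normalized_family_def jsr by (intro ext eq_matI) auto
  then obtain q where q: "q < 1" "\<forall>w\<in>words m. w \<noteq> [] \<and> \<not> (\<exists>p' k. cyclic_perm p p' \<and> w = word_pow p' k) \<longrightarrow>
     spectral_radius (complexify (W w)) < q"
    using dom unfolding dominant_word_def by auto
  show ?thesis
  proof (intro exI[of _ q] conjI q(1) ballI impI allI)
    fix w z assume w: "w \<in> words m" "w \<noteq> [] \<and> \<not> (\<exists>p' k. cyclic_perm p p' \<and> w = word_pow p' k)"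
      and z: "eigenvalue (complexify (W w)) z"
    have "cmod z \<le> spectral_radius (complexify (W w))"
      using eigenvalue_le_spectral_radius[of "complexify (W w)" n z] W_carrier[OF w(1)] z by simp
    then show "cmod z < q" using q(2) w by fastforce
  qed
qed

lemma dominant_word_dominates:
  assumes jsr: "joint_spectral_radius N n m B = 1" and dom: "dominant_word N n m B p"
    and p': "cyclic_perm p p'"
  shows "\<exists>q. dominates n m B q p'"
proof -
  obtain q where q: "q < 1" "\<forall>w\<in>words m. w \<noteq> [] \<and> \<not> (\<exists>p' k. cyclic_perm p p' \<and> w = word_pow p' k) \<longrightarrow>
     (\<forall>z. eigenvalue (complexify (W w)) z \<longrightarrow> cmod z < q)"
    using dominant_word_eigenvalue[OF jsr dom] by blast
  have "\<not> periodic p' w \<Longrightarrow> w \<noteq> [] \<and> \<not> (\<exists>p'' k. cyclic_perm p p'' \<and> w = word_pow p'' k)" for w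
    using periodic_word_pow_cyclic_perm cyclic_perm_trans[OF cyclic_perm_sym[OF p']] by auto
  then have "dominates n m B q p'" unfolding dominates_def using q by (meson less_imp_le)
  then show ?thesis ..
qed

lemma nonperiodic_products_small:
  assumes K: "\<And>w. w \<in> words m \<Longrightarrow> mnorm (W w) \<le> K" and dom: "dominates n m B q p" and eps: "\<epsilon> > 0"
  shows "\<exists>J>0. \<forall>us. length us = J \<longrightarrow> (\<forall>u\<in>set us. u \<in> words m \<and> \<not> periodic p u) \<longrightarrow> mnorm (W (concat us)) < \<epsilon>"
proof -
  define S where "S = {w \<in> words m. \<not> periodic p w}"
  have "\<exists>J>0. \<forall>us. length us = J \<longrightarrow> set us \<subseteq> S \<longrightarrow> mnorm (W (concat us)) < \<epsilon>"
  proof (rule concat_products_small[OF K _ _ _ eps])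
    show "S \<subseteq> words m" unfolding S_def by auto
    show "q < 1" using dom unfolding dominates_def by simp
    fix us z assume us: "us \<noteq> []" "set us \<subseteq> S" and z: "eigenvalue (complexify (W (concat us))) z"
    have "\<not> periodic p (concat us)" using us by (intro concat_not_periodic) (auto simp: S_def)
    moreover have "concat us \<in> words m" using us by (intro words_concat) (auto simp: S_def)
    ultimately show "cmod z \<le> q" using dom z unfolding dominates_def by blast
  qed
  then show ?thesis unfolding S_def subset_iff Ball_def mem_Collect_eq .
qed

text \<open>Cut into \<open>J\<close> equal blocks: either all of them break the period, or one is
  periodic. Since \<open>J\<close> is chosen before \<open>l\<close>, the block length stays free to
  be fitted to the decay of periodic products.\<close>

lemma small_or_periodic_factor:
  assumes K: "\<And>w. w \<in> words m \<Longrightarrow> mnorm (W w) \<le> K" and dom: "dominates n m B q p"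
    and eps: "\<epsilon> > 0"
  shows "\<exists>J>0. \<forall>l. \<forall>w\<in>words m. length w = J * l \<longrightarrow>
     mnorm (W w) < \<epsilon> \<or> (\<exists>a b c. w = a @ b @ c \<and> length b = l \<and> periodic p b)"
proof -
  obtain J where J: "J > 0" "\<And>us. length us = J \<Longrightarrow> (\<forall>u\<in>set us. u \<in> words m \<and> \<not> periodic p u) \<Longrightarrow> mnorm (W (concat us)) < \<epsilon>"
    using nonperiodic_products_small[OF K dom eps] by blast
  have "\<exists>a b c. w = a @ b @ c \<and> length b = l \<and> periodic p b"
    if w: "w \<in> words m" "length w = J * l" and big: "\<not> mnorm (W w) < \<epsilon>" for w l
  proof -
    obtain us where us: "length us = J" "concat us = w" "\<And>u. u \<in> set us \<Longrightarrow> length u = l"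
      using split_into_blocks[OF w(2)] by blast
    have "u \<in> words m" if "u \<in> set us" for u
      using that w(1) unfolding us(2)[symmetric] words_def by auto
    then obtain b where b: "b \<in> set us" "periodic p b" using J(2)[OF us(1)] big us(2) by auto
    obtain xs ys where "us = xs @ b # ys" using split_list[OF b(1)] by blast
    then have "w = concat xs @ b @ concat ys" using us(2) by auto
    then show ?thesis using b us(3) by blast
  qed
  then show ?thesis using J(1) by blast
qed

lemma periodic_products_small:
  assumes K: "\<And>w. w \<in> words m \<Longrightarrow> mnorm (W w) \<le> K" and n: "n > 0"
    and p: "p \<in> words m" "p \<noteq> []" and q: "q < 1"
    and ev: "\<And>z. eigenvalue (complexify (W p)) z \<Longrightarrow> cmod z \<le> q" and eps: "\<epsilon> > 0"
  shows "\<exists>l>0. \<forall>b. periodic p b \<longrightarrow> length b \<ge> l \<longrightarrow> mnorm (W b) < \<epsilon>"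
proof -
  define K' where "K' = max K 1"
  have K': "K' \<ge> 1" "\<And>w. w \<in> words m \<Longrightarrow> mnorm (W w) \<le> K'"
    using K unfolding K'_def by (auto intro: max.coboundedI1)
  obtain C s where C: "C > 0" and s: "0 < s" "s < 1" and dec: "\<And>k. mnorm (W p ^\<^sub>m k) \<le> C * s ^ k"
    using pow_decay_of_eigenvalues[OF W_carrier[OF p(1)] n q ev] by auto
  have "\<epsilon> / (K' * K' * C) > 0" using eps K' C by auto
  then obtain j0 where j0: "s ^ j0 < \<epsilon> / (K' * K' * C)" using real_arch_pow_inv[of _ s] s by blast
  \<comment> \<open>Two periods are reserved for the border pieces, so at least \<open>j0\<close>
    full copies of \<open>p\<close> remain in the middle.\<close>
  define l where "l = (j0 + 2) * length p"
  have "mnorm (W b) < \<epsilon>" if b: "periodic p b" "length b \<ge> l" for b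
  proof -
    obtain x j y where bd: "b = x @ word_pow p j @ y" "sublist x p" "sublist y p"
      using periodic_decomposition[OF b(1)] by blast
    have "length x \<le> length p" "length y \<le> length p" using bd sublist_length_le by auto
    moreover have "(j0 + 2) * length p \<le> length x + j * length p + length y"
      using b(2) unfolding l_def bd(1) by simp
    ultimately have "(j0 + 2) * length p \<le> (j + 2) * length p"
      unfolding add_mult_distrib by linarith
    then have jj: "j0 \<le> j" using p(2) by (simp only: mult_le_cancel2 length_greater_0_conv) simp
    have wd: "x \<in> words m" "y \<in> words m" "word_pow p j \<in> words m"
      using words_sublist bd p words_word_pow by auto
    have "mnorm (W b) \<le> mnorm (W x) * (mnorm (W (word_pow p j)) * mnorm (W y))"
      unfolding bd(1) using wd
      by (intro order_trans[OF mnorm_W_append] mult_left_mono mnorm_W_append) auto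
    also have "\<dots> \<le> K' * ((C * s ^ j) * K')"
      using wd K' dec[of j] C s by (intro mult_mono) (auto simp: W_word_pow[OF p(1)])
    also have "\<dots> \<le> K' * ((C * s ^ j0) * K')"
      using K' C s jj by (intro mult_mono mult_nonneg_nonneg power_decreasing) auto
    also have "\<dots> = K' * K' * C * s ^ j0" by simp
    also have "\<dots> < \<epsilon>" using j0 K' C by (simp add: pos_less_divide_eq mult.commute)
    finally show ?thesis .
  qed
  moreover have "l > 0" unfolding l_def using p by simp
  ultimately show ?thesis by blast
qed

text \<open>Splitting off blocks of length \<open>L\<close> halves the norm each time, so the decay
  rate is the \<open>L\<close>-th root of one half.\<close>

lemma jsr_less_1:
  assumes N: "mat_norm n N" and m: "m > 0" and K: "\<And>w. w \<in> words m \<Longrightarrow> mnorm (W w) \<le> K" and L: "L > 0"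
    and half: "\<And>w. w \<in> words m \<Longrightarrow> length w = L \<Longrightarrow> mnorm (W w) \<le> 1/2"
  shows "joint_spectral_radius N n m B < 1"
proof -
  define r where "r = root L (1/2)"
  have r: "0 < r" "r < 1" "r ^ L = 1/2" unfolding r_def using L real_root_pow_pos2[of L "1/2"] by auto
  \<comment> \<open>The factor 2 absorbs an incomplete last block, on which
    \<open>r ^ length w\<close> is still at least \<open>r ^ L = 1/2\<close>.\<close>
  define C where "C = 2 * max K 1"
  have "mnorm (W w) \<le> C * r ^ length w" if "w \<in> words m" for w
    using that
  proof (induction "length w" arbitrary: w rule: less_induct)
    case less
    show ?case
    proof (cases "length w < L")
      case True
      have "mnorm (W w) \<le> max K 1" using K[OF less.prems] by simp
      also have "\<dots> = C * r ^ L" unfolding C_def r by simp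
      also have "\<dots> \<le> C * r ^ length w" using r True unfolding C_def by (intro mult_left_mono power_decreasing) auto
      finally show ?thesis .
    next
      case False
      define u v where "u = take L w" and "v = drop L w"
      have w: "w = u @ v" "length u = L" "length w = L + length v" using False unfolding u_def v_def by auto
      then have wd: "u \<in> words m" "v \<in> words m" using less.prems by auto
      have "mnorm (W w) \<le> mnorm (W u) * mnorm (W v)" unfolding w(1) using wd by (rule mnorm_W_append)
      also have "\<dots> \<le> (1/2) * (C * r ^ length v)"
        using half[OF wd(1) w(2)] less.hyps[OF _ wd(2)] w(3) L by (intro mult_mono) auto
      also have "\<dots> = C * r ^ length w" unfolding w(3) power_add r(3) by simp
      finally show ?thesis .
    qed
  qed
  then have "joint_spectral_radius N n m B \<le> r" using jsr_le[OF N m, of r C] r by simp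
  then show ?thesis using r by simp
qed

text \<open>The case of the Berger-Wang theorem that is needed: if the dominant product had spectral
  radius below one, then long periodic words as well as long non-periodic words would have small
  products.\<close>

lemma dominating_word_eigenvalue_ge_1:
  assumes N: "mat_norm n N" and m: "m > 0" and n: "n > 0" and K: "\<And>w. w \<in> words m \<Longrightarrow> mnorm (W w) \<le> K"
    and jsr: "joint_spectral_radius N n m B = 1" and dom: "dominates n m B q p"
    and p: "p \<in> words m" "p \<noteq> []"
  shows "\<exists>z. eigenvalue (complexify (W p)) z \<and> cmod z \<ge> 1"
proof (rule ccontr)
  assume "\<not> ?thesis"
  then have lt: "\<And>z. eigenvalue (complexify (W p)) z \<Longrightarrow> cmod z < 1" by force
  have cX: "complexify (W p) \<in> carrier_mat n n" using W_carrier[OF p(1)] by simp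
  define K' where "K' = max K 1"
  have K': "K' \<ge> 1" "\<And>w. w \<in> words m \<Longrightarrow> mnorm (W w) \<le> K'"
    using K unfolding K'_def by (auto intro: max.coboundedI1)
  have "1 / (2 * K' * K') > 0" using K' by auto
  \<comment> \<open>The spectral radius itself serves as \<open>q\<close>, since it is attained by
    an eigenvalue and hence below one. The two factors \<open>K'\<close> in the threshold pay for
    the words on either side of the periodic factor.\<close>
  from periodic_products_small[OF K'(2) n p spectral_radius_less_1[OF cX n lt] eigenvalue_le_spectral_radius[OF cX] this]
  obtain l where l: "l > 0" "\<And>b. periodic p b \<Longrightarrow> length b \<ge> l \<Longrightarrow> mnorm (W b) < 1 / (2 * K' * K')"
    by auto
  obtain J where J: "J > 0" "\<And>l w. w \<in> words m \<Longrightarrow> length w = J * l \<Longrightarrow>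
     mnorm (W w) < 1/2 \<or> (\<exists>a b c. w = a @ b @ c \<and> length b = l \<and> periodic p b)"
    using small_or_periodic_factor[OF K'(2) dom, of "1/2"] by auto
  have "mnorm (W w) \<le> 1/2" if w: "w \<in> words m" "length w = J * l" for w
  proof (cases "mnorm (W w) < 1/2")
    case False
    then obtain a b c where abc: "w = a @ b @ c" "length b = l" "periodic p b" using J(2)[OF w] by blast
    then have wd: "a \<in> words m" "b \<in> words m" "c \<in> words m" using w by auto
    have "mnorm (W w) \<le> mnorm (W a) * (mnorm (W b) * mnorm (W c))"
      unfolding abc(1) using wd by (intro order_trans[OF mnorm_W_append] mult_left_mono mnorm_W_append) auto
    also have "\<dots> \<le> K' * (1 / (2 * K' * K') * K')"
      using wd K' l(2)[OF abc(3)] abc(2) by (intro mult_mono) auto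
    also have "\<dots> = 1/2" using K' by simp
    finally show ?thesis .
  qed auto
  then show False using jsr_less_1[OF N m K, of "J * l"] J(1) l(1) jsr by auto
qed

end

section \<open>Leading eigenvalues and Jordan blocks\<close>

lemma char_poly_nonzero:
  assumes "X \<in> carrier_mat n n"
  shows "char_poly X \<noteq> 0"
  using degree_monic_char_poly[OF assms] by auto

lemma char_poly_upper_block:
  fixes X :: "complex mat"
  assumes "X \<in> carrier_mat a a" "Y \<in> carrier_mat a b" "Z \<in> carrier_mat b b"
  shows "char_poly (four_block_mat X Y (0\<^sub>m b a) Z) = char_poly X * char_poly Z"
  using assms char_poly_factorized[of X a] char_poly_factorized[of Z b]
  by (intro char_poly_0_block[OF refl]) blast+

text \<open>\<open>UV\<close> and \<open>VU\<close> are compared through the similar block matrices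
  \<open>(UV, 0; V, 0)\<close> and \<open>(0, 0; V, VU)\<close>.\<close>

lemma char_poly_mult_commute:
  fixes U V :: "complex mat"
  assumes U: "U \<in> carrier_mat n n" and V: "V \<in> carrier_mat n n"
  shows "char_poly (U * V) = char_poly (V * U)"
proof -
  let ?O = "0\<^sub>m n n :: complex mat" and ?I = "1\<^sub>m n :: complex mat"
  let ?M1 = "four_block_mat (U * V) ?O V ?O" and ?M2 = "four_block_mat ?O ?O V (V * U)"
  let ?P = "four_block_mat ?I U ?O ?I" and ?Q = "four_block_mat ?I (- U) ?O ?I"
  have UV: "U * V \<in> carrier_mat n n" and VU: "V * U \<in> carrier_mat n n" using U V by auto
  have one: "four_block_mat ?I ?O ?O ?I = 1\<^sub>m (n + n)" by (rule four_block_one_mat)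
  have uminus: "U + - U = ?O" "- U + U = ?O" "- ?O = ?O" using U by (auto intro!: eq_matI)
  note mult = mult_four_block_mat[of _ n n _ n _ n _ _ n _ n]
  have "?P * ?Q = 1\<^sub>m (n + n)"
    unfolding one[symmetric] using U by (subst mult) (auto simp: uminus)
  moreover have "?Q * ?P = 1\<^sub>m (n + n)"
    unfolding one[symmetric] using U by (subst mult) (auto simp: uminus)
  moreover have "?M1 = ?P * ?M2 * ?Q"
  proof -
    have "?P * ?M2 = four_block_mat (U * V) (U * (V * U)) V (V * U)"
      using U V VU by (subst mult) auto
    moreover have "U * V * - U + U * (V * U) = ?O" "V * - U + V * U = ?O"
      using U V by (auto simp: assoc_mult_mat[of _ n n _ n _ n] intro!: eq_matI)
    ultimately show ?thesis
      using U V VU UV by (simp, subst mult) auto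
  qed
  ultimately have "similar_mat_wit ?M1 ?M2 ?P ?Q"
    using U V by (intro similar_mat_witI[of _ _ "n + n"]) auto
  then have "char_poly ?M1 = char_poly ?M2" by (intro char_poly_similar) (auto simp: similar_mat_def)
  moreover have "char_poly ?M1 = char_poly (U * V) * char_poly ?O"
    using char_poly_factorized[OF UV] char_poly_factorized[of ?O n]
    by (intro char_poly_0_block'[OF refl _ _ UV V]) auto
  moreover have "char_poly ?M2 = char_poly ?O * char_poly (V * U)"
    using char_poly_factorized[OF VU] char_poly_factorized[of ?O n]
    by (intro char_poly_0_block'[OF refl _ _ _ V VU]) auto
  ultimately show ?thesis using char_poly_nonzero[of ?O n] by (simp add: mult.commute)
qed

text \<open>With \<open>p = x @ y\<close> and \<open>p' = y @ x\<close> the products are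
  \<open>U * V\<close> and \<open>V * U\<close>. Leading eigenvalues and their multiplicities thus
  depend only on the cyclic class of the word.\<close>

lemma (in mat_family) char_poly_cyclic_perm:
  assumes p: "p \<in> words m" and p': "cyclic_perm p p'"
  shows "p' \<in> words m" "char_poly (complexify (W p')) = char_poly (complexify (W p))"
proof -
  obtain r where r: "p' = rotate r p" using p' unfolding cyclic_perm_def by blast
  define x y where "x = take (r mod length p) p" and "y = drop (r mod length p) p"
  have xy: "p = x @ y" "p' = y @ x" unfolding x_def y_def r rotate_drop_take by auto
  then have wd: "x \<in> words m" "y \<in> words m" using p by auto
  show "p' \<in> words m" using xy wd by simp
  show "char_poly (complexify (W p')) = char_poly (complexify (W p))"
    unfolding xy W_append[OF wd] W_append[OF wd(2,1)]
    using W_carrier[OF wd(1)] W_carrier[OF wd(2)]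
    by (simp add: of_real_hom.mat_hom_mult[of _ n n _ n]
        char_poly_mult_commute[of "complexify (W y)" n "complexify (W x)"])
qed

lemma leading_eigenvalues_cong:
  assumes "X \<in> carrier_mat n n" "Y \<in> carrier_mat n n"
    and "char_poly (complexify X) = char_poly (complexify Y)"
  shows "leading_eigenvalues X = leading_eigenvalues Y"
    and "unique_simple_leading X \<longleftrightarrow> unique_simple_leading Y"
proof -
  have "eigenvalue (complexify X) z \<longleftrightarrow> eigenvalue (complexify Y) z" for z
    using assms eigenvalue_root_char_poly[of _ n z] by simp
  then show *: "leading_eigenvalues X = leading_eigenvalues Y"
    unfolding leading_eigenvalues_def by simp
  then show "unique_simple_leading X \<longleftrightarrow> unique_simple_leading Y"
    unfolding unique_simple_leading_def using assms(3) by simp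
qed

lemma pow_bounded_of_no_jordan_block:
  assumes X: "X \<in> carrier_mat n n"
    and ev: "\<And>z. eigenvalue (complexify X) z \<Longrightarrow> cmod z \<le> 1"
    and no: "\<And>z. cmod z = 1 \<Longrightarrow> \<not> nontrivial_jordan_block X z"
  shows "\<exists>K. \<forall>k. mnorm (X ^\<^sub>m k) \<le> K"
proof -
  have cX: "complexify X \<in> carrier_mat n n" using X by simp
  obtain as where "char_poly (complexify X) = (\<Prod>a\<leftarrow>as. [:- a, 1:])"
    using char_poly_factorized[OF cX] by blast
  from jordan_nf_exists[OF cX this] obtain n_as where jnf: "jordan_nf (complexify X) n_as" ..
  have "cmod a \<le> 1" if "(k, a) \<in> set n_as" "k > 0" for k a
  proof -
    have "order a (char_poly (complexify X)) \<noteq> 0"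
      using jordan_nf_block_size_order_bound[OF jnf that(1)] that(2) by simp
    then show ?thesis using ev eigenvalue_root_char_poly[OF cX, of a] by (simp add: order_root)
  qed
  moreover have "k \<le> 1" if "(k, a) \<in> set n_as" "cmod a = 1" for k a
    using no[OF that(2)] jnf that(1) unfolding nontrivial_jordan_block_def
    by (metis Suc_1 not_less_eq_eq One_nat_def)
  ultimately obtain c1 c2 where "\<And>k. norm_bound (complexify X ^\<^sub>m k) (c1 + c2 * of_nat k ^ (1 - 1))"
    using jordan_nf_matrix_poly_bound[OF cX _ _ jnf, of 1] by blast
  then have "norm_bound (complexify (X ^\<^sub>m k)) (c1 + c2)" for k
    using complexify_pow[OF X, of k] by simp
  then have "mnorm (X ^\<^sub>m k) \<le> real n * real n * (c1 + c2)" for k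
    using X by (intro norm_bound_mnorm) auto
  then show ?thesis by blast
qed

text \<open>The entry next to the diagonal in the k-th power of the block is
  \<open>k * z ^ (k - 1)\<close>, of modulus \<open>k\<close> on the unit circle; the change of
  basis costs a constant factor.\<close>

lemma pow_growth_of_jordan_block:
  assumes X: "X \<in> carrier_mat n n" and nt: "nontrivial_jordan_block X z" and z: "cmod z = 1"
  shows "\<exists>c>0. \<forall>k. c * real k \<le> mnorm (X ^\<^sub>m k)"
proof -
  have cX: "complexify X \<in> carrier_mat n n" using X by simp
  obtain n_as s where jnf: "jordan_nf (complexify X) n_as" and s: "s \<ge> 2" "(s, z) \<in> set n_as"
    using nt unfolding nontrivial_jordan_block_def by blast
  let ?J = "jordan_matrix n_as"
  obtain P Q where wit: "similar_mat_wit (complexify X) ?J P Q"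
    using jnf unfolding jordan_nf_def similar_mat_def by blast
  have PQ: "?J \<in> carrier_mat n n" "P \<in> carrier_mat n n" "Q \<in> carrier_mat n n"
    using similar_mat_witD2[OF cX wit] by auto
  have growth: "real k \<le> mnorm (?J ^\<^sub>m k)" for k
  proof -
    have "(jordan_block s z ^\<^sub>m k) $$ (0, 1) = of_nat k * z ^ (k - 1)"
      unfolding jordan_block_pow using s(1) by simp
    then have "real k = norm ((jordan_block s z ^\<^sub>m k) $$ (0, 1))"
      using z by (simp add: norm_mult norm_power)
    also have "\<dots> \<le> mnorm (jordan_block s z ^\<^sub>m k)"
      using s(1) by (intro norm_entry_le_mnorm) auto
    also have "\<dots> \<le> mnorm (?J ^\<^sub>m k)"
      unfolding jordan_matrix_pow using s(2) by (intro mnorm_diag_block_mat) force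
    finally show ?thesis .
  qed
  define c where "c = 1 / (mnorm Q * mnorm P + 1)"
  have "c * real k \<le> mnorm (X ^\<^sub>m k)" for k
  proof -
    have cXk: "complexify X ^\<^sub>m k \<in> carrier_mat n n" using cX by simp
    have "?J ^\<^sub>m k = Q * complexify X ^\<^sub>m k * P"
      by (rule similar_mat_wit_pow_id[OF similar_mat_wit_sym[OF wit]])
    then have "mnorm (?J ^\<^sub>m k) \<le> mnorm (Q * complexify X ^\<^sub>m k) * mnorm P"
      using mnorm_mult[of "Q * complexify X ^\<^sub>m k" n n P n] PQ cXk by simp
    also have "\<dots> \<le> (mnorm Q * mnorm (complexify X ^\<^sub>m k)) * mnorm P"
      using PQ cXk by (intro mult_right_mono mnorm_mult) auto
    also have "mnorm (complexify X ^\<^sub>m k) = mnorm (X ^\<^sub>m k)"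
      using complexify_pow[OF X, of k] mnorm_complexify by metis
    also have "(mnorm Q * mnorm (X ^\<^sub>m k)) * mnorm P \<le> (mnorm Q * mnorm P + 1) * mnorm (X ^\<^sub>m k)"
      by (simp add: algebra_simps)
    finally have "real k \<le> (mnorm Q * mnorm P + 1) * mnorm (X ^\<^sub>m k)" using growth[of k] by simp
    then show ?thesis unfolding c_def by (simp add: pos_divide_le_eq add_nonneg_pos mult.commute)
  qed
  moreover have "c > 0" unfolding c_def by (simp add: add_nonneg_pos)
  ultimately show ?thesis by blast
qed

text \<open>On the unit circle every eigenvalue of a matrix with spectral radius at most one is
  leading, hence simple; a point outside the spectrum has order zero.\<close>

lemma order_leading_le_1:
  assumes X: "X \<in> carrier_mat n n" and lead: "unique_simple_leading X"
    and ev: "\<And>z. eigenvalue (complexify X) z \<Longrightarrow> cmod z \<le> 1" and z: "cmod z = 1"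
  shows "order z (char_poly (complexify X)) \<le> (if z \<in> leading_eigenvalues X then 1 else 0)"
proof (cases "eigenvalue (complexify X) z")
  case True
  then have "z \<in> leading_eigenvalues X" unfolding leading_eigenvalues_def using ev z by auto
  then show ?thesis using lead unfolding unique_simple_leading_def by auto
next
  case False
  have "complexify X \<in> carrier_mat n n" using X by simp
  then have "order z (char_poly (complexify X)) = 0"
    using False eigenvalue_root_char_poly order_root by blast
  then show ?thesis by simp
qed

text \<open>Two sets of the form \<open>{x, cnj x}\<close> with a common point are equal, so
  resonance at one eigenvalue already identifies all leading eigenvalues.\<close>

lemma unique_simple_leading_eq:
  assumes "unique_simple_leading X" "unique_simple_leading Y"
    and "z \<in> leading_eigenvalues X" "z \<in> leading_eigenvalues Y"
  shows "leading_eigenvalues X = leading_eigenvalues Y"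
proof -
  obtain x y where "leading_eigenvalues X = {x, cnj x}" "leading_eigenvalues Y = {y, cnj y}"
    using assms(1,2) unfolding unique_simple_leading_def by blast
  then show ?thesis using assms(3,4) by auto
qed

text \<open>A Jordan block of size two needs algebraic multiplicity two, and multiplicities add over
  the diagonal blocks. As each contributes at most one on the unit circle, such an eigenvalue must
  be leading for both.\<close>

lemma pow_bounded_of_no_resonance:
  assumes X: "X \<in> carrier_mat d d" and X1: "X1 \<in> carrier_mat d1 d1" and X2: "X2 \<in> carrier_mat d2 d2"
    and cp: "char_poly (complexify X) = char_poly (complexify X1) * char_poly (complexify X2)"
    and K1: "\<And>k. mnorm (X1 ^\<^sub>m k) \<le> K" and K2: "\<And>k. mnorm (X2 ^\<^sub>m k) \<le> K"
    and lead: "unique_simple_leading X1" "unique_simple_leading X2"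
    and no: "\<not> (leading_eigenvalues X1 = leading_eigenvalues X2 \<and>
        (\<exists>z\<in>leading_eigenvalues X1. nontrivial_jordan_block X z))"
  shows "\<exists>K. \<forall>k. mnorm (X ^\<^sub>m k) \<le> K"
proof (rule pow_bounded_of_no_jordan_block[OF X])
  have cX: "complexify X \<in> carrier_mat d d" "complexify X1 \<in> carrier_mat d1 d1"
    "complexify X2 \<in> carrier_mat d2 d2" using X X1 X2 by auto
  have ev1: "eigenvalue (complexify X1) z \<Longrightarrow> cmod z \<le> 1" for z
    using eigenvalue_le_of_pow_bound[of X1 d1 z 1 K] X1 K1 by simp
  have ev2: "eigenvalue (complexify X2) z \<Longrightarrow> cmod z \<le> 1" for z
    using eigenvalue_le_of_pow_bound[of X2 d2 z 1 K] X2 K2 by simp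
  show "cmod z \<le> 1" if "eigenvalue (complexify X) z" for z
    using that ev1 ev2 cp eigenvalue_root_char_poly[OF cX(1)] eigenvalue_root_char_poly[OF cX(2)]
      eigenvalue_root_char_poly[OF cX(3)] by auto
  show "\<not> nontrivial_jordan_block X z" if z: "cmod z = 1" for z
  proof
    assume nt: "nontrivial_jordan_block X z"
    then obtain n_as s where "jordan_nf (complexify X) n_as" "s \<ge> 2" "(s, z) \<in> set n_as"
      unfolding nontrivial_jordan_block_def by blast
    then have "2 \<le> order z (char_poly (complexify X))"
      using jordan_nf_block_size_order_bound by fastforce
    also have "\<dots> = order z (char_poly (complexify X1)) + order z (char_poly (complexify X2))"
      unfolding cp using char_poly_nonzero[OF cX(2)] char_poly_nonzero[OF cX(3)] by (intro order_mult) simp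
    finally have "z \<in> leading_eigenvalues X1 \<and> z \<in> leading_eigenvalues X2"
      using order_leading_le_1[OF X1 lead(1) ev1 z] order_leading_le_1[OF X2 lead(2) ev2 z]
      by (auto split: if_splits)
    then show False using no nt unique_simple_leading_eq[OF lead] by blast
  qed
qed

section \<open>The off-diagonal block\<close>

locale triangular_family = F1: mat_family d1 m A1 + F2: mat_family d2 m A2
  for d1 d2 m A1 A2 +
  fixes C :: "nat \<Rightarrow> real mat"
  assumes C_carrier: "\<And>j. j < m \<Longrightarrow> C j \<in> carrier_mat d1 d2"
begin

text \<open>The upper right corner of a triangular product after one more factor on the left. A
  recursion on the word keeps block matrices out of the estimates.\<close>

primrec offdiag :: "nat list \<Rightarrow> real mat" where
  "offdiag [] = 0\<^sub>m d1 d2"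
| "offdiag (j # w) = A1 j * offdiag w + C j * F2.W w"

lemma offdiag_carrier [simp]: "w \<in> words m \<Longrightarrow> offdiag w \<in> carrier_mat d1 d2"
proof (induction w)
  case (Cons j w)
  then have "j < m" "w \<in> words m" by auto
  then show ?case
    using F1.carrier[of j] C_carrier[of j] F2.W_carrier[of w] Cons.IH by (simp add: mult_carrier_mat)
qed simp

lemma offdiag_append:
  assumes "u \<in> words m" and v: "v \<in> words m"
  shows "offdiag (u @ v) = F1.W u * offdiag v + offdiag u * F2.W v"
  using assms(1)
proof (induction u)
  case Nil
  have "0\<^sub>m d1 d2 * F2.W v = 0\<^sub>m d1 d2" using F2.W_carrier[OF v] by simp
  then show ?case using offdiag_carrier[OF v] by simp
next
  case (Cons j u)
  then have j: "j < m" and u: "u \<in> words m" by auto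
  note cs = F1.carrier[OF j] C_carrier[OF j] F1.W_carrier[OF u] F2.W_carrier[OF u] F2.W_carrier[OF v]
    offdiag_carrier[OF u] offdiag_carrier[OF v]
  let ?a = "A1 j * (F1.W u * offdiag v)" and ?b = "A1 j * (offdiag u * F2.W v)" and ?c = "C j * (F2.W u * F2.W v)"
  have car: "?a \<in> carrier_mat d1 d2" "?b \<in> carrier_mat d1 d2" "?c \<in> carrier_mat d1 d2"
    using cs by (auto intro!: mult_carrier_mat)
  have "offdiag ((j # u) @ v) = A1 j * (F1.W u * offdiag v + offdiag u * F2.W v) + C j * (F2.W u * F2.W v)"
    using Cons.IH[OF u] F2.W_append[OF u v] by simp
  also have "\<dots> = (?a + ?b) + ?c"
    using cs by (subst mult_add_distrib_mat[of _ d1 d1 _ d2]) (auto intro!: mult_carrier_mat)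
  also have "\<dots> = ?a + (?b + ?c)" using car by (rule assoc_add_mat)
  also have "?a = F1.W (j # u) * offdiag v"
    using assoc_mult_mat[OF cs(1,3,7)] by simp
  also have "?b + ?c = offdiag (j # u) * F2.W v"
    using assoc_mult_mat[OF cs(1,6,5)] assoc_mult_mat[OF cs(2,4,5)]
      add_mult_distrib_mat[OF mult_carrier_mat[OF cs(1,6)] mult_carrier_mat[OF cs(2,4)] cs(5)] by simp
  finally show ?case .
qed

lemma mnorm_offdiag_append:
  assumes "u \<in> words m" "v \<in> words m"
  shows "mnorm (offdiag (u @ v)) \<le> mnorm (F1.W u) * mnorm (offdiag v) + mnorm (offdiag u) * mnorm (F2.W v)"
proof -
  note cs = F1.W_carrier[OF assms(1)] F2.W_carrier[OF assms(2)] offdiag_carrier[OF assms(1)] offdiag_carrier[OF assms(2)]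
  have "mnorm (offdiag (u @ v)) \<le> mnorm (F1.W u * offdiag v) + mnorm (offdiag u * F2.W v)"
    unfolding offdiag_append[OF assms] using cs by (intro mnorm_add) (auto intro!: mult_carrier_mat)
  also have "\<dots> \<le> mnorm (F1.W u) * mnorm (offdiag v) + mnorm (offdiag u) * mnorm (F2.W v)"
    using cs by (intro add_mono mnorm_mult) auto
  finally show ?thesis .
qed

abbreviation "T j \<equiv> four_block_mat (A1 j) (C j) (0\<^sub>m d2 d1) (A2 j)"

lemma word_prod_T:
  "w \<in> words m \<Longrightarrow> word_prod (d1 + d2) T w = four_block_mat (F1.W w) (offdiag w) (0\<^sub>m d2 d1) (F2.W w)"
proof (induction w)
  case Nil
  show ?case by (simp add: word_prod_def)
next
  case (Cons j w)
  then have j: "j < m" and w: "w \<in> words m" by auto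
  note cs = F1.carrier[OF j] C_carrier[OF j] F2.carrier[OF j] F1.W_carrier[OF w] F2.W_carrier[OF w] offdiag_carrier[OF w]
  have "word_prod (d1 + d2) T (j # w) = T j * four_block_mat (F1.W w) (offdiag w) (0\<^sub>m d2 d1) (F2.W w)"
    using Cons.IH[OF w] by (simp add: word_prod_def)
  also have "\<dots> = four_block_mat (F1.W (j # w)) (offdiag (j # w)) (0\<^sub>m d2 d1) (F2.W (j # w))"
    using cs by (subst mult_four_block_mat[OF cs(1,2) zero_carrier_mat cs(3,4,6) zero_carrier_mat cs(5)])
      (auto simp: mult_carrier_mat)
  finally show ?case .
qed

lemma mnorm_word_prod_T:
  assumes "w \<in> words m"
  shows "mnorm (word_prod (d1 + d2) T w) = mnorm (F1.W w) + mnorm (offdiag w) + mnorm (F2.W w)"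
  unfolding word_prod_T[OF assms] using assms by (subst mnorm_four_block[of _ d1 d1 _ d2 _ d2]) auto

text \<open>The prefix \<open>v\<close> is carried along as an accumulator: estimating
  \<open>F1.W v\<close> and \<open>F1.W c\<close> separately would cost one constant per chunk,
  while \<open>F1.W (v @ c)\<close> is again a single product with the same bound.\<close>

lemma mnorm_mult_offdiag_append:
  assumes v: "v \<in> words m" and c: "c \<in> words m" and w: "w \<in> words m"
  shows "mnorm (F1.W v * offdiag (c @ w)) \<le>
    mnorm (F1.W (v @ c) * offdiag w) + mnorm (F1.W v) * mnorm (offdiag c) * mnorm (F2.W w)"
proof -
  note cs = F1.W_carrier[OF v] F1.W_carrier[OF c] offdiag_carrier[OF w] offdiag_carrier[OF c] F2.W_carrier[OF w]
  have "F1.W v * offdiag (c @ w) = F1.W v * (F1.W c * offdiag w) + F1.W v * (offdiag c * F2.W w)"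
    unfolding offdiag_append[OF c w] using cs
    by (intro mult_add_distrib_mat[of _ d1 d1 _ d2]) (auto intro!: mult_carrier_mat)
  also have "F1.W v * (F1.W c * offdiag w) = F1.W (v @ c) * offdiag w"
    unfolding F1.W_append[OF v c] using assoc_mult_mat[OF cs(1,2,3)] by simp
  finally have "mnorm (F1.W v * offdiag (c @ w)) \<le> mnorm (F1.W (v @ c) * offdiag w) + mnorm (F1.W v * (offdiag c * F2.W w))"
    using mnorm_add[of "F1.W (v @ c) * offdiag w" d1 d2 "F1.W v * (offdiag c * F2.W w)"] cs
      mult_carrier_mat[OF F1.W_carrier[of "v @ c"] cs(3)] v c by simp
  also have "mnorm (F1.W v * (offdiag c * F2.W w)) \<le> mnorm (F1.W v) * (mnorm (offdiag c) * mnorm (F2.W w))"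
    using cs by (intro order_trans[OF mnorm_mult[of _ d1 d1 _ d2]] mult_left_mono mnorm_mult) auto
  finally show ?thesis by (simp add: mult.assoc)
qed

lemma mnorm_one_mult_offdiag: "w \<in> words m \<Longrightarrow> mnorm (F1.W [] * offdiag w) = mnorm (offdiag w)"
  using left_mult_one_mat[OF offdiag_carrier] by simp

lemma mnorm_offdiag_letter:
  "j < m \<Longrightarrow> mnorm (offdiag [j]) \<le> (\<Sum>j<m. mnorm (C j))"
proof -
  assume j: "j < m"
  have "offdiag [j] = C j" using F1.carrier[OF j] C_carrier[OF j] by simp
  moreover have "mnorm (C j) \<le> (\<Sum>j<m. mnorm (C j))" using j by (intro member_le_sum) auto
  ultimately show ?thesis by simp
qed

text \<open>Unrolled, the block is a sum with one term per letter: an \<open>A1\<close> product, one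
  \<open>C j\<close> and an \<open>A2\<close> product. This gives linear growth for
  \<open>r = 1\<close> and decay for \<open>r < 1\<close>.\<close>

lemma offdiag_growth:
  assumes r: "r > 0" and K1: "\<And>w. w \<in> words m \<Longrightarrow> mnorm (F1.W w) \<le> K * r ^ length w"
    and K2: "\<And>w. w \<in> words m \<Longrightarrow> mnorm (F2.W w) \<le> K * r ^ length w"
  shows "\<exists>D\<ge>0. \<forall>w\<in>words m. mnorm (offdiag w) \<le> D * real (length w) * r ^ length w"
proof -
  define S where "S = (\<Sum>j<m. mnorm (C j))"
  have S: "S \<ge> 0" unfolding S_def by (intro sum_nonneg) auto
  have K: "K \<ge> 0" using order_trans[OF mnorm_nonneg K1[of "[]"]] by simp
  \<comment> \<open>The letter that carries \<open>C j\<close> counts in the length without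
    supplying a factor \<open>r\<close>, whence the division.\<close>
  define D where "D = K * K * S / r"
  have "mnorm (F1.W v * offdiag w) \<le> D * real (length w) * r ^ (length v + length w)"
    if "v \<in> words m" "w \<in> words m" for v w
    using that
  proof (induction w arbitrary: v)
    case Nil
    have "F1.W v * 0\<^sub>m d1 d2 = 0\<^sub>m d1 d2" using F1.W_carrier[OF Nil(1)] by simp
    then show ?case by simp
  next
    case (Cons j w)
    then have j: "j < m" "[j] \<in> words m" and w: "w \<in> words m" by auto
    have "mnorm (F1.W v * offdiag ([j] @ w)) \<le>
      mnorm (F1.W (v @ [j]) * offdiag w) + mnorm (F1.W v) * mnorm (offdiag [j]) * mnorm (F2.W w)"
      using Cons.prems(1) j(2) w by (rule mnorm_mult_offdiag_append)
    also have "\<dots> \<le> D * real (length w) * r ^ (length (v @ [j]) + length w) + (K * r ^ length v) * S * (K * r ^ length w)"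
      using Cons.IH[of "v @ [j]"] Cons.prems j w K1[of v] K2[OF w] mnorm_offdiag_letter[OF j(1)] S K r
      by (intro add_mono mult_mono) (auto simp: S_def)
    also have "\<dots> = D * real (length (j # w)) * r ^ (length v + length (j # w))"
      unfolding D_def using r by (simp add: power_add field_simps)
    finally show ?case by simp
  qed
  from this[of "[]"] have "\<forall>w\<in>words m. mnorm (offdiag w) \<le> D * real (length w) * r ^ length w"
    using mnorm_one_mult_offdiag by simp
  moreover have "D \<ge> 0" unfolding D_def using K S r by simp
  ultimately show ?thesis by blast
qed

section \<open>Off-diagonal blocks over bounded diagonal families\<close>

context
  fixes K :: real
  assumes K: "K \<ge> 1" and K1: "\<And>w. w \<in> words m \<Longrightarrow> mnorm (F1.W w) \<le> K"
    and K2: "\<And>w. w \<in> words m \<Longrightarrow> mnorm (F2.W w) \<le> K"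
begin

lemma offdiag_linear: "\<exists>D\<ge>0. \<forall>w\<in>words m. mnorm (offdiag w) \<le> D * real (length w)"
  using offdiag_growth[of 1 K] K1 K2 by simp

text \<open>Counts chunks instead of letters: each chunk contributes once, between two diagonal
  products bounded by \<open>K\<close>.\<close>

lemma offdiag_concat_le:
  assumes G: "G \<ge> 0" and cs: "\<And>c. c \<in> set cs \<Longrightarrow> c \<in> words m \<and> mnorm (offdiag c) \<le> G"
  shows "mnorm (offdiag (concat cs)) \<le> K * K * G * real (length cs)"
proof -
  have "mnorm (F1.W v * offdiag (concat cs)) \<le> K * K * G * real (length cs)" if "v \<in> words m" for v
    using cs that
  proof (induction cs arbitrary: v)
    case Nil
    have "F1.W v * 0\<^sub>m d1 d2 = 0\<^sub>m d1 d2" using F1.W_carrier[OF Nil(2)] by simp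
    then show ?case by simp
  next
    case (Cons c cs)
    have wd: "c \<in> words m" "concat cs \<in> words m" using Cons.prems(1) by (auto intro!: words_concat)
    have "mnorm (F1.W v * offdiag (c @ concat cs)) \<le>
      mnorm (F1.W (v @ c) * offdiag (concat cs)) + mnorm (F1.W v) * mnorm (offdiag c) * mnorm (F2.W (concat cs))"
      using Cons.prems(2) wd by (rule mnorm_mult_offdiag_append)
    also have "\<dots> \<le> K * K * G * real (length cs) + K * G * K"
      using Cons.IH[of "v @ c"] Cons.prems wd K1[of v] K2[OF wd(2)] K G
      by (intro add_mono mult_mono) auto
    finally show ?case by (simp add: algebra_simps)
  qed
  from this[of "[]"] show ?thesis
    using mnorm_one_mult_offdiag[OF words_concat, of cs] cs by (auto simp: subset_iff)
qed

text \<open>The quantity \<open>y\<close> controls the products of the second family. A chunk contracting the second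
  family halves \<open>y\<close>, which pays for its contribution to the off-diagonal block; any other chunk
  halves what was accumulated so far.\<close>

lemma offdiag_chunks:
  assumes G: "G \<ge> 0" and cs: "\<And>c. c \<in> set cs \<Longrightarrow> c \<in> words m \<and> mnorm (offdiag c) \<le> G \<and>
      (mnorm (F1.W c) \<le> 1 / (2 * K) \<or> mnorm (F2.W c) \<le> 1 / (2 * K))"
  shows "\<exists>y. 0 \<le> y \<and> y \<le> 1 \<and> (\<forall>v\<in>words m. mnorm (F2.W (v @ concat cs)) \<le> K * y) \<and>
    (\<forall>v\<in>words m. mnorm (F1.W v * offdiag (concat cs)) \<le> 4 * (K * K * G) - 2 * (K * K * G) * y)"
  using cs
proof (induction cs)
  case Nil
  have "F1.W v * 0\<^sub>m d1 d2 = 0\<^sub>m d1 d2" if "v \<in> words m" for v using F1.W_carrier[OF that] by simp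
  \<comment> \<open>Nothing is contracted yet, so \<open>y = 1\<close>; the claimed bound is then
    \<open>2 * (K * K * G)\<close>, ample for a zero block.\<close>
  then show ?case using K2 K G by (intro exI[of _ 1]) auto
next
  case (Cons c cs)
  define \<Gamma> where "\<Gamma> = K * K * G"
  have Gam: "\<Gamma> \<ge> 0" unfolding \<Gamma>_def using K G by simp
  have wd: "c \<in> words m" "concat cs \<in> words m" using Cons.prems by (auto intro!: words_concat)
  obtain y where y: "0 \<le> y" "y \<le> 1" and y2: "\<And>v. v \<in> words m \<Longrightarrow> mnorm (F2.W (v @ concat cs)) \<le> K * y"
    and y1: "\<And>v. v \<in> words m \<Longrightarrow> mnorm (F1.W v * offdiag (concat cs)) \<le> 4 * \<Gamma> - 2 * \<Gamma> * y"
    using Cons.IH[OF Cons.prems] unfolding \<Gamma>_def by auto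
  have step: "mnorm (F1.W v * offdiag (concat (c # cs))) \<le> mnorm (F1.W (v @ c) * offdiag (concat cs)) + \<Gamma> * y"
    if v: "v \<in> words m" for v
  proof -
    have "mnorm (F1.W v * offdiag (c @ concat cs)) \<le>
      mnorm (F1.W (v @ c) * offdiag (concat cs)) + mnorm (F1.W v) * mnorm (offdiag c) * mnorm (F2.W (concat cs))"
      using v wd by (rule mnorm_mult_offdiag_append)
    also have "mnorm (F1.W v) * mnorm (offdiag c) * mnorm (F2.W (concat cs)) \<le> K * G * (K * y)"
      using K1[OF v] Cons.prems[of c] y2[of "[]"] K G by (intro mult_mono) auto
    finally show ?thesis unfolding \<Gamma>_def by (simp add: algebra_simps)
  qed
  show ?case unfolding \<Gamma>_def[symmetric]
  proof (cases "mnorm (F1.W c) \<le> 1 / (2 * K)")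
    case True
    \<comment> \<open>Halving the old bound gives \<open>2 * \<Gamma> - \<Gamma> * y\<close>. The
      new contribution \<open>\<Gamma> * y\<close> lifts it to \<open>2 * \<Gamma>\<close>, which
      stays within the invariant because \<open>y \<le> 1\<close>.\<close>
    have "mnorm (F1.W v * offdiag (concat (c # cs))) \<le> 4 * \<Gamma> - 2 * \<Gamma> * y" if v: "v \<in> words m" for v
    proof -
      note car = F1.W_carrier[OF v] F1.W_carrier[OF wd(1)] offdiag_carrier[OF wd(2)]
      have "mnorm (F1.W (v @ c) * offdiag (concat cs)) \<le> mnorm (F1.W (v @ c)) * mnorm (offdiag (concat cs))"
        using v wd by (intro mnorm_mult[of _ d1 d1 _ d2]) auto
      also have "\<dots> \<le> (K * (1 / (2 * K))) * (4 * \<Gamma> - 2 * \<Gamma> * y)"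
      proof (rule mult_mono)
        have "mnorm (F1.W (v @ c)) \<le> mnorm (F1.W v) * mnorm (F1.W c)"
          using v wd(1) by (rule F1.mnorm_W_append)
        also have "\<dots> \<le> K * (1 / (2 * K))" using K1[OF v] True K by (intro mult_mono) auto
        finally show "mnorm (F1.W (v @ c)) \<le> K * (1 / (2 * K))" .
        show "mnorm (offdiag (concat cs)) \<le> 4 * \<Gamma> - 2 * \<Gamma> * y"
          using y1[of "[]"] mnorm_one_mult_offdiag[OF wd(2)] by simp
      qed (use K in auto)
      also have "\<dots> = 2 * \<Gamma> - \<Gamma> * y" using K by (simp add: algebra_simps)
      finally have "mnorm (F1.W v * offdiag (concat (c # cs))) \<le> 2 * \<Gamma>" using step[OF v] by simp
      also have "\<dots> \<le> 4 * \<Gamma> - 2 * \<Gamma> * y" using mult_left_mono[OF y(2) Gam] by simp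
      finally show ?thesis .
    qed
    moreover have "mnorm (F2.W (v @ concat (c # cs))) \<le> K * y" if v: "v \<in> words m" for v
      using y2[of "v @ c"] v wd by simp
    ultimately show "\<exists>y. 0 \<le> y \<and> y \<le> 1 \<and> (\<forall>v\<in>words m. mnorm (F2.W (v @ concat (c # cs))) \<le> K * y) \<and>
      (\<forall>v\<in>words m. mnorm (F1.W v * offdiag (concat (c # cs))) \<le> 4 * \<Gamma> - 2 * \<Gamma> * y)"
      using y by blast
  next
    case False
    then have c2: "mnorm (F2.W c) \<le> 1 / (2 * K)" using Cons.prems[of c] by simp
    have "mnorm (F2.W (v @ concat (c # cs))) \<le> K * (y / 2)" if v: "v \<in> words m" for v
    proof -
      have vc: "mnorm (F2.W (v @ c)) \<le> K * (1 / (2 * K))"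
        using K2[OF v] c2 K v wd by (intro order_trans[OF F2.mnorm_W_append] mult_mono) auto
      have "mnorm (F2.W ((v @ c) @ concat cs)) \<le> mnorm (F2.W (v @ c)) * mnorm (F2.W (concat cs))"
        using v wd by (intro F2.mnorm_W_append) auto
      also have "\<dots> \<le> (K * (1 / (2 * K))) * (K * y)"
        using vc y2[of "[]"] K by (intro mult_mono) auto
      also have "\<dots> = K * (y / 2)" using K by simp
      finally show ?thesis by simp
    qed
    \<comment> \<open>Replacing \<open>y\<close> by \<open>y / 2\<close> raises the allowed bound by
      exactly \<open>\<Gamma> * y\<close>, the contribution of this chunk.\<close>
    moreover have "mnorm (F1.W v * offdiag (concat (c # cs))) \<le> 4 * \<Gamma> - 2 * \<Gamma> * (y / 2)" if v: "v \<in> words m" for v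
      using step[OF v] y1[of "v @ c"] v wd by simp
    ultimately show "\<exists>y. 0 \<le> y \<and> y \<le> 1 \<and> (\<forall>v\<in>words m. mnorm (F2.W (v @ concat (c # cs))) \<le> K * y) \<and>
      (\<forall>v\<in>words m. mnorm (F1.W v * offdiag (concat (c # cs))) \<le> 4 * \<Gamma> - 2 * \<Gamma> * y)"
      using y by (intro exI[of _ "y / 2"]) auto
  qed
qed

lemma offdiag_bounded_of_chunks:
  assumes G: "G \<ge> 0" and Ch: "\<And>c. c \<in> Ch \<Longrightarrow> c \<in> words m \<and> mnorm (offdiag c) \<le> G \<and>
      (mnorm (F1.W c) \<le> 1 / (2 * K) \<or> mnorm (F2.W c) \<le> 1 / (2 * K))"
    and split: "\<And>w. w \<in> words m \<Longrightarrow> \<exists>cs t. w = concat cs @ t \<and> set cs \<subseteq> Ch \<and> mnorm (offdiag t) \<le> G"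
  shows "\<exists>M. \<forall>w\<in>words m. mnorm (offdiag w) \<le> M"
proof -
  have "mnorm (offdiag w) \<le> K * G + 4 * (K * K * G) * K" if w: "w \<in> words m" for w
  proof -
    obtain cs t where ct: "w = concat cs @ t" "set cs \<subseteq> Ch" "mnorm (offdiag t) \<le> G" using split[OF w] by blast
    then have wd: "concat cs \<in> words m" "t \<in> words m" using w by auto
    obtain y where y: "0 \<le> y"
      "\<And>v. v \<in> words m \<Longrightarrow> mnorm (F1.W v * offdiag (concat cs)) \<le> 4 * (K * K * G) - 2 * (K * K * G) * y"
      using offdiag_chunks[OF G, of cs] Ch ct(2) by blast
    have "mnorm (offdiag (concat cs)) \<le> 4 * (K * K * G) - 2 * (K * K * G) * y"
      using y(2)[OF words_Nil] mnorm_one_mult_offdiag[OF wd(1)] by simp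
    moreover have "0 \<le> 2 * (K * K * G) * y" using y(1) K G by simp
    ultimately have oc: "mnorm (offdiag (concat cs)) \<le> 4 * (K * K * G)" by linarith
    have "mnorm (offdiag w) \<le> mnorm (F1.W (concat cs)) * mnorm (offdiag t) + mnorm (offdiag (concat cs)) * mnorm (F2.W t)"
      unfolding ct(1) using wd by (rule mnorm_offdiag_append)
    also have "\<dots> \<le> K * G + 4 * (K * K * G) * K"
      using K1[OF wd(1)] K2[OF wd(2)] oc ct(3) K G by (intro add_mono mult_mono) auto
    finally show ?thesis .
  qed
  then show ?thesis by blast
qed

lemma offdiag_bounded_of_fixed_length:
  assumes L: "L > 0" and small: "\<And>c. c \<in> words m \<Longrightarrow> length c = L \<Longrightarrow>
      mnorm (F1.W c) \<le> 1 / (2 * K) \<or> mnorm (F2.W c) \<le> 1 / (2 * K)"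
  shows "\<exists>M. \<forall>w\<in>words m. mnorm (offdiag w) \<le> M"
proof -
  obtain D where D: "D \<ge> 0" "\<And>w. w \<in> words m \<Longrightarrow> mnorm (offdiag w) \<le> D * real (length w)"
    using offdiag_linear by blast
  have le: "mnorm (offdiag w) \<le> D * real L" if "w \<in> words m" "length w \<le> L" for w
    using D(2)[OF that(1)] mult_left_mono[of "real (length w)" "real L" D] that(2) D(1) by simp
  show ?thesis
  proof (rule offdiag_bounded_of_chunks[where G = "D * real L" and Ch = "{c \<in> words m. length c = L}"])
    fix w assume w: "w \<in> words m"
    define q where "q = length w div L"
    have "length (take (q * L) w) = q * L" unfolding q_def by (simp add: min_absorb2)
    then obtain cs where cs: "concat cs = take (q * L) w" "\<forall>c\<in>set cs. length c = L"
      using split_into_blocks by blast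
    have wcs: "w = concat cs @ drop (q * L) w" unfolding cs by simp
    then have wd: "concat cs \<in> words m" "drop (q * L) w \<in> words m" using w words_append by metis+
    have "set cs \<subseteq> words m" using wd(1) unfolding words_def by auto
    moreover have "length (drop (q * L) w) \<le> L"
      unfolding q_def using L by (simp add: minus_div_mult_eq_mod less_imp_le)
    ultimately show "\<exists>cs t. w = concat cs @ t \<and> set cs \<subseteq> {c \<in> words m. length c = L} \<and> mnorm (offdiag t) \<le> D * real L"
      using wcs cs(2) le[OF wd(2)] by (intro exI[of _ cs] exI[of _ "drop (q * L) w"]) auto
  qed (use D(1) le small in auto)
qed

text \<open>Greedy reading: a piece is closed at the letter that destroys its period. It is
  aperiodic and hence counts towards contraction, yet periodic up to its last letter, so a bound on
  periodic words controls its off-diagonal block whatever its length.\<close>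

lemma split_at_breaks:
  "w \<in> words m \<Longrightarrow> \<exists>us t. w = concat us @ t \<and> periodic p t \<and>
     (\<forall>u\<in>set us. u \<in> words m \<and> \<not> periodic p u \<and> periodic p (butlast u))"
proof (induction w rule: rev_induct)
  case Nil
  then show ?case by (intro exI[of _ "[]"]) auto
next
  case (snoc j w)
  then obtain us t where us: "w = concat us @ t" "periodic p t"
    "\<forall>u\<in>set us. u \<in> words m \<and> \<not> periodic p u \<and> periodic p (butlast u)" by auto
  show ?case
  proof (cases "periodic p (t @ [j])")
    case True
    then show ?thesis using us by (intro exI[of _ us] exI[of _ "t @ [j]"]) auto
  next
    case False
    then show ?thesis using us snoc.prems by (intro exI[of _ "us @ [t @ [j]]"] exI[of _ "[]"]) auto
  qed
qed

text \<open>A chunk consists of \<open>J\<close> aperiodic pieces, enough for the product of the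
  first family to fall below \<open>1 / (2 * K)\<close>. The chunk estimate is content with one
  contracted family, which is why dominance is asked of \<open>A1\<close> alone.\<close>

lemma offdiag_bounded_of_periodic:
  assumes dom: "dominates d1 m A1 q p" and p: "p \<in> words m"
    and per: "\<And>k. mnorm (offdiag (word_pow p k)) \<le> G0"
  shows "\<exists>M. \<forall>w\<in>words m. mnorm (offdiag w) \<le> M"
proof -
  obtain D where D: "D \<ge> 0" "\<And>w. w \<in> words m \<Longrightarrow> mnorm (offdiag w) \<le> D * real (length w)"
    using offdiag_linear by blast
  \<comment> \<open>Covers both kinds of parts of a periodic word: factors of \<open>p\<close>,
    through the linear bound, and powers of \<open>p\<close>, through \<open>G0\<close>.\<close>
  define G1 where "G1 = D * real (length p) + D + \<bar>G0\<bar>"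
  have G1: "G1 \<ge> 0" unfolding G1_def using D by simp
  have K2': "K * K \<ge> 1" using K by (metis mult_mono' mult_1 zero_le_one)
  have pb: "mnorm (offdiag b) \<le> K * K * G1 * 3" if b: "periodic p b" for b
  proof -
    obtain s j t where st: "b = s @ word_pow p j @ t" "sublist s p" "sublist t p"
      using periodic_decomposition[OF b] by blast
    have sub: "x \<in> words m \<and> mnorm (offdiag x) \<le> G1" if x: "sublist x p" for x
    proof -
      have "x \<in> words m" using words_sublist[OF x p] .
      moreover have "D * real (length x) \<le> D * real (length p)"
        using D(1) sublist_length_le[OF x] by (intro mult_left_mono) auto
      ultimately show ?thesis using D(2)[of x] D(1) unfolding G1_def by simp
    qed
    have "word_pow p j \<in> words m \<and> mnorm (offdiag (word_pow p j)) \<le> G1"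
      using words_word_pow[OF p] per[of j] D(1) unfolding G1_def
      by (simp add: add_increasing)
    then have "mnorm (offdiag (concat [s, word_pow p j, t])) \<le> K * K * G1 * real (length [s, word_pow p j, t])"
      using sub[OF st(2)] sub[OF st(3)] by (intro offdiag_concat_le[OF G1]) auto
    then show ?thesis unfolding st(1) by simp
  qed
  define G2 where "G2 = K * K * (K * K * G1 * 3 + D) * 2"
  have G2: "G2 \<ge> 0" unfolding G2_def using K2' G1 D by simp
  have piece: "mnorm (offdiag u) \<le> G2" if u: "u \<in> words m" "\<not> periodic p u" "periodic p (butlast u)" for u
  proof -
    have "u \<noteq> []" using u(2) by auto
    then have un: "u = concat [butlast u, [last u]]" by simp
    then have wd: "butlast u \<in> words m" "[last u] \<in> words m" using u(1) words_append[of "butlast u" "[last u]" m] by auto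
    have "mnorm (offdiag [last u]) \<le> D" using D(2)[OF wd(2)] by simp
    then have "mnorm (offdiag (concat [butlast u, [last u]])) \<le> K * K * (K * K * G1 * 3 + D) * real (length [butlast u, [last u]])"
      using wd pb[OF u(3)] D(1) K2' G1 by (intro offdiag_concat_le) (auto intro: add_increasing add_increasing2)
    then show ?thesis using un unfolding G2_def by simp
  qed
  have "1 / (2 * K) > 0" using K by simp
  then obtain J where J: "J > 0" "\<And>us. length us = J \<Longrightarrow> (\<forall>u\<in>set us. u \<in> words m \<and> \<not> periodic p u) \<Longrightarrow>
      mnorm (F1.W (concat us)) < 1 / (2 * K)"
    using F1.nonperiodic_products_small[OF K1 dom] by blast
  define Pc where "Pc = {u \<in> words m. \<not> periodic p u \<and> periodic p (butlast u)}"
  define Ch where "Ch = concat ` {us. length us = J \<and> set us \<subseteq> Pc}"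
  define G3 where "G3 = K * K * G2 * real J"
  have G3: "G3 \<ge> 0" unfolding G3_def using K2' G2 by simp
  \<comment> \<open>Bounds the tail, at most \<open>J\<close> leftover pieces followed by a periodic
    word, and also dominates \<open>G3\<close>, the bound for full chunks.\<close>
  define G where "G = K * G1 * K * K * 3 + G3 * K"
  have G3G: "G3 \<le> G" and G: "G \<ge> 0"
    unfolding G_def using mult_left_mono[OF K G3] K G1 G3 by (auto intro: add_increasing)
  have pieces: "mnorm (offdiag (concat us)) \<le> G3" if "length us \<le> J" "set us \<subseteq> Pc" for us
  proof -
    have "mnorm (offdiag (concat us)) \<le> K * K * G2 * real (length us)"
      using that(2) piece unfolding Pc_def by (intro offdiag_concat_le[OF G2]) auto
    also have "\<dots> \<le> G3" unfolding G3_def using that(1) K2' G2 by (intro mult_left_mono) auto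
    finally show ?thesis .
  qed
  show ?thesis
  proof (rule offdiag_bounded_of_chunks[OF G, of Ch])
    fix c assume "c \<in> Ch"
    then obtain us where us: "c = concat us" "length us = J" "set us \<subseteq> Pc" unfolding Ch_def by blast
    have "c \<in> words m" using us unfolding Pc_def by (auto intro!: words_concat)
    moreover have "mnorm (F1.W c) < 1 / (2 * K)" unfolding us(1) using us(2,3) unfolding Pc_def by (intro J(2)) auto
    moreover have "mnorm (offdiag c) \<le> G" using pieces[of us] us G3G by auto
    ultimately show "c \<in> words m \<and> mnorm (offdiag c) \<le> G \<and> (mnorm (F1.W c) \<le> 1 / (2 * K) \<or> mnorm (F2.W c) \<le> 1 / (2 * K))"
      by simp
  next
    fix w assume w: "w \<in> words m"
    obtain us t where us: "w = concat us @ t" "periodic p t" "set us \<subseteq> Pc"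
      using split_at_breaks[OF w, of p] unfolding Pc_def by blast
    define q where "q = length us div J"
    have "length (take (q * J) us) = q * J" unfolding q_def by (simp add: min_absorb2)
    then obtain vss where vss: "concat vss = take (q * J) us" "\<forall>vs\<in>set vss. length vs = J"
      using split_into_blocks by blast
    define rest where "rest = drop (q * J) us"
    have usr: "us = concat vss @ rest" unfolding vss rest_def by simp
    then have sub: "set rest \<subseteq> Pc" "\<And>vs. vs \<in> set vss \<Longrightarrow> set vs \<subseteq> Pc" using us(3) by auto
    have "length rest \<le> J" unfolding rest_def q_def using J(1) by (simp add: minus_div_mult_eq_mod less_imp_le)
    then have orest: "mnorm (offdiag (concat rest)) \<le> G3" using pieces sub(1) by simp
    have weq: "w = concat (map concat vss) @ (concat rest @ t)"
      unfolding us(1) usr by (simp, induction vss) auto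
    then have wd: "concat rest \<in> words m" "t \<in> words m" using w by auto
    have "mnorm (offdiag (concat rest @ t)) \<le> mnorm (F1.W (concat rest)) * mnorm (offdiag t) + mnorm (offdiag (concat rest)) * mnorm (F2.W t)"
      using wd by (rule mnorm_offdiag_append)
    also have "\<dots> \<le> K * (K * K * G1 * 3) + G3 * K"
      using K1[OF wd(1)] K2[OF wd(2)] orest pb[OF us(2)] K G3 by (intro add_mono mult_mono) auto
    also have "\<dots> = G" unfolding G_def by simp
    finally show "\<exists>cs t. w = concat cs @ t \<and> set cs \<subseteq> Ch \<and> mnorm (offdiag t) \<le> G"
      using weq vss(2) sub(2) unfolding Ch_def by (intro exI[of _ "map concat vss"] exI[of _ "concat rest @ t"]) auto
  qed
qed

end

end

section \<open>Trajectories\<close>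

lemma rev_word_pow: "rev (word_pow p k) = word_pow (rev p) k"
  by (induction k) (simp_all add: word_pow_Suc, metis word_pow_Suc word_pow_Suc')

lemma map_periodic_upt:
  assumes "q \<noteq> []"
  shows "map (\<lambda>i. q ! (i mod length q)) [0..<k * length q] = word_pow q k"
proof (induction k)
  case (Suc k)
  have "map (\<lambda>i. q ! (i mod length q)) [k * length q..<k * length q + length q] = q"
    by (rule nth_equalityI) auto
  moreover have "[0..<Suc k * length q] = [0..<k * length q] @ [k * length q..<k * length q + length q]"
    using upt_add_eq_append[of 0 "k * length q" "length q"] by (simp add: add.commute)
  ultimately show ?case using Suc by (simp add: word_pow_Suc')
qed simp

context mat_family
begin

text \<open>The first letter of a word is the leftmost factor and thus the last matrix applied, so
  the switching law is read backwards.\<close>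

lemma trajectory_eq:
  assumes s: "range s \<subseteq> {..<m}" and x: "x \<in> carrier_vec n"
  shows "trajectory B s x k = W (rev (map s [0..<k])) *\<^sub>v x"
proof (induction k)
  case 0
  then show ?case using x by simp
next
  case (Suc k)
  have sk: "s k < m" and w: "rev (map s [0..<k]) \<in> words m" using s unfolding words_def by auto
  show ?case
    using Suc assoc_mult_mat_vec[OF carrier[OF sk] W_carrier[OF w] x] by simp
qed

lemma all_trajectories_bounded_of_products:
  assumes M: "\<And>w. w \<in> words m \<Longrightarrow> mnorm (W w) \<le> M"
  shows "all_trajectories_bounded n m B"
  unfolding all_trajectories_bounded_def
proof (intro allI impI)
  fix s :: "nat \<Rightarrow> nat" and x :: "real vec"
  assume s: "range s \<subseteq> {..<m}" and x: "x \<in> carrier_vec n"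
  have "sqrt (trajectory B s x k \<bullet> trajectory B s x k) \<le> M * vnorm x" for k
  proof -
    have w: "rev (map s [0..<k]) \<in> words m" using s unfolding words_def by auto
    have "sqrt (trajectory B s x k \<bullet> trajectory B s x k) \<le> vnorm (trajectory B s x k)"
      by (rule sqrt_scalar_prod_self_le_vnorm)
    also have "\<dots> \<le> mnorm (W (rev (map s [0..<k]))) * vnorm x"
      unfolding trajectory_eq[OF s x] using vnorm_mult_mat_vec[OF W_carrier[OF w] x] .
    also have "\<dots> \<le> M * vnorm x" using M[OF w] by (intro mult_right_mono) auto
    finally show ?thesis .
  qed
  then show "\<exists>K. \<forall>k. sqrt (trajectory B s x k \<bullet> trajectory B s x k) \<le> K" by blast
qed

text \<open>One periodic switching law realises all powers of a product, and its trajectories from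
  the unit vectors bound the columns. Instability therefore follows from growth of powers, without
  assembling a law from different long words.\<close>

lemma pow_bounded_of_all_trajectories_bounded:
  assumes bd: "all_trajectories_bounded n m B" and p: "p \<in> words m" "p \<noteq> []"
  shows "\<exists>M. \<forall>k. mnorm (W p ^\<^sub>m k) \<le> M"
proof -
  define s where "s i = rev p ! (i mod length p)" for i
  have s: "range s \<subseteq> {..<m}"
  proof
    fix y assume "y \<in> range s"
    then obtain i where "y = rev p ! (i mod length (rev p))" unfolding s_def by auto
    then have "y \<in> set (rev p)" using p(2) by (metis nth_mem mod_less_divisor length_greater_0_conv rev_is_Nil_conv)
    then show "y \<in> {..<m}" using p(1) unfolding words_def by auto
  qed
  have tr: "trajectory B s x (k * length p) = W p ^\<^sub>m k *\<^sub>v x" if x: "x \<in> carrier_vec n" for x k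
  proof -
    have "map s [0..<k * length p] = word_pow (rev p) k"
      using map_periodic_upt[of "rev p" k] p(2) unfolding s_def by simp
    then have "rev (map s [0..<k * length p]) = word_pow p k"
      by (simp add: rev_word_pow)
    then show ?thesis using trajectory_eq[OF s x] W_word_pow[OF p(1)] by simp
  qed
  have "\<exists>K. \<forall>k. sqrt (trajectory B s (unit_vec n j) k \<bullet> trajectory B s (unit_vec n j) k) \<le> K" for j
    using bd s unfolding all_trajectories_bounded_def by simp
  then obtain K where K: "\<And>j k. sqrt (trajectory B s (unit_vec n j) k \<bullet> trajectory B s (unit_vec n j) k) \<le> K j" by metis
  have K0: "K j \<ge> 0" for j
  proof -
    have "0 \<le> sqrt (unit_vec n j \<bullet> unit_vec n j :: real)"
      by (auto simp: scalar_prod_def intro!: sum_nonneg)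
    from order_trans[OF this, of "K j"] K[of j 0] show ?thesis by simp
  qed
  have "mnorm (W p ^\<^sub>m k) \<le> real n * real n * (\<Sum>j<n. K j)" for k
  proof -
    have dW: "dim_row (W p) = n" "dim_col (W p) = n" using W_carrier[OF p(1)] by auto
    have car: "W p ^\<^sub>m k \<in> carrier_mat n n" using W_carrier[OF p(1)] by simp
    have "mnorm (W p ^\<^sub>m k) \<le> real (dim_row (W p ^\<^sub>m k)) * real (dim_col (W p ^\<^sub>m k)) * (\<Sum>j<n. K j)"
    proof (rule mnorm_le)
      fix i j assume "i < dim_row (W p ^\<^sub>m k)" "j < dim_col (W p ^\<^sub>m k)"
      then have ij: "i < n" "j < n" using carrier_matD[OF car] by auto
      let ?y = "trajectory B s (unit_vec n j) (k * length p)"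
      have y: "?y = W p ^\<^sub>m k *\<^sub>v unit_vec n j" by (rule tr) simp
      have "?y $ i = (W p ^\<^sub>m k) $$ (i,j)"
        unfolding y using dW ij by (simp add: scalar_prod_right_unit[of j n "row (W p ^\<^sub>m k) i"])
      moreover have "dim_vec ?y = n" unfolding y using dW by simp
      ultimately have "norm ((W p ^\<^sub>m k) $$ (i,j)) \<le> sqrt (?y \<bullet> ?y)"
        using abs_entry_le_sqrt_scalar_prod[of i ?y] ij by simp
      also have "\<dots> \<le> K j" by (rule K)
      also have "\<dots> \<le> (\<Sum>j<n. K j)" using K0 ij by (intro member_le_sum) auto
      finally show "norm ((W p ^\<^sub>m k) $$ (i,j)) \<le> (\<Sum>j<n. K j)" .
    qed
    then show ?thesis using carrier_matD[OF car] by simp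
  qed
  then show ?thesis by blast
qed

end

section \<open>Families with two irreducible diagonal blocks\<close>

locale two_block_family = triangular_family +
  fixes A :: "nat \<Rightarrow> real mat" and P Q :: "real mat" and N :: "real mat \<Rightarrow> real" and p1 p2 :: "nat list"
  assumes A_carrier: "\<And>j. j < m \<Longrightarrow> A j \<in> carrier_mat (d1 + d2) (d1 + d2)"
    and similar: "\<And>j. j < m \<Longrightarrow> similar_mat_wit (A j) (T j) P Q"
    and m: "m > 0" and d1: "d1 > 0" and d2: "d2 > 0" and N: "\<And>n. mat_norm n N"
    and jsr: "joint_spectral_radius N (d1 + d2) m A = 1"
    and irred1: "\<not> reducible_family d1 m A1" and irred2: "\<not> reducible_family d2 m A2"
    and dom1: "dominant_word N d1 m A1 p1" and lead1: "unique_simple_leading (word_prod d1 A1 p1)"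
    and dom2: "dominant_word N d2 m A2 p2" and lead2: "unique_simple_leading (word_prod d2 A2 p2)"
begin

sublocale F: mat_family "d1 + d2" m A
  by unfold_locales (rule A_carrier)

abbreviation "\<rho>1 \<equiv> joint_spectral_radius N d1 m A1"
abbreviation "\<rho>2 \<equiv> joint_spectral_radius N d2 m A2"
abbreviation "X1 \<equiv> word_prod d1 A1 p1"
abbreviation "X2 \<equiv> word_prod d2 A2 p1"

text \<open>Condition 2) with \<open>p1\<close> as the common word. Comparing whole sets covers real
  and complex conjugate leading eigenvalues alike.\<close>

definition resonant :: bool where
  "resonant \<longleftrightarrow> leading_eigenvalues X1 = leading_eigenvalues X2 \<and>
     (\<exists>z\<in>leading_eigenvalues X1. nontrivial_jordan_block (F.W p1) z)"

abbreviation "WT w \<equiv> word_prod (d1 + d2) T w"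

section \<open>Transfer between the family and its triangular form\<close>

lemma PQ: "P \<in> carrier_mat (d1 + d2) (d1 + d2)" "Q \<in> carrier_mat (d1 + d2) (d1 + d2)"
    "P * Q = 1\<^sub>m (d1 + d2)" "Q * P = 1\<^sub>m (d1 + d2)"
  using similar_mat_witD2[OF A_carrier[OF m] similar[OF m]] by auto

lemma T_carrier: "j < m \<Longrightarrow> T j \<in> carrier_mat (d1 + d2) (d1 + d2)"
  using F1.carrier F2.carrier by auto

lemma WT_carrier: "w \<in> words m \<Longrightarrow> WT w \<in> carrier_mat (d1 + d2) (d1 + d2)"
  using F1.W_carrier[of w] F2.W_carrier[of w] by (auto simp: word_prod_T)

lemma W_similar: "w \<in> words m \<Longrightarrow> F.W w = P * WT w * Q"
proof (induction w)
  case Nil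
  then show ?case using PQ by (simp add: word_prod_def)
next
  case (Cons j w)
  then have j: "j < m" and w: "w \<in> words m" by auto
  let ?d = "d1 + d2"
  note cs = PQ(1,2) T_carrier[OF j] WT_carrier[OF w]
  have "A j = P * T j * Q" using similar_mat_witD2(3)[OF A_carrier[OF j] similar[OF j]] .
  then have "F.W (j # w) = (P * T j * Q) * (P * (WT w * Q))"
    using Cons.IH[OF w] cs by (simp add: assoc_mult_mat[of _ ?d ?d _ ?d _ ?d])
  also have "\<dots> = P * T j * (Q * P) * (WT w * Q)"
    using cs by (simp add: assoc_mult_mat[of _ ?d ?d _ ?d _ ?d] mult_carrier_mat[of _ ?d ?d _ ?d])
  also have "\<dots> = P * (T j * WT w) * Q"
    unfolding PQ(4) using cs
    by (simp add: assoc_mult_mat[of _ ?d ?d _ ?d _ ?d] mult_carrier_mat[of _ ?d ?d _ ?d])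
  finally show ?case by (simp add: word_prod_def)
qed

lemma W_similar_wit: "w \<in> words m \<Longrightarrow> similar_mat_wit (F.W w) (WT w) P Q"
  using PQ W_similar F.W_carrier WT_carrier by (intro similar_mat_witI) auto

lemma mnorm_W_le: "w \<in> words m \<Longrightarrow> mnorm (F.W w) \<le> mnorm P * mnorm Q * mnorm (WT w)"
proof -
  assume w: "w \<in> words m"
  note cs = PQ(1,2) WT_carrier[OF w]
  have "mnorm (P * WT w * Q) \<le> mnorm P * mnorm (WT w) * mnorm Q"
    using mnorm_mult[OF mult_carrier_mat[OF cs(1,3)] cs(2)] mult_right_mono[OF mnorm_mult[OF cs(1,3)], of "mnorm Q"]
    by simp
  then show ?thesis unfolding W_similar[OF w] by (simp add: mult_ac)
qed

lemma mnorm_WT_le: "w \<in> words m \<Longrightarrow> mnorm (WT w) \<le> mnorm P * mnorm Q * mnorm (F.W w)"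
proof -
  assume w: "w \<in> words m"
  note cs = PQ(1,2) F.W_carrier[OF w]
  have "WT w = Q * F.W w * P"
    using similar_mat_witD2(3)[OF WT_carrier[OF w] similar_mat_wit_sym[OF W_similar_wit[OF w]]] .
  moreover have "mnorm (Q * F.W w * P) \<le> mnorm Q * mnorm (F.W w) * mnorm P"
    using mnorm_mult[OF mult_carrier_mat[OF cs(2,3)] cs(1)] mult_right_mono[OF mnorm_mult[OF cs(2,3)], of "mnorm P"]
    by simp
  ultimately show ?thesis by (simp add: mult_ac)
qed

lemma mnorm_block_le:
  assumes "w \<in> words m"
  shows "mnorm (F1.W w) \<le> mnorm P * mnorm Q * mnorm (F.W w)"
    and "mnorm (F2.W w) \<le> mnorm P * mnorm Q * mnorm (F.W w)"
    and "mnorm (offdiag w) \<le> mnorm P * mnorm Q * mnorm (F.W w)"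
  using mnorm_WT_le[OF assms] mnorm_word_prod_T[OF assms] mnorm_nonneg[of "F1.W w"]
    mnorm_nonneg[of "F2.W w"] mnorm_nonneg[of "offdiag w"] by linarith+

lemma char_poly_W:
  assumes w: "w \<in> words m"
  shows "char_poly (complexify (F.W w)) = char_poly (complexify (F1.W w)) * char_poly (complexify (F2.W w))"
proof -
  let ?d = "d1 + d2"
  note cs = PQ(1,2) WT_carrier[OF w]
  have zero: "complexify (0\<^sub>m d2 d1) = 0\<^sub>m d2 d1" by (intro eq_matI) auto
  have "complexify (F.W w) = complexify P * complexify (WT w) * complexify Q"
    unfolding W_similar[OF w] using cs
    by (simp add: of_real_hom.mat_hom_mult[of _ ?d ?d _ ?d] mult_carrier_mat[of _ ?d ?d _ ?d])
  moreover have "complexify (P * Q) = complexify P * complexify Q"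
    by (rule of_real_hom.mat_hom_mult[OF cs(1,2)])
  moreover have "complexify (Q * P) = complexify Q * complexify P"
    by (rule of_real_hom.mat_hom_mult[OF cs(2,1)])
  ultimately have "similar_mat_wit (complexify (F.W w)) (complexify (WT w)) (complexify P) (complexify Q)"
    using cs F.W_carrier[OF w] unfolding PQ(3,4)
    by (intro similar_mat_witI[of _ _ ?d]) (auto simp: of_real_hom.mat_hom_one)
  then have "char_poly (complexify (F.W w)) = char_poly (complexify (WT w))"
    by (intro char_poly_similar) (auto simp: similar_mat_def)
  also have "complexify (WT w) = four_block_mat (complexify (F1.W w)) (complexify (offdiag w)) (0\<^sub>m d2 d1) (complexify (F2.W w))"
    unfolding word_prod_T[OF w] using F1.W_carrier[OF w] F2.W_carrier[OF w] offdiag_carrier[OF w]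
    by (subst map_four_block_mat[of _ d1 d1 _ d2 _ d2]) (auto simp: zero)
  also have "char_poly \<dots> = char_poly (complexify (F1.W w)) * char_poly (complexify (F2.W w))"
    using F1.W_carrier[OF w] F2.W_carrier[OF w] offdiag_carrier[OF w]
    by (intro char_poly_upper_block) auto
  finally show ?thesis .
qed

lemma growth:
  assumes "r > 1"
  shows "\<exists>D>0. \<forall>w\<in>words m. mnorm (F1.W w) \<le> D * r ^ length w"
    and "\<exists>D>0. \<forall>w\<in>words m. mnorm (F2.W w) \<le> D * r ^ length w"
proof -
  obtain D where D: "D > 0" "\<And>w. w \<in> words m \<Longrightarrow> mnorm (F.W w) \<le> D * r ^ length w"
    using F.jsr_upper[OF N m, of r] jsr assms by auto
  define E where "E = (mnorm P * mnorm Q + 1) * D"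
  have le: "mnorm P * mnorm Q * mnorm (F.W w) \<le> E * r ^ length w" if "w \<in> words m" for w
  proof -
    have "mnorm P * mnorm Q * mnorm (F.W w) \<le> (mnorm P * mnorm Q + 1) * mnorm (F.W w)"
      by (intro mult_right_mono) auto
    also have "\<dots> \<le> (mnorm P * mnorm Q + 1) * (D * r ^ length w)"
      using D(2)[OF that] by (intro mult_left_mono) auto
    finally show ?thesis unfolding E_def by (simp add: mult.assoc)
  qed
  moreover have "E > 0" unfolding E_def using D(1) by (simp add: add_nonneg_pos)
  ultimately show "\<exists>D>0. \<forall>w\<in>words m. mnorm (F1.W w) \<le> D * r ^ length w"
    "\<exists>D>0. \<forall>w\<in>words m. mnorm (F2.W w) \<le> D * r ^ length w"
    using mnorm_block_le by (meson order_trans)+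
qed

lemma jsr_blocks_le: "\<rho>1 \<le> 1" "\<rho>2 \<le> 1"
proof -
  have "\<rho>1 \<le> r" "\<rho>2 \<le> r" if r: "r > 1" for r
    using growth[OF r] F1.jsr_le[OF N m, of r] F2.jsr_le[OF N m, of r] r by auto
  then show "\<rho>1 \<le> 1" "\<rho>2 \<le> 1" by (meson dense_ge)+
qed

text \<open>Which block has joint spectral radius one is not known at this point. Boundedness of
  irreducible products needs only growth slower than \<open>r ^ k\<close> for every
  \<open>r > 1\<close>, and both blocks inherit this from the whole family.\<close>

lemma blocks_bounded:
  "\<exists>K\<ge>1. (\<forall>w\<in>words m. mnorm (F1.W w) \<le> K) \<and> (\<forall>w\<in>words m. mnorm (F2.W w) \<le> K)"
proof -
  obtain K1 where K1: "K1 \<ge> 1" "\<forall>w\<in>words m. mnorm (F1.W w) \<le> K1"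
    using F1.irreducible_products_bounded[OF irred1 growth(1)] by blast
  obtain K2 where K2: "K2 \<ge> 1" "\<forall>w\<in>words m. mnorm (F2.W w) \<le> K2"
    using F2.irreducible_products_bounded[OF irred2 growth(2)] by blast
  show ?thesis using K1 K2 by (intro exI[of _ "max K1 K2"]) (auto intro: max.coboundedI1 max.coboundedI2)
qed

definition K where
  "K = (SOME K. K \<ge> 1 \<and> (\<forall>w\<in>words m. mnorm (F1.W w) \<le> K) \<and> (\<forall>w\<in>words m. mnorm (F2.W w) \<le> K))"

lemma K: "K \<ge> 1" "\<And>w. w \<in> words m \<Longrightarrow> mnorm (F1.W w) \<le> K" "\<And>w. w \<in> words m \<Longrightarrow> mnorm (F2.W w) \<le> K"
  using someI_ex[OF blocks_bounded] unfolding K_def by auto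

lemma p1: "p1 \<in> words m" "p1 \<noteq> []" "simple_word p1"
  and p2: "p2 \<in> words m" "p2 \<noteq> []"
  using dom1 dom2 unfolding dominant_word_def simple_word_def by auto

lemma exists_small_power:
  assumes "0 < r" "r < 1" "\<epsilon> > 0"
  shows "\<exists>L>0. (a + b * real L) * r ^ L \<le> (\<epsilon>::real)"
proof -
  have "(\<lambda>L. a * r ^ L + b * (of_nat L * r ^ L)) \<longlonglongrightarrow> a * 0 + b * 0"
    using assms by (intro tendsto_intros LIMSEQ_power_zero powser_times_n_limit_0) auto
  then have "\<forall>\<^sub>F L in sequentially. a * r ^ L + b * (of_nat L * r ^ L) < \<epsilon>"
    using assms(3) order_tendstoD(2) by fastforce
  then have "\<forall>\<^sub>F L in sequentially. L > 0 \<and> a * r ^ L + b * (of_nat L * r ^ L) < \<epsilon>"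
    using eventually_gt_at_top[of "0::nat"] by eventually_elim auto
  then obtain L where "L > 0" "a * r ^ L + b * (of_nat L * r ^ L) < \<epsilon>"
    using eventually_happens[of _ sequentially] by auto
  then show ?thesis by (intro exI[of _ L]) (auto simp: algebra_simps)
qed

text \<open>If both diagonal families decayed at a geometric rate \<open>r < 1\<close>, the
  off-diagonal block would decay like \<open>k * r ^ k\<close>, and the joint spectral radius of the
  whole family would be below one.\<close>

lemma jsr_block_eq_1: "\<rho>1 = 1 \<or> \<rho>2 = 1"
proof (rule ccontr)
  assume "\<not> ?thesis"
  then have lt: "max \<rho>1 \<rho>2 < 1" using jsr_blocks_le by auto
  define r where "r = (1 + max \<rho>1 \<rho>2) / 2"
  have "max \<rho>1 \<rho>2 \<ge> 0" using F1.jsr_nonneg[OF N m] by (simp add: max.coboundedI1)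
  then have r: "0 < r" "r < 1" "max \<rho>1 \<rho>2 < r" using lt unfolding r_def by auto
  obtain D1 where D1: "D1 > 0" "\<And>w. w \<in> words m \<Longrightarrow> mnorm (F1.W w) \<le> D1 * r ^ length w"
    using F1.jsr_upper[OF N m, of r] r by auto
  obtain D2 where D2: "D2 > 0" "\<And>w. w \<in> words m \<Longrightarrow> mnorm (F2.W w) \<le> D2 * r ^ length w"
    using F2.jsr_upper[OF N m, of r] r by auto
  define D where "D = max D1 D2"
  have D: "mnorm (F1.W w) \<le> D * r ^ length w" "mnorm (F2.W w) \<le> D * r ^ length w" if "w \<in> words m" for w
    using D1(2)[OF that] D2(2)[OF that] r unfolding D_def
    by (auto intro: order_trans mult_right_mono)
  obtain E where E: "E \<ge> 0" "\<And>w. w \<in> words m \<Longrightarrow> mnorm (offdiag w) \<le> E * real (length w) * r ^ length w"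
    using offdiag_growth[OF r(1), of D] D by blast
  let ?\<kappa> = "mnorm P * mnorm Q"
  obtain L where L: "L > 0" "(?\<kappa> * (2 * D) + ?\<kappa> * E * real L) * r ^ L \<le> 1/2"
    using exists_small_power[OF r(1,2), of "1/2" "?\<kappa> * (2 * D)" "?\<kappa> * E"] by auto
  have bound: "mnorm (F.W w) \<le> (?\<kappa> * (2 * D) + ?\<kappa> * E * real (length w)) * r ^ length w" if w: "w \<in> words m" for w
  proof -
    have "mnorm (WT w) \<le> (2 * D + E * real (length w)) * r ^ length w"
      unfolding mnorm_word_prod_T[OF w] using D[OF w] E(2)[OF w] by (simp add: algebra_simps)
    then have "?\<kappa> * mnorm (WT w) \<le> ?\<kappa> * ((2 * D + E * real (length w)) * r ^ length w)"
      by (intro mult_left_mono) auto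
    then show ?thesis using mnorm_W_le[OF w] by (simp add: algebra_simps)
  qed
  obtain D' where D': "D' > 0" "\<And>w. w \<in> words m \<Longrightarrow> mnorm (F.W w) \<le> D'"
  proof -
    have "Bseq (\<lambda>L. (?\<kappa> * (2 * D)) * r ^ L + (?\<kappa> * E) * (of_nat L * r ^ L))"
      using r by (intro convergent_imp_Bseq convergentI[of _ "(?\<kappa> * (2 * D)) * 0 + (?\<kappa> * E) * 0"]
          tendsto_intros LIMSEQ_power_zero powser_times_n_limit_0) auto
    then obtain M where M: "M > 0" "\<And>L. \<bar>(?\<kappa> * (2 * D)) * r ^ L + (?\<kappa> * E) * (of_nat L * r ^ L)\<bar> \<le> M"
      unfolding Bseq_def real_norm_def by blast
    have "mnorm (F.W w) \<le> M" if "w \<in> words m" for w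
      using bound[OF that] M(2)[of "length w"] by (simp add: algebra_simps)
    then show ?thesis using that M(1) by blast
  qed
  have "mnorm (F.W w) \<le> 1/2" if "w \<in> words m" "length w = L" for w
    using bound[OF that(1)] L(2) that(2) by simp
  then show False using F.jsr_less_1[OF N m D'(2) L(1)] jsr by simp
qed

section \<open>Bounded off-diagonal blocks outside the resonant case\<close>

lemma stable_of_jsr1_less:
  assumes "\<rho>1 < 1"
  shows "\<exists>M. \<forall>w\<in>words m. mnorm (offdiag w) \<le> M"
proof -
  define r where "r = (1 + \<rho>1) / 2"
  have r: "0 < r" "r < 1" "\<rho>1 < r" using assms F1.jsr_nonneg[OF N m] unfolding r_def by auto
  obtain D where D: "\<And>w. w \<in> words m \<Longrightarrow> mnorm (F1.W w) \<le> D * r ^ length w"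
    using F1.jsr_upper[OF N m r(3)] by blast
  have "1 / (2 * K) > 0" using K(1) by simp
  then obtain L where L: "L > 0" "(D + 0 * real L) * r ^ L \<le> 1 / (2 * K)"
    using exists_small_power[OF r(1,2)] by blast
  show ?thesis
    using offdiag_bounded_of_fixed_length[OF K L(1)] D L(2) by fastforce
qed

lemma stable_of_jsr2_less:
  assumes "\<rho>2 < 1"
  shows "\<exists>M. \<forall>w\<in>words m. mnorm (offdiag w) \<le> M"
proof -
  define r where "r = (1 + \<rho>2) / 2"
  have r: "0 < r" "r < 1" "\<rho>2 < r" using assms F2.jsr_nonneg[OF N m] unfolding r_def by auto
  obtain D where D: "\<And>w. w \<in> words m \<Longrightarrow> mnorm (F2.W w) \<le> D * r ^ length w"
    using F2.jsr_upper[OF N m r(3)] by blast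
  have "1 / (2 * K) > 0" using K(1) by simp
  then obtain L where L: "L > 0" "(D + 0 * real L) * r ^ L \<le> 1 / (2 * K)"
    using exists_small_power[OF r(1,2)] by blast
  show ?thesis
    using offdiag_bounded_of_fixed_length[OF K L(1)] D L(2) by fastforce
qed

text \<open>If the dominant words differ, a long word whose product in the first family is not small
  contains a long piece of a power of \<open>p1\<close>, and this piece makes its product in the second family
  small.\<close>

lemma stable_of_not_cyclic_perm:
  assumes r1: "\<rho>1 = 1" and r2: "\<rho>2 = 1" and nc: "\<not> cyclic_perm p1 p2"
  shows "\<exists>M. \<forall>w\<in>words m. mnorm (offdiag w) \<le> M"
proof -
  have "cyclic_perm p1 p1" unfolding cyclic_perm_def by (metis rotate0 id_apply)
  then obtain q1 where q1: "dominates d1 m A1 q1 p1"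
    using F1.dominant_word_dominates[OF r1 dom1] by blast
  obtain q2 where q2: "q2 < 1" "\<forall>w\<in>words m. w \<noteq> [] \<and> \<not> (\<exists>p' k. cyclic_perm p2 p' \<and> w = word_pow p' k) \<longrightarrow>
     (\<forall>z. eigenvalue (complexify (F2.W w)) z \<longrightarrow> cmod z < q2)"
    using F2.dominant_word_eigenvalue[OF r2 dom2] by blast
  \<comment> \<open>If \<open>p1\<close> is the \<open>k\<close>-th power of a cyclic permutation
    \<open>p'\<close> of \<open>p2\<close>, simplicity of \<open>p1\<close> excludes a shorter
    \<open>p'\<close>; so \<open>k = 1\<close>, and \<open>p1\<close> would be a cyclic permutation
    of \<open>p2\<close>.\<close>
  have np: "\<not> (\<exists>p' k. cyclic_perm p2 p' \<and> p1 = word_pow p' k)"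
  proof
    assume "\<exists>p' k. cyclic_perm p2 p' \<and> p1 = word_pow p' k"
    then obtain p' k where pk: "cyclic_perm p2 p'" "p1 = word_pow p' k" by blast
    then have "\<not> length p' < length p1" using p1(3) unfolding simple_word_def by blast
    moreover have "length p1 = k * length p'" using pk(2) length_word_pow[of p' k] by simp
    moreover have "k \<noteq> 0" "p' \<noteq> []" using p1(2) pk(2) unfolding word_pow_def by auto
    ultimately have "k = 1" by (cases k) auto
    then have "p1 = p'" using pk(2) by (simp add: word_pow_Suc)
    then show False using nc cyclic_perm_sym pk(1) by blast
  qed
  have ev: "eigenvalue (complexify (F2.W p1)) z \<Longrightarrow> cmod z \<le> q2" for z
    using q2(2) p1 np by (meson less_imp_le)
  \<comment> \<open>The words around the periodic piece cost \<open>K\<close> each, which leaves the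
    required \<open>1 / (2 * K)\<close>.\<close>
  have "1 / (2 * K * K * K) > 0" using K(1) by simp
  from F2.periodic_products_small[OF K(3) d2 p1(1,2) q2(1) ev this]
  obtain l where l: "l > 0" "\<And>b. periodic p1 b \<Longrightarrow> length b \<ge> l \<Longrightarrow> mnorm (F2.W b) < 1 / (2 * K * K * K)" by blast
  have "1 / (2 * K) > 0" using K(1) by simp
  from F1.small_or_periodic_factor[OF K(2) q1 this]
  obtain J where J: "J > 0" "\<And>w. w \<in> words m \<Longrightarrow> length w = J * l \<Longrightarrow>
     mnorm (F1.W w) < 1 / (2 * K) \<or> (\<exists>a b c. w = a @ b @ c \<and> length b = l \<and> periodic p1 b)" by blast
  show ?thesis
  proof (rule offdiag_bounded_of_fixed_length[OF K, of "J * l"])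
    show "J * l > 0" using J(1) l(1) by simp
    fix w assume w: "w \<in> words m" "length w = J * l"
    show "mnorm (F1.W w) \<le> 1 / (2 * K) \<or> mnorm (F2.W w) \<le> 1 / (2 * K)"
    proof (cases "mnorm (F1.W w) < 1 / (2 * K)")
      case False
      then obtain a b c where abc: "w = a @ b @ c" "length b = l" "periodic p1 b" using J(2)[OF w] by blast
      then have wd: "a \<in> words m" "b \<in> words m" "c \<in> words m" using w by auto
      have "mnorm (F2.W w) \<le> mnorm (F2.W a) * (mnorm (F2.W b) * mnorm (F2.W c))"
        unfolding abc(1) using wd by (intro order_trans[OF F2.mnorm_W_append] mult_left_mono F2.mnorm_W_append) auto
      also have "\<dots> \<le> K * (1 / (2 * K * K * K) * K)"
        using wd K l(2)[OF abc(3)] abc(2) by (intro mult_mono) auto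
      also have "\<dots> = 1 / (2 * K)" using K(1) by simp
      finally show ?thesis by simp
    qed auto
  qed
qed

lemma X1_pow_bounded: "mnorm (X1 ^\<^sub>m k) \<le> K" and X2_pow_bounded: "mnorm (X2 ^\<^sub>m k) \<le> K"
  using K(2,3)[OF words_word_pow[OF p1(1), of k]] F1.W_word_pow[OF p1(1)] F2.W_word_pow[OF p1(1)] by auto

text \<open>Without resonance the powers of the full product at \<open>p1\<close> are bounded, hence
  so is the off-diagonal block on powers of \<open>p1\<close>, which is all that the period-breaking
  estimate asks for.\<close>

lemma stable_of_not_resonant:
  assumes r1: "\<rho>1 = 1" and cp: "cyclic_perm p1 p2" and nr: "\<not> resonant"
  shows "\<exists>M. \<forall>w\<in>words m. mnorm (offdiag w) \<le> M"
proof -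
  have "cyclic_perm p1 p1" unfolding cyclic_perm_def by (metis rotate0 id_apply)
  then obtain q1 where q1: "dominates d1 m A1 q1 p1"
    using F1.dominant_word_dominates[OF r1 dom1] by blast
  \<comment> \<open>The hypothesis concerns \<open>p2\<close>; it moves to \<open>p1\<close> because
    the characteristic polynomials agree.\<close>
  have lead2': "unique_simple_leading X2"
    using leading_eigenvalues_cong(2)[OF F2.W_carrier F2.W_carrier F2.char_poly_cyclic_perm(2)[OF p1(1) cp]]
      F2.char_poly_cyclic_perm(1)[OF p1(1) cp] p1(1) lead2 by blast
  obtain M where M: "\<And>k. mnorm (F.W p1 ^\<^sub>m k) \<le> M"
    using pow_bounded_of_no_resonance[OF F.W_carrier[OF p1(1)] F1.W_carrier[OF p1(1)] F2.W_carrier[OF p1(1)]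
        char_poly_W[OF p1(1)] X1_pow_bounded X2_pow_bounded lead1 lead2' nr[unfolded resonant_def]] by blast
  have "mnorm (offdiag (word_pow p1 k)) \<le> mnorm P * mnorm Q * M" for k
  proof -
    have "mnorm (offdiag (word_pow p1 k)) \<le> mnorm P * mnorm Q * mnorm (F.W (word_pow p1 k))"
      using mnorm_block_le(3)[OF words_word_pow[OF p1(1)]] .
    also have "\<dots> \<le> mnorm P * mnorm Q * M"
      using M F.W_word_pow[OF p1(1)] by (intro mult_left_mono) auto
    finally show ?thesis .
  qed
  then show ?thesis using offdiag_bounded_of_periodic[OF K q1 p1(1)] by blast
qed

lemma unstable_imp:
  assumes "\<not> all_trajectories_bounded (d1 + d2) m A"
  shows "cyclic_perm p1 p2 \<and> resonant"
proof -
  have "\<not> (\<exists>M. \<forall>w\<in>words m. mnorm (offdiag w) \<le> M)"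
  proof
    assume "\<exists>M. \<forall>w\<in>words m. mnorm (offdiag w) \<le> M"
    then obtain M where M: "\<And>w. w \<in> words m \<Longrightarrow> mnorm (offdiag w) \<le> M" by blast
    have "mnorm (F.W w) \<le> mnorm P * mnorm Q * (K + M + K)" if w: "w \<in> words m" for w
    proof -
      have "mnorm P * mnorm Q * mnorm (WT w) \<le> mnorm P * mnorm Q * (K + M + K)"
        unfolding mnorm_word_prod_T[OF w] using K(2,3)[OF w] M[OF w] by (intro mult_left_mono) auto
      then show ?thesis using mnorm_W_le[OF w] by linarith
    qed
    then show False using F.all_trajectories_bounded_of_products assms by blast
  qed
  then have "\<rho>1 = 1" "\<rho>2 = 1" "cyclic_perm p1 p2" "resonant"
    using stable_of_jsr1_less stable_of_jsr2_less jsr_blocks_le stable_of_not_cyclic_perm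
      stable_of_not_resonant by (meson order_le_less)+
  then show ?thesis by simp
qed

text \<open>The Jordan block must be shown to sit on the unit circle. A diagonal family of joint
  spectral radius one has an eigenvalue of modulus at least one at the common word, and
  \<open>z\<close>, being leading for both, is at least as large. Boundedness of the powers gives
  the other inequality.\<close>

lemma resonant_pow_growth:
  assumes cp: "cyclic_perm p1 p2" and res: "resonant"
  shows "\<exists>c>0. \<forall>k. c * real k \<le> mnorm (F.W p1 ^\<^sub>m k)"
proof -
  obtain z where z: "z \<in> leading_eigenvalues X1" "z \<in> leading_eigenvalues X2" "nontrivial_jordan_block (F.W p1) z"
    using res unfolding resonant_def by auto
  have "\<exists>y. (eigenvalue (complexify X1) y \<or> eigenvalue (complexify X2) y) \<and> cmod y \<ge> 1"
    using jsr_block_eq_1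
  proof
    assume r: "\<rho>1 = 1"
    have "cyclic_perm p1 p1" unfolding cyclic_perm_def by (metis rotate0 id_apply)
    then obtain q where "dominates d1 m A1 q p1" using F1.dominant_word_dominates[OF r dom1] by blast
    then show ?thesis using F1.dominating_word_eigenvalue_ge_1[OF N m d1 K(2) r _ p1(1,2)] by blast
  next
    assume r: "\<rho>2 = 1"
    obtain q where "dominates d2 m A2 q p1"
      using F2.dominant_word_dominates[OF r dom2 cyclic_perm_sym[OF cp]] by blast
    then show ?thesis using F2.dominating_word_eigenvalue_ge_1[OF N m d2 K(3) r _ p1(1,2)] by blast
  qed
  then have "cmod z \<ge> 1" using z(1,2) unfolding leading_eigenvalues_def by force
  moreover have "eigenvalue (complexify X1) z" using z(1) unfolding leading_eigenvalues_def by simp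
  then have "cmod z \<le> 1"
    using eigenvalue_le_of_pow_bound[of X1 d1 z 1 K] F1.W_carrier[OF p1(1)] X1_pow_bounded by simp
  ultimately show ?thesis using pow_growth_of_jordan_block[OF F.W_carrier[OF p1(1)] z(3)] by simp
qed

lemma resonant_imp_unstable:
  assumes "cyclic_perm p1 p2" "resonant"
  shows "\<not> all_trajectories_bounded (d1 + d2) m A"
proof
  assume "all_trajectories_bounded (d1 + d2) m A"
  then obtain M where M: "\<And>k. mnorm (F.W p1 ^\<^sub>m k) \<le> M"
    using F.pow_bounded_of_all_trajectories_bounded p1 by blast
  obtain c where c: "c > 0" "\<And>k. c * real k \<le> mnorm (F.W p1 ^\<^sub>m k)"
    using resonant_pow_growth[OF assms] by blast
  obtain k where "real k * c > M" using reals_Archimedean3[OF c(1)] by blast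
  then show False using c(2)[of k] M[of k] by (simp add: mult.commute)
qed

text \<open>Powers of \<open>p1\<close> show growth only at multiples of its length. For other
  \<open>k\<close> a power of \<open>p1\<close> is cut after \<open>k\<close> letters, and
  submultiplicativity lets the short remainder cost a constant.\<close>

lemma resonant_imp_linear_growth:
  assumes "cyclic_perm p1 p2" "resonant"
  shows "\<exists>C1>0. \<exists>C2>0. \<forall>k\<ge>1. C1 * real k \<le> max_growth N (d1 + d2) m A k \<and> max_growth N (d1 + d2) m A k \<le> C2 * real k"
proof -
  let ?\<kappa> = "mnorm P * mnorm Q" and ?M = "max_growth N (d1 + d2) m A"
  obtain D where D: "D \<ge> 0" "\<And>w. w \<in> words m \<Longrightarrow> mnorm (offdiag w) \<le> D * real (length w)"
    using offdiag_linear[OF K] by blast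
  have up: "mnorm (F.W w) \<le> ?\<kappa> * (K + D * real (length w) + K)" if w: "w \<in> words m" for w
  proof -
    have "?\<kappa> * mnorm (WT w) \<le> ?\<kappa> * (K + D * real (length w) + K)"
      unfolding mnorm_word_prod_T[OF w] using K(2,3)[OF w] D(2)[OF w] by (intro mult_left_mono) auto
    then show ?thesis using mnorm_W_le[OF w] by linarith
  qed
  obtain n1 where n1: "n1 > 0" "\<And>X. X \<in> carrier_mat (d1 + d2) (d1 + d2) \<Longrightarrow> N X \<le> n1 * mnorm X"
    using mat_norm_le_mnorm[OF N] by blast
  obtain n2 where n2: "n2 > 0" "\<And>X. X \<in> carrier_mat (d1 + d2) (d1 + d2) \<Longrightarrow> mnorm X \<le> n2 * N X"
    using mnorm_le_mat_norm[OF N] by blast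
  obtain c where c: "c > 0" "\<And>k. c * real k \<le> mnorm (F.W p1 ^\<^sub>m k)"
    using resonant_pow_growth[OF assms] by blast
  define l where "l = length p1"
  have l: "l > 0" unfolding l_def using p1(2) by simp
  define E where "E = ?\<kappa> * (K + D * real l + K) + 1"
  have E: "E > 0" unfolding E_def using K(1) D(1) by (intro add_nonneg_pos mult_nonneg_nonneg) auto
  define c1 where "c1 = c / (real l * E * n2)"
  define c2 where "c2 = n1 * (?\<kappa> * (2 * K + D) + 1)"
  have lower: "c1 * real k \<le> ?M k" if k: "k \<ge> 1" for k
  proof -
    \<comment> \<open>Rounding up, possibly by a full period, ensures at least \<open>k\<close>
      letters and an overshoot of at most \<open>l\<close>.\<close>
    define i where "i = k div l + 1"
    have "l * (k div l) + k mod l = k" "k mod l < l" "i * l = l * (k div l) + l"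
      using l by (auto simp: i_def)
    then have il: "k \<le> i * l" "i * l - k \<le> l" by linarith+
    define u v where "u = take k (word_pow p1 i)" and "v = drop k (word_pow p1 i)"
    have uv: "word_pow p1 i = u @ v" "length u = k" "length v \<le> l"
      unfolding u_def v_def using il by (auto simp: l_def)
    have wd: "u \<in> words m" "v \<in> words m" using words_word_pow[OF p1(1), of i] unfolding uv(1) by auto
    have "mnorm (F.W v) \<le> ?\<kappa> * (K + D * real (length v) + K)" by (rule up[OF wd(2)])
    also have "\<dots> \<le> ?\<kappa> * (K + D * real l + K)"
      using uv(3) D(1) by (intro mult_left_mono add_mono) auto
    finally have vE: "mnorm (F.W v) \<le> E" unfolding E_def by simp
    have uM: "mnorm (F.W u) \<le> n2 * ?M k"
      using n2(2)[OF F.W_carrier[OF wd(1)]] max_growth_ge[OF wd(1) uv(2), of N "d1 + d2" A] n2(1)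
      by (meson mult_left_mono less_imp_le order_trans)
    have "real k \<le> real i * real l" using il(1) by (metis of_nat_le_iff of_nat_mult)
    then have "c * real k \<le> c * (real i * real l)" using c(1) by (intro mult_left_mono) auto
    also have "\<dots> = real l * (c * real i)" by simp
    also have "\<dots> \<le> real l * mnorm (F.W (u @ v))"
      using c(2)[of i] F.W_word_pow[OF p1(1), of i] unfolding uv(1) by (intro mult_left_mono) auto
    also have "\<dots> \<le> real l * (mnorm (F.W u) * mnorm (F.W v))"
      using wd by (intro mult_left_mono F.mnorm_W_append) auto
    also have "\<dots> \<le> real l * ((n2 * ?M k) * E)"
      using uM vE order_trans[OF mnorm_nonneg uM] by (intro mult_left_mono mult_mono) auto
    also have "\<dots> = ?M k * (real l * E * n2)" by simp
    finally show ?thesis unfolding c1_def using l E n2(1) by (simp add: pos_divide_le_eq)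
  qed
  have upper: "?M k \<le> c2 * real k" if k: "k \<ge> 1" for k
  proof -
    obtain w where w: "w \<in> words m" "length w = k" "?M k = N (F.W w)"
      using max_growth_attained[OF m] by blast
    have kge: "K \<le> K * real k" using k K(1) by simp
    have "K + D * real k + K \<le> (2 * K + D) * real k" using kge by (simp add: algebra_simps)
    then have "?\<kappa> * (K + D * real k + K) \<le> ?\<kappa> * ((2 * K + D) * real k)"
      by (intro mult_left_mono) auto
    also have "\<dots> \<le> (?\<kappa> * (2 * K + D) + 1) * real k" by (simp add: algebra_simps)
    finally have "mnorm (F.W w) \<le> (?\<kappa> * (2 * K + D) + 1) * real k"
      using up[OF w(1)] w(2) by simp
    then have "n1 * mnorm (F.W w) \<le> n1 * ((?\<kappa> * (2 * K + D) + 1) * real k)"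
      using n1(1) by (intro mult_left_mono) auto
    then show ?thesis unfolding c2_def w(3) using n1(2)[OF F.W_carrier[OF w(1)]] by (simp add: mult.assoc)
  qed
  have "c1 > 0" unfolding c1_def using c l E n2 by simp
  moreover have "c2 > 0" unfolding c2_def using n1 K(1) D(1)
    by (intro mult_pos_pos add_nonneg_pos mult_nonneg_nonneg) auto
  ultimately show ?thesis using lower upper by blast
qed

end

theorem theorem1:
  fixes N :: "real mat \<Rightarrow> real"
    and m d d1 d2 :: nat
    and A A1 A2 C :: "nat \<Rightarrow> real mat"
    and P Q :: "real mat"
    and p1 p2 :: "nat list"
  assumes "\<And>n. mat_norm n N"
    and "m > 0" and "d1 > 0" and "d2 > 0" and "d = d1 + d2"
    and "\<And>j. j < m \<Longrightarrow> A j \<in> carrier_mat d d"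
    and "\<And>j. j < m \<Longrightarrow> A1 j \<in> carrier_mat d1 d1"
    and "\<And>j. j < m \<Longrightarrow> A2 j \<in> carrier_mat d2 d2"
    and "\<And>j. j < m \<Longrightarrow> C j \<in> carrier_mat d1 d2"
    and "joint_spectral_radius N d m A = 1"
    and "reducible_family d m A"
    and "\<And>j. j < m \<Longrightarrow>
           similar_mat_wit (A j) (four_block_mat (A1 j) (C j) (0\<^sub>m d2 d1) (A2 j)) P Q"
    and "\<not> reducible_family d1 m A1"
    and "\<not> reducible_family d2 m A2"
    and "dominant_word N d1 m A1 p1" and "unique_simple_leading (word_prod d1 A1 p1)"
    and "dominant_word N d2 m A2 p2" and "unique_simple_leading (word_prod d2 A2 p2)"
  shows
    "(marginally_unstable N d m A \<longleftrightarrow>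
        cyclic_perm p1 p2 \<and>
        leading_eigenvalues (word_prod d1 A1 p1) = leading_eigenvalues (word_prod d2 A2 p1) \<and>
        (\<exists>z \<in> leading_eigenvalues (word_prod d1 A1 p1).
           nontrivial_jordan_block (word_prod d A p1) z)) \<and>
     (cyclic_perm p1 p2 \<and>
        leading_eigenvalues (word_prod d1 A1 p1) = leading_eigenvalues (word_prod d2 A2 p1) \<and>
        (\<exists>z \<in> leading_eigenvalues (word_prod d1 A1 p1).
           nontrivial_jordan_block (word_prod d A p1) z) \<longrightarrow>
        (\<exists>C1 > 0. \<exists>C2 > 0. \<forall>k \<ge> 1.
           C1 * real k \<le> max_growth N d m A k \<and> max_growth N d m A k \<le> C2 * real k))"
proof -
  interpret two_block_family d1 d2 m A1 A2 C A P Q N p1 p2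
    using assms by unfold_locales auto
  show ?thesis
    using unstable_imp resonant_imp_unstable resonant_imp_linear_growth
    unfolding marginally_unstable_def \<open>d = d1 + d2\<close> resonant_def jsr by blast
qed

end
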